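(* Let $T:\mathbb{R}^{2d}\to\mathbb{R}^{2d}$ be an invertible linear map, and write $$T^{-1}=\begin{pmatrix}A&B\\C&D\end{pmatrix}$$ with $A,B,C,D$ matrices of size $d\times d$. Let $\mu,\nu\in\mathcal{S}'(\mathbb{R}^d)$. If $\Pi_1\operatorname{supp}W_T(\mu,\nu)$ is a uniformly discrete set, then $$\det A\neq 0\ \Longrightarrow\ \operatorname{supp}\mu\text{ is uniformly discrete},$$ $$\det B\neq 0\ \Longrightarrow\ \operatorname{supp}\nu\text{ is uniformly discrete}.$$ In particular, for the classical Wigner transform $W(\mu,\nu)$ we have $$T^{-1}=\begin{pmatrix}\frac12\mathrm{Id}&\frac12\mathrm{Id}\\ \mathrm{Id}&-\mathrm{Id}\end{pmatrix},$$ where $\mathrm{Id}$ is the identity; therefore, as all subdeterminants are nonzero, $\Pi_1\operatorname{supp}W(\mu,\nu)$ uniformly discrete implies that both $\operatorname{supp}\mu$ and $\operatorname{supp}\nu$ are uniformly discrete.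
   Context: A set $E\subset\mathbb{R}^d$ is uniformly discrete if there is $\delta>0$ such that $|r-s|\ge\delta$ for all $r,s\in E$ with $r\ne s$. For $E\subset\mathbb{R}^{2d}=\mathbb{R}^d_x\times\mathbb{R}^d_\omega$, $\Pi_1(E)=\{x:\exists\,\omega,\ (x,\omega)\in E\}$. For an invertible linear map $T:\mathbb{R}^{2d}\to\mathbb{R}^{2d}$ the same letter denotes the matrix of the map and the change of coordinate operator $TF=F\circ T$, extended to $\mathcal{S}'(\mathbb{R}^{2d})$ in the natural way (pull-back). $\mathcal{F}_2$ is the partial Fourier transform $\mathcal{F}_2F(x,\omega)=\int_{\mathbb{R}^d}F(x,t)e^{-2\pi i\omega t}\,dt$, extended to $\mathcal{S}'(\mathbb{R}^{2d})$. The matrix-Wigner transform of $\mu,\nu\in\mathcal{S}'(\mathbb{R}^d)$ is $W_T(\mu,\nu)=\mathcal{F}_2\left(T(\mu\otimes\overline{\nu})\right)\in\mathcal{S}'(\mathbb{R}^{2d})$, where $\overline{\nu}$ is the complex conjugate distribution. The classical Wigner transform is $W(\mu,\nu)=W_{\mathcal{T}_s}(\mu,\nu)$ with $\mathcal{T}_s(x,t)=(x+\frac t2,x-\frac t2)$.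
   Formalization: The formal statement assumes ν ≠ 0 for the conclusion on supp μ and μ ≠ 0 for the conclusion on supp ν (also for the classical Wigner transform); without this the claim fails, e.g. for μ = 1, ν = 0, where W_T(μ,ν) = 0 has empty support. *)

theory Defs
  imports "HOL-Analysis.Analysis"
begin

section \<open>Schwartz functions\<close>

text \<open>Iterated partial derivatives along the coordinate directions in the given list; the head of
  the list is differentiated last.\<close>

primrec iterated_partial ::
    "'a list \<Rightarrow> ('a::euclidean_space \<Rightarrow> complex) \<Rightarrow> 'a \<Rightarrow> complex" where
  "iterated_partial [] f = f"
| "iterated_partial (b # bs) f = (\<lambda>x. frechet_derivative (iterated_partial bs f) (at x) b)"

definition smooth_fun :: "('a::euclidean_space \<Rightarrow> complex) \<Rightarrow> bool" where
  "smooth_fun f \<longleftrightarrow> (\<forall>bs \<in> lists Basis. iterated_partial bs f differentiable_on UNIV)"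

definition schwartz_space :: "('a::euclidean_space \<Rightarrow> complex) set" where
  "schwartz_space = {f. smooth_fun f \<and>
     (\<forall>k. \<forall>bs \<in> lists Basis.
        bdd_above (range (\<lambda>x. (1 + norm x) ^ k * norm (iterated_partial bs f x))))}"

definition schwartz_seminorm ::
    "nat \<Rightarrow> 'a list \<Rightarrow> ('a::euclidean_space \<Rightarrow> complex) \<Rightarrow> real" where
  "schwartz_seminorm k bs f = (SUP x. (1 + norm x) ^ k * norm (iterated_partial bs f x))"

definition schwartz_topology :: "('a::euclidean_space \<Rightarrow> complex) topology" where
  "schwartz_topology = topology_generated_by
     {{g \<in> schwartz_space. schwartz_seminorm k bs (\<lambda>x. g x - f x) < e} | f k bs e.
        f \<in> schwartz_space \<and> bs \<in> lists Basis \<and> 0 < e}"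

definition test_function :: "('a::euclidean_space \<Rightarrow> complex) \<Rightarrow> bool" where
  "test_function f \<longleftrightarrow> smooth_fun f \<and> compact (closure {x. f x \<noteq> 0})"


section \<open>Tempered distributions\<close>

text \<open>Functionals are total HOL functions, but only their values on Schwartz functions are
  meaningful; in particular a distribution is zero iff it vanishes on all Schwartz functions.\<close>

type_synonym 'a functional = "('a \<Rightarrow> complex) \<Rightarrow> complex"

definition tempered_distribution :: "('a::euclidean_space) functional \<Rightarrow> bool" where
  "tempered_distribution u \<longleftrightarrow>
     (\<forall>f \<in> schwartz_space. \<forall>g \<in> schwartz_space. u (\<lambda>x. f x + g x) = u f + u g) \<and>
     (\<forall>c. \<forall>f \<in> schwartz_space. u (\<lambda>x. c * f x) = c * u f) \<and>
     continuous_map schwartz_topology euclidean u"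

definition zero_distribution :: "('a::euclidean_space) functional \<Rightarrow> bool" where
  "zero_distribution u \<longleftrightarrow> (\<forall>f \<in> schwartz_space. u f = 0)"

definition vanishes_on :: "('a::euclidean_space) functional \<Rightarrow> 'a set \<Rightarrow> bool" where
  "vanishes_on u U \<longleftrightarrow>
     (\<forall>f. test_function f \<and> closure {x. f x \<noteq> 0} \<subseteq> U \<longrightarrow> u f = 0)"

definition distr_supp :: "('a::euclidean_space) functional \<Rightarrow> 'a set" where
  "distr_supp u = - \<Union>{U. open U \<and> vanishes_on u U}"

definition conj_distr :: "('a::euclidean_space) functional \<Rightarrow> 'a functional" where
  "conj_distr u = (\<lambda>f. cnj (u (\<lambda>x. cnj (f x))))"

text \<open>The slice-wise formula below is the tensor product: it is the tempered distribution
  determined by \<open>u(f) v(g)\<close> on products \<open>f(x) g(y)\<close>.\<close>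

definition tensor_distr ::
    "('a::euclidean_space) functional \<Rightarrow> ('b::euclidean_space) functional \<Rightarrow> ('a \<times> 'b) functional" where
  "tensor_distr u v = (\<lambda>f. u (\<lambda>x. v (\<lambda>y. f (x, y))))"


section \<open>Linear maps of the doubled space\<close>

text \<open>The space of dimension \<open>2d\<close> is the product \<open>real ^ 'n \<times> real ^ 'n\<close>; its
  matrices are indexed by \<open>'n + 'n\<close>, with \<open>Inl\<close> for the first and \<open>Inr\<close> for the second block.\<close>

definition join_vec :: "(real ^ 'n) \<times> (real ^ 'n) \<Rightarrow> real ^ ('n::finite + 'n)" where
  "join_vec z = (\<chi> i. case i of Inl j \<Rightarrow> fst z $ j | Inr j \<Rightarrow> snd z $ j)"

definition split_vec :: "real ^ ('n::finite + 'n) \<Rightarrow> (real ^ 'n) \<times> (real ^ 'n)" where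
  "split_vec v = (\<chi> j. v $ Inl j, \<chi> j. v $ Inr j)"

definition map_matrix2 ::
    "((real ^ 'n) \<times> (real ^ 'n) \<Rightarrow> (real ^ 'n) \<times> (real ^ 'n)) \<Rightarrow> real ^ ('n::finite + 'n) ^ ('n + 'n)" where
  "map_matrix2 T = matrix (\<lambda>v. join_vec (T (split_vec v)))"

definition block_matrix ::
    "real ^ 'n ^ 'n \<Rightarrow> real ^ 'n ^ 'n \<Rightarrow> real ^ 'n ^ 'n \<Rightarrow> real ^ 'n ^ 'n \<Rightarrow>
     real ^ ('n::finite + 'n) ^ ('n + 'n)" where
  "block_matrix A B C D = (\<chi> i j.
     case i of
       Inl k \<Rightarrow> (case j of Inl l \<Rightarrow> A $ k $ l | Inr l \<Rightarrow> B $ k $ l)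
     | Inr k \<Rightarrow> (case j of Inl l \<Rightarrow> C $ k $ l | Inr l \<Rightarrow> D $ k $ l))"

text \<open>Substituting \<open>w = T z\<close> in the integral of \<open>F(T z) f(z)\<close> shows that this is the
  extension of the operator \<open>F \<mapsto> F \<circ> T\<close> to distributions.\<close>

definition pullback_distr ::
    "((real ^ 'n) \<times> (real ^ 'n) \<Rightarrow> (real ^ 'n) \<times> (real ^ 'n)) \<Rightarrow>
     ((real ^ 'n::finite) \<times> (real ^ 'n)) functional \<Rightarrow> ((real ^ 'n) \<times> (real ^ 'n)) functional" where
  "pullback_distr T u =
     (\<lambda>f. complex_of_real (1 / \<bar>det (map_matrix2 T)\<bar>) * u (\<lambda>z. f (inv T z)))"


section \<open>The matrix-Wigner transform\<close>

definition partial_fourier ::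
    "((real ^ 'n::finite) \<times> (real ^ 'n) \<Rightarrow> complex) \<Rightarrow> (real ^ 'n) \<times> (real ^ 'n) \<Rightarrow> complex" where
  "partial_fourier f = (\<lambda>(x, w).
     \<integral>t. f (x, t) * exp (- 2 * complex_of_real pi * \<i> * complex_of_real (w \<bullet> t)) \<partial>lborel)"

text \<open>The partial Fourier transform is symmetric with respect to the bilinear pairing
  \<open>\<integral> F(z) f(z) dz\<close>, so it extends to tempered distributions by transposition.\<close>

definition partial_fourier_distr ::
    "((real ^ 'n::finite) \<times> (real ^ 'n)) functional \<Rightarrow> ((real ^ 'n) \<times> (real ^ 'n)) functional" where
  "partial_fourier_distr u = (\<lambda>f. u (partial_fourier f))"

definition matrix_wigner ::
    "((real ^ 'n) \<times> (real ^ 'n) \<Rightarrow> (real ^ 'n) \<times> (real ^ 'n)) \<Rightarrow>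
     (real ^ 'n::finite) functional \<Rightarrow> (real ^ 'n) functional \<Rightarrow> ((real ^ 'n) \<times> (real ^ 'n)) functional" where
  "matrix_wigner T u v =
     partial_fourier_distr (pullback_distr T (tensor_distr u (conj_distr v)))"

definition wigner_coord :: "(real ^ 'n::finite) \<times> (real ^ 'n) \<Rightarrow> (real ^ 'n) \<times> (real ^ 'n)" where
  "wigner_coord = (\<lambda>(x, t). (x + (1/2) *\<^sub>R t, x - (1/2) *\<^sub>R t))"

definition wigner ::
    "(real ^ 'n::finite) functional \<Rightarrow> (real ^ 'n) functional \<Rightarrow> ((real ^ 'n) \<times> (real ^ 'n)) functional" where
  "wigner u v = matrix_wigner wigner_coord u v"

end

theory Submission
  imports Defs
begin

text \<open>Write \<open>p (x, y) = A x + B y\<close> for the first component of \<open>T\<^sup>-\<^sup>1 (x, y)\<close>. The partial Fourier transform acts in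
the second variable only, so it does not change the projection of a support to the first variable, as long
as this projection is closed, which uniform discreteness guarantees. Since the support of the tensor
product of \<open>\<mu>\<close> and the conjugate of \<open>\<nu>\<close> is the product of the supports, \<open>p\<close> maps \<open>supp \<mu> \<times> supp \<nu>\<close> into the
projection of the support of the Wigner transform (\<open>support_relation\<close>). Fixing one point \<open>y\<close> of \<open>supp \<nu>\<close>,
which exists because \<open>\<nu>\<close> is nonzero, the affine map \<open>x \<mapsto> A x + B y\<close> sends \<open>supp \<mu>\<close> into a uniformly discrete
set; if \<open>A\<close> is invertible, \<open>supp \<mu>\<close> is uniformly discrete itself. The roles of \<open>\<mu>\<close> and \<open>\<nu>\<close> are symmetric.

The analytic part is to turn the first observation into a statement about test functions. Given a test
function \<open>h\<close> whose first variable avoids the projection, one wants to evaluate the Wigner transform at the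
inverse partial Fourier transform of \<open>h\<close>. That function is not compactly supported in frequency, so it is
multiplied by a window \<open>\<psi> (\<epsilon> w)\<close>. Transforming back gives a mollification of \<open>h\<close> by the Fourier transform of
the window (\<open>partial_ft_windowed\<close>), and the mollifications converge to \<open>h\<close> in the Schwartz topology
(\<open>mollify_error_bound\<close>) provided the kernel has mass one. Taking for \<open>\<psi>\<close> an autocorrelation makes the kernel
a squared modulus, hence of positive mass, and dividing by this mass normalises it (\<open>exists_kernel\<close>).

Passing to the limit needs continuity of the tensor product \<open>u (\<lambda>x. v (\<lambda>y. f (x, y)))\<close>, which is expressed
by bounds with finitely many seminorms (\<open>tempered_imp_bounded\<close>, \<open>bounded_functional_tensor\<close>). Two facts about
supports complete the argument: a functional vanishes on every test function whose support misses the support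
of the functional (\<open>vanishes_off_support\<close>), and a nonzero tempered distribution has nonempty support
(\<open>nonzero_imp_support_nonempty\<close>).\<close>

section \<open>Directional derivatives and smooth functions\<close>

text \<open>Directional derivatives along arbitrary vectors rather than along basis vectors only: for a linear map
\<open>L\<close> the derivative of \<open>f \<circ> L\<close> along \<open>v\<close> is the derivative of \<open>f\<close> along \<open>L v\<close>, which need not be
a basis vector.\<close>

definition pd :: "'a \<Rightarrow> ('a::euclidean_space \<Rightarrow> complex) \<Rightarrow> 'a \<Rightarrow> complex" where
  "pd v f = (\<lambda>x. frechet_derivative f (at x) v)"

text \<open>All partial derivatives of order at most \<open>n\<close> exist, are differentiable and satisfy \<open>Q\<close>. With trivial
\<open>Q\<close> this is smoothness, with rapid decrease it describes Schwartz functions, so one calculus serves both.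
The recursion peels off the derivative that is taken first; therefore closure of a class under an
operation follows by induction on \<open>n\<close> from the product, chain or quotient rule alone.\<close>

primrec regular :: "(('a \<Rightarrow> complex) \<Rightarrow> bool) \<Rightarrow> nat \<Rightarrow> ('a::euclidean_space \<Rightarrow> complex) \<Rightarrow> bool" where
  "regular Q 0 f \<longleftrightarrow> (\<forall>x. f differentiable (at x)) \<and> Q f"
| "regular Q (Suc n) f \<longleftrightarrow> (\<forall>x. f differentiable (at x)) \<and> Q f \<and> (\<forall>b\<in>Basis. regular Q n (pd b f))"

lemma pd_eq: "(f has_derivative f') (at x) \<Longrightarrow> pd v f x = f' v"
  unfolding pd_def by (metis frechet_derivative_at)

lemma pd_eq_coefficient:
  assumes "(f has_derivative (\<lambda>h. \<Sum>b\<in>Basis. of_real (h \<bullet> b) * c b)) (at x)" "b \<in> Basis"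
  shows "pd b f x = c b"
  unfolding pd_eq[OF assms(1)] using assms(2)
  by (simp add: inner_Basis if_distrib if_distribR sum.delta cong: if_cong)

lemma has_derivative_pd: "f differentiable (at x) \<Longrightarrow> (f has_derivative (\<lambda>v. pd v f x)) (at x)"
  unfolding pd_def by (simp add: frechet_derivative_works eta_contract_eq)

lemma linear_pd: "f differentiable (at x) \<Longrightarrow> linear (\<lambda>v. pd v f x)"
  using has_derivative_pd has_derivative_linear by blast

lemma pd_expand:
  assumes "f differentiable (at x)"
  shows "pd v f x = (\<Sum>b\<in>Basis. of_real (v \<bullet> b) * pd b f x)"
proof -
  have "pd v f x = pd (\<Sum>b\<in>Basis. (v \<bullet> b) *\<^sub>R b) f x" by (simp add: euclidean_representation)
  also have "\<dots> = (\<Sum>b\<in>Basis. (v \<bullet> b) *\<^sub>R pd b f x)"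
    using linear_sum[OF linear_pd[OF assms], of "\<lambda>b. (v \<bullet> b) *\<^sub>R b" Basis]
    by (simp add: linear_cmul[OF linear_pd[OF assms]])
  finally show ?thesis by (simp add: scaleR_conv_of_real)
qed

lemma iterated_partial_Cons_pd: "iterated_partial (b # bs) f = pd b (iterated_partial bs f)"
  by (simp add: pd_def)

declare iterated_partial.simps(2) [simp del]
declare iterated_partial_Cons_pd [simp]

lemma iterated_partial_append:
  "iterated_partial (bs @ cs) f = iterated_partial bs (iterated_partial cs f)"
  by (induction bs) auto

text \<open>The derivative taken first is the last entry of the list, hence the case split at the end of the list.\<close>

lemma regular_iff_upto:
  "regular Q n f \<longleftrightarrow> (\<forall>bs\<in>lists Basis. length bs \<le> n \<longrightarrow>
     (\<forall>x. iterated_partial bs f differentiable (at x)) \<and> Q (iterated_partial bs f))"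
proof (induction n arbitrary: f)
  case (Suc n)
  show ?case (is "?L \<longleftrightarrow> ?R")
  proof
    assume L: ?L
    show ?R
    proof (intro ballI impI)
      fix bs :: "'a list" assume bs: "bs \<in> lists Basis" "length bs \<le> Suc n"
      show "(\<forall>x. iterated_partial bs f differentiable (at x)) \<and> Q (iterated_partial bs f)"
      proof (cases bs rule: rev_cases)
        case (snoc cs b)
        with bs L Suc show ?thesis by (auto simp: iterated_partial_append)
      qed (use L in auto)
    qed
  next
    assume R: ?R
    have "regular Q n (pd b f)" if "b \<in> Basis" for b
      unfolding Suc
    proof (intro ballI impI)
      fix bs :: "'a list" assume bs: "bs \<in> lists Basis" "length bs \<le> n"
      then show "(\<forall>x. iterated_partial bs (pd b f) differentiable (at x)) \<and> Q (iterated_partial bs (pd b f))"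
        using R[rule_format, of "bs @ [b]"] that by (simp add: iterated_partial_append)
    qed
    with R[rule_format, of "[]"] show ?L by simp
  qed
qed auto

lemma regular_iff:
  "(\<forall>n. regular Q n f) \<longleftrightarrow> (\<forall>bs\<in>lists Basis.
     (\<forall>x. iterated_partial bs f differentiable (at x)) \<and> Q (iterated_partial bs f))"
  unfolding regular_iff_upto by blast

text \<open>For functions given by integrals: their partial derivatives are integrals of the same kind, so a whole
family is shown to be regular at once.\<close>

lemma regular_coinduct:
  assumes "P f"
    and "\<And>g. P g \<Longrightarrow> (\<forall>x. g differentiable (at x)) \<and> Q g \<and> (\<forall>b\<in>Basis. P (pd b g))"
  shows "regular Q n f"
  using assms(1) by (induction n arbitrary: f) (use assms(2) in auto)

lemma regularD: "regular Q n f \<Longrightarrow> f differentiable (at x)" "regular Q n f \<Longrightarrow> Q f"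
  by (cases n; auto)+

lemma regular_Suc_D: "regular Q (Suc n) f \<Longrightarrow> regular Q n f"
  by (simp add: regular_iff_upto)

definition additive_class :: "(('a \<Rightarrow> complex) \<Rightarrow> bool) \<Rightarrow> bool" where
  "additive_class Q \<longleftrightarrow> Q (\<lambda>x. 0) \<and> (\<forall>f g. Q f \<longrightarrow> Q g \<longrightarrow> Q (\<lambda>x. f x + g x)) \<and>
     (\<forall>c f. Q f \<longrightarrow> Q (\<lambda>x. c * f x))"

lemma additive_class_True [simp]: "additive_class (\<lambda>_. True)"
  by (simp add: additive_class_def)

lemma pd_add:
  assumes "\<And>x. f differentiable (at x)" "\<And>x. g differentiable (at x)"
  shows "pd b (\<lambda>x. f x + g x) = (\<lambda>x. pd b f x + pd b g x)"
  by (rule ext, rule pd_eq) (intro has_derivative_add has_derivative_pd assms)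

lemma pd_cmult:
  assumes "\<And>x. f differentiable (at x)"
  shows "pd b (\<lambda>x. c * f x) = (\<lambda>x. c * pd b f x)"
  by (rule ext, rule pd_eq) (intro has_derivative_mult_right has_derivative_pd assms)

lemma pd_mult:
  assumes "\<And>x. f differentiable (at x)" "\<And>x. g differentiable (at x)"
  shows "pd b (\<lambda>x. f x * g x) = (\<lambda>x. f x * pd b g x + pd b f x * g x)"
  by (rule ext, rule pd_eq) (intro has_derivative_mult has_derivative_pd assms)

lemma pd_const [simp]: "pd b (\<lambda>x. c) = (\<lambda>x. 0)"
  by (rule ext, rule pd_eq) simp

lemma regular_zero: "additive_class Q \<Longrightarrow> regular Q n (\<lambda>x. 0)"
  by (induction n) (auto simp: additive_class_def)

lemma regular_add:
  assumes "additive_class Q" "regular Q n f" "regular Q n g"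
  shows "regular Q n (\<lambda>x. f x + g x)"
  using assms(2,3)
proof (induction n arbitrary: f g)
  case 0 then show ?case using assms(1) by (auto simp: additive_class_def)
next
  case (Suc n) then show ?case using assms(1) by (auto simp: additive_class_def pd_add)
qed

lemma regular_cmult:
  assumes "additive_class Q" "regular Q n f"
  shows "regular Q n (\<lambda>x. c * f x)"
  using assms(2)
proof (induction n arbitrary: f)
  case 0 then show ?case using assms(1) by (auto simp: additive_class_def)
next
  case (Suc n) then show ?case using assms(1) by (auto simp: additive_class_def pd_cmult)
qed

lemma regular_sum:
  assumes "additive_class Q" "\<And>i. i \<in> I \<Longrightarrow> regular Q n (f i)"
  shows "regular Q n (\<lambda>x. \<Sum>i\<in>I. f i x)"
  using assms(2)
  by (induction I rule: infinite_finite_induct)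
     (auto simp: regular_zero[OF assms(1)] intro!: regular_add[OF assms(1)])

lemma regular_cnj:
  assumes "\<And>f. Q f \<Longrightarrow> Q (\<lambda>x. cnj (f x))" "regular Q n f"
  shows "regular Q n (\<lambda>x. cnj (f x))"
proof -
  have pdc: "pd b (\<lambda>x. cnj (f x)) = (\<lambda>x. cnj (pd b f x))" if "\<And>x. f differentiable (at x)"
    for f :: "'a \<Rightarrow> complex" and b
    by (rule ext, rule pd_eq) (intro has_derivative_cnj has_derivative_pd that)
  have d: "(\<lambda>x. cnj (f x)) differentiable (at x)" if "f differentiable (at x)" for f :: "'a \<Rightarrow> complex" and x
    using that unfolding differentiable_def by (blast intro: has_derivative_cnj)
  show ?thesis using assms(2)
    by (induction n arbitrary: f) (auto simp: pdc d assms(1))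
qed

lemma has_derivative_affine:
  fixes L :: "'a::euclidean_space \<Rightarrow> 'b::euclidean_space"
  assumes "linear L" and "f differentiable (at (L x + c))"
  shows "((\<lambda>x. f (L x + c)) has_derivative (\<lambda>v. pd (L v) f (L x + c))) (at x)"
proof -
  have "(L has_derivative L) (at x)"
    using assms(1) by (intro bounded_linear_imp_has_derivative) (simp add: linear_conv_bounded_linear)
  from has_derivative_add[OF this has_derivative_const[of c]]
  have "((\<lambda>x. L x + c) has_derivative L) (at x)" by simp
  from has_derivative_compose[OF this has_derivative_pd[OF assms(2)]] show ?thesis by simp
qed

lemma pd_affine:
  fixes L :: "'a::euclidean_space \<Rightarrow> 'b::euclidean_space"
  assumes "linear L" "\<And>x. f differentiable (at x)"
  shows "pd b (\<lambda>x. f (L x + c)) = (\<lambda>x. pd (L b) f (L x + c))"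
  by (rule ext, rule pd_eq[OF has_derivative_affine]) (simp_all add: assms)

text \<open>The partial derivatives of \<open>f \<circ> L\<close> are linear combinations of partial derivatives of \<open>f\<close>, composed with
\<open>L\<close>; this is why the class must be closed under sums and multiples.\<close>

lemma regular_affine:
  fixes L :: "'a::euclidean_space \<Rightarrow> 'b::euclidean_space"
  assumes L: "linear L" and Q: "additive_class Q'" "\<And>f. Q f \<Longrightarrow> Q' (\<lambda>x. f (L x + c))"
    and f: "regular Q n f"
  shows "regular Q' n (\<lambda>x. f (L x + c))"
proof -
  have D: "(\<lambda>x. f (L x + c)) differentiable (at x)" if "\<forall>x. f differentiable (at x)" for f :: "'b \<Rightarrow> complex" and x
    using has_derivative_affine[OF L, of f x c] that unfolding differentiable_def by blast
  show ?thesis using f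
  proof (induction n arbitrary: f)
    case 0
    then show ?case using Q(2) D by auto
  next
    case (Suc n)
    then have d: "\<And>x. f differentiable (at x)" by auto
    have "regular Q' n (pd b (\<lambda>x. f (L x + c)))" for b
    proof -
      have "pd b (\<lambda>x. f (L x + c)) = (\<lambda>x. \<Sum>i\<in>Basis. of_real (L b \<bullet> i) * pd i f (L x + c))"
        unfolding pd_affine[OF L d] by (intro ext pd_expand d)
      moreover have "regular Q' n (\<lambda>x. \<Sum>i\<in>Basis. of_real (L b \<bullet> i) * pd i f (L x + c))"
        by (intro regular_sum regular_cmult Q(1) Suc.IH) (use Suc.prems in auto)
      ultimately show ?thesis by simp
    qed
    then show ?case using Suc.prems Q(2) D[rule_format] by auto
  qed
qed

abbreviation smooth_upto :: "nat \<Rightarrow> ('a::euclidean_space \<Rightarrow> complex) \<Rightarrow> bool" where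
  "smooth_upto \<equiv> regular (\<lambda>_. True)"

lemma smooth_upto_mult:
  "smooth_upto n f \<Longrightarrow> smooth_upto n g \<Longrightarrow> smooth_upto n (\<lambda>x. f x * g x)"
proof (induction n arbitrary: f g)
  case 0 then show ?case by (auto intro: differentiable_mult)
next
  case (Suc n)
  have "smooth_upto n f" "smooth_upto n g" using Suc.prems regular_Suc_D by blast+
  with Suc show ?case
    by (auto intro!: differentiable_mult regular_add simp: pd_mult)
qed

lemma smooth_upto_inverse:
  "smooth_upto n f \<Longrightarrow> (\<And>x. f x \<noteq> 0) \<Longrightarrow> smooth_upto n (\<lambda>x. inverse (f x))"
proof (induction n)
  case 0 then show ?case by (auto intro: differentiable_inverse)
next
  case (Suc n)
  have d: "f differentiable (at x)" for x using Suc.prems by auto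
  have n: "smooth_upto n f" using Suc.prems regular_Suc_D by blast
  have pdi: "pd b (\<lambda>x. inverse (f x)) = (\<lambda>x. (-1) * (inverse (f x) * (pd b f x * inverse (f x))))" for b
    by (rule ext, rule pd_eq) (auto intro!: derivative_eq_intros has_derivative_pd[OF d] simp: Suc.prems)
  have "smooth_upto n (pd b (\<lambda>x. inverse (f x)))" if "b \<in> Basis" for b
    unfolding pdi by (intro regular_cmult smooth_upto_mult Suc.IH n additive_class_True) (use Suc.prems that in auto)
  with Suc.prems show ?case by (auto intro!: differentiable_inverse)
qed

lemma has_derivative_exp_comp:
  fixes f :: "'a::euclidean_space \<Rightarrow> complex"
  assumes "f differentiable (at x)"
  shows "((\<lambda>x. exp (f x)) has_derivative (\<lambda>b. pd b f x * exp (f x))) (at x)"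
  using has_derivative_compose[OF has_derivative_pd[OF assms] DERIV_exp[of "f x", unfolded has_field_derivative_def]]
  by (simp add: mult.commute)

lemma smooth_upto_exp:
  "smooth_upto n f \<Longrightarrow> smooth_upto n (\<lambda>x. exp (f x))"
proof (induction n)
  case 0
  then have "((\<lambda>x. exp (f x)) has_derivative (\<lambda>b. pd b f x * exp (f x))) (at x)" for x
    by (intro has_derivative_exp_comp) auto
  then show ?case unfolding regular.simps differentiable_def by blast
next
  case (Suc n)
  have d: "f differentiable (at x)" for x using Suc.prems by auto
  have n: "smooth_upto n f" using Suc.prems regular_Suc_D by blast
  have hd: "((\<lambda>x. exp (f x)) has_derivative (\<lambda>b. pd b f x * exp (f x))) (at x)" for x
    by (intro has_derivative_exp_comp d)
  then have "pd b (\<lambda>x. exp (f x)) = (\<lambda>x. pd b f x * exp (f x))" for b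
    using pd_eq by blast
  moreover have "(\<lambda>x. exp (f x)) differentiable (at x)" for x using hd differentiable_def by blast
  ultimately show ?case using Suc n by (auto intro!: smooth_upto_mult)
qed

lemma smooth_fun_iff: "smooth_fun f \<longleftrightarrow> (\<forall>n. smooth_upto n f)"
  unfolding smooth_fun_def regular_iff by (simp add: differentiable_on_def)

lemma smooth_fun_mult: "smooth_fun f \<Longrightarrow> smooth_fun g \<Longrightarrow> smooth_fun (\<lambda>x. f x * g x)"
  by (simp add: smooth_fun_iff smooth_upto_mult)
lemma smooth_fun_add: "smooth_fun f \<Longrightarrow> smooth_fun g \<Longrightarrow> smooth_fun (\<lambda>x. f x + g x)"
  by (simp add: smooth_fun_iff regular_add)
lemma smooth_fun_cmult: "smooth_fun f \<Longrightarrow> smooth_fun (\<lambda>x. c * f x)"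
  by (simp add: smooth_fun_iff regular_cmult)
lemma smooth_fun_sum: "(\<And>i. i \<in> I \<Longrightarrow> smooth_fun (f i)) \<Longrightarrow> smooth_fun (\<lambda>x. \<Sum>i\<in>I. f i x)"
  by (simp add: smooth_fun_iff regular_sum)
lemma smooth_fun_exp: "smooth_fun f \<Longrightarrow> smooth_fun (\<lambda>x. exp (f x))"
  by (simp add: smooth_fun_iff smooth_upto_exp)
lemma smooth_fun_inverse: "smooth_fun f \<Longrightarrow> (\<And>x. f x \<noteq> 0) \<Longrightarrow> smooth_fun (\<lambda>x. inverse (f x))"
  by (simp add: smooth_fun_iff smooth_upto_inverse)
lemma smooth_fun_cnj: "smooth_fun f \<Longrightarrow> smooth_fun (\<lambda>x. cnj (f x))"
  by (simp add: smooth_fun_iff regular_cnj)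
lemma smooth_fun_affine: "smooth_fun f \<Longrightarrow> linear L \<Longrightarrow> smooth_fun (\<lambda>x. f (L x + c))"
  unfolding smooth_fun_iff
  by (intro allI regular_affine[where Q="\<lambda>_. True" and Q'="\<lambda>_. True"]) auto
lemma smooth_fun_const: "smooth_fun (\<lambda>x. c)"
proof -
  have "smooth_upto n (\<lambda>x::'a. c)" for n
    by (cases n) (auto simp: regular_zero)
  then show ?thesis by (simp add: smooth_fun_iff)
qed
lemma smooth_fun_prod: "(\<And>i. i \<in> I \<Longrightarrow> smooth_fun (f i)) \<Longrightarrow> smooth_fun (\<lambda>x. \<Prod>i\<in>I. f i x)"
  by (induction I rule: infinite_finite_induct) (auto intro!: smooth_fun_const smooth_fun_mult)
lemma smooth_fun_linear:
  assumes "linear l" shows "smooth_fun (\<lambda>x. complex_of_real (l x))"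
proof -
  have hd: "((\<lambda>x. complex_of_real (l x)) has_derivative (\<lambda>v. complex_of_real (l v))) (at x)" for x
    using assms
    by (intro bounded_linear_imp_has_derivative bounded_linear_compose[OF bounded_linear_of_real])
       (simp add: linear_conv_bounded_linear)
  then have "pd b (\<lambda>x. complex_of_real (l x)) = (\<lambda>x. complex_of_real (l b))" for b
    using pd_eq by blast
  moreover have "smooth_upto n (\<lambda>x::'a. c)" for n c
    using smooth_fun_const smooth_fun_iff by blast
  moreover have "(\<lambda>x. complex_of_real (l x)) differentiable (at x)" for x using hd differentiable_def by blast
  ultimately have "smooth_upto n (\<lambda>x. complex_of_real (l x))" for n
    by (cases n) auto
  then show ?thesis by (simp add: smooth_fun_iff)
qed

lemma smooth_fun_pd:
  assumes "smooth_fun f" shows "smooth_fun (pd v f)"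
proof -
  have d: "f differentiable (at x)" for x using assms regularD unfolding smooth_fun_iff by blast
  have "pd v f = (\<lambda>x. \<Sum>b\<in>Basis. of_real (v \<bullet> b) * pd b f x)" by (intro ext pd_expand d)
  moreover have "smooth_fun (pd b f)" if "b \<in> Basis" for b
  proof -
    have "smooth_upto (Suc n) f" for n using assms smooth_fun_iff by blast
    then show ?thesis using that by (auto simp: smooth_fun_iff)
  qed
  then have "smooth_fun (\<lambda>x. \<Sum>b\<in>Basis. of_real (v \<bullet> b) * pd b f x)"
    by (intro smooth_fun_sum smooth_fun_cmult)
  ultimately show ?thesis by (simp only:)
qed

lemma smooth_fun_iterated_partial: "smooth_fun f \<Longrightarrow> smooth_fun (iterated_partial bs f)"
  by (induction bs) (auto intro: smooth_fun_pd)

lemma smooth_fun_differentiable: "smooth_fun f \<Longrightarrow> f differentiable (at x)"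
  using regularD unfolding smooth_fun_iff by blast

lemma smooth_fun_continuous: "smooth_fun f \<Longrightarrow> continuous_on S f"
  by (meson continuous_at_imp_continuous_on differentiable_imp_continuous_within smooth_fun_differentiable)

lemma smooth_fun_coinduct:
  assumes "P f"
    and "\<And>g. P g \<Longrightarrow> (\<forall>x. g differentiable (at x)) \<and> (\<forall>b\<in>Basis. P (pd b g))"
  shows "smooth_fun f"
  unfolding smooth_fun_iff by (intro allI regular_coinduct[where P=P]) (use assms in auto)

lemma norm_pd_le:
  fixes M :: real
  assumes "f differentiable (at x)" "\<And>b. b \<in> Basis \<Longrightarrow> norm (pd b f x) \<le> M"
  shows "norm (pd v f x) \<le> real DIM('a) * M * norm (v::'a::euclidean_space)"
proof -
  have "norm (pd v f x) \<le> (\<Sum>b\<in>Basis. norm (of_real (v \<bullet> b) * pd b f x))"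
    unfolding pd_expand[OF assms(1), of v] by (rule norm_sum)
  also have "\<dots> \<le> (\<Sum>b\<in>(Basis::'a set). norm v * M)"
    using assms(2) by (intro sum_mono) (auto simp: norm_mult intro!: mult_mono Basis_le_norm)
  finally show ?thesis by (simp add: mult_ac)
qed

lemma smooth_diff_bound:
  fixes f :: "'a::euclidean_space \<Rightarrow> complex" and M :: real
  assumes "smooth_fun f"
    and "\<And>w b. w \<in> closed_segment z (z + h) \<Longrightarrow> b \<in> Basis \<Longrightarrow> norm (pd b f w) \<le> M"
  shows "norm (f (z + h) - f z) \<le> real DIM('a) * M * norm h"
proof -
  have "norm (f (z + h) - f z) \<le> (real DIM('a) * M) * norm ((z + h) - z)"
  proof (rule differentiable_bound[where S="closed_segment z (z + h)" and f'="\<lambda>x v. pd v f x"])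
    fix w assume w: "w \<in> closed_segment z (z + h)"
    show "(f has_derivative (\<lambda>v. pd v f w)) (at w within closed_segment z (z + h))"
      using has_derivative_at_withinI has_derivative_pd smooth_fun_differentiable[OF assms(1)] by blast
    show "onorm (\<lambda>v. pd v f w) \<le> real DIM('a) * M"
      using norm_pd_le[OF smooth_fun_differentiable[OF assms(1)] assms(2)[OF w]]
      by (rule onorm_le)
  qed auto
  then show ?thesis by simp
qed

lemma path_has_vector_derivative:
  assumes "smooth_fun g"
  shows "((\<lambda>t. g (w + t *\<^sub>R v)) has_vector_derivative pd v g (w + t *\<^sub>R v)) (at t within S)"
proof -
  have "((\<lambda>t. w + t *\<^sub>R v) has_derivative (\<lambda>s. s *\<^sub>R v)) (at t)"
    by (auto intro!: derivative_eq_intros)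
  from has_derivative_compose[OF this has_derivative_pd[OF smooth_fun_differentiable[OF assms]]]
  have "((\<lambda>t. g (w + t *\<^sub>R v)) has_derivative (\<lambda>s. pd (s *\<^sub>R v) g (w + t *\<^sub>R v))) (at t)" .
  then show ?thesis
    unfolding has_vector_derivative_def linear_cmul[OF linear_pd[OF smooth_fun_differentiable[OF assms]]]
    by (rule has_derivative_at_withinI)
qed

text \<open>Integrating \<open>pd b f\<close> along \<open>b\<close> gives \<open>f (w + t b) - f w\<close>. For \<open>w = z + s a\<close>, differentiate both sides
in \<open>s\<close> at \<open>0\<close>, under the integral sign on the left, and then in \<open>t\<close> at \<open>0\<close>.\<close>

lemma pd_commute:
  assumes f: "smooth_fun f"
  shows "pd a (pd b f) = pd b (pd a f)"
proof
  fix z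
  note sb = smooth_fun_pd[OF f, of b] and sab = smooth_fun_pd[OF smooth_fun_pd[OF f], of a b]
  have cont: "continuous_on S (\<lambda>t. g (w + t *\<^sub>R b))" if "smooth_fun g" for g w and S :: "real set"
    by (rule continuous_on_compose2[OF smooth_fun_continuous[OF that, of UNIV]]) (auto intro!: continuous_intros)
  have "pd a f (z + t *\<^sub>R b) - pd a f z = integral {0..t} (\<lambda>\<tau>. pd a (pd b f) (z + \<tau> *\<^sub>R b))" if t: "0 \<le> t" for t
  proof -
    have FTC: "integral {0..t} (\<lambda>\<tau>. pd b f (z + \<tau> *\<^sub>R b + s *\<^sub>R a)) = f (z + t *\<^sub>R b + s *\<^sub>R a) - f (z + s *\<^sub>R a)" for s
      using fundamental_theorem_of_calculus[OF t path_has_vector_derivative[OF f, of "z + s *\<^sub>R a" b], THEN integral_unique]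
      by (simp add: add.assoc add.commute[of "s *\<^sub>R a"])
    have "((\<lambda>s. integral (cbox 0 t) (\<lambda>\<tau>. pd b f (z + \<tau> *\<^sub>R b + s *\<^sub>R a))) has_vector_derivative
        integral (cbox 0 t) (\<lambda>\<tau>. pd a (pd b f) (z + \<tau> *\<^sub>R b + 0 *\<^sub>R a))) (at 0 within UNIV)"
    proof (rule leibniz_rule_vector_derivative)
      show "(\<lambda>\<tau>. pd b f (z + \<tau> *\<^sub>R b + s *\<^sub>R a)) integrable_on cbox 0 t" for s
        using integrable_continuous[OF cont[OF sb, of "cbox 0 t" "z + s *\<^sub>R a"]] by (simp add: add_ac)
      show "continuous_on (UNIV \<times> cbox 0 t) (\<lambda>(s, \<tau>). pd a (pd b f) (z + \<tau> *\<^sub>R b + s *\<^sub>R a))"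
        unfolding case_prod_beta
        by (rule continuous_on_compose2[OF smooth_fun_continuous[OF sab, of UNIV]]) (auto intro!: continuous_intros)
    qed (auto intro: path_has_vector_derivative sb)
    moreover have "((\<lambda>s. f (z + t *\<^sub>R b + s *\<^sub>R a) - f (z + s *\<^sub>R a)) has_vector_derivative
        pd a f (z + t *\<^sub>R b + 0 *\<^sub>R a) - pd a f (z + 0 *\<^sub>R a)) (at 0)"
      by (intro has_vector_derivative_diff path_has_vector_derivative f)
    ultimately show ?thesis using vector_derivative_unique_at by (fastforce simp: FTC)
  qed
  then have eq: "pd a f (z + t *\<^sub>R b) - pd a f z = integral {0..t} (\<lambda>\<tau>. pd a (pd b f) (z + \<tau> *\<^sub>R b))" if "t \<in> {0..1}" for t
    using that by auto
  have "((\<lambda>t. integral {0..t} (\<lambda>\<tau>. pd a (pd b f) (z + \<tau> *\<^sub>R b))) has_vector_derivative pd a (pd b f) z) (at 0 within {0..1})"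
    using integral_has_vector_derivative[OF cont[OF sab, where w=z], of 0 0 1] by simp
  then have "((\<lambda>t. pd a f (z + t *\<^sub>R b) - pd a f z) has_vector_derivative pd a (pd b f) z) (at 0 within {0..1})"
    by (rule has_vector_derivative_transform[rotated 2]) (auto simp: eq)
  moreover have "((\<lambda>t. pd a f (z + t *\<^sub>R b) - pd a f z) has_vector_derivative pd b (pd a f) (z + 0 *\<^sub>R b) - 0) (at 0 within {0..1})"
    by (intro has_vector_derivative_diff path_has_vector_derivative smooth_fun_pd f has_vector_derivative_const)
  ultimately show "pd a (pd b f) z = pd b (pd a f) z"
    using vector_derivative_unique_within_closed_interval[of 0 1 0] by fastforce
qed

text \<open>Every differentiation under an integral or under a functional rests on this quadratic remainder. The
derivative along \<open>v\<close> at two points of the segment differs by at most the second derivatives times the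
distance; commuting \<open>pd b\<close> with \<open>pd v\<close> reduces these to derivatives along basis vectors.\<close>

lemma smooth_taylor_bound:
  fixes f :: "'a::euclidean_space \<Rightarrow> complex" and M :: real
  assumes f: "smooth_fun f"
    and M: "\<And>w b c. w \<in> closed_segment z (z + h) \<Longrightarrow> b \<in> Basis \<Longrightarrow> c \<in> Basis \<Longrightarrow> norm (pd c (pd b f) w) \<le> M"
  shows "norm (f (z + h) - f z - pd h f z) \<le> real DIM('a)^2 * M * (norm h)^2"
proof -
  let ?d = "real DIM('a)"
  have "norm (f (z + h) - f z - pd (z + h - z) f z) \<le> norm (z + h - z) * (?d * ?d * M * norm h)"
  proof (rule differentiable_bound_linearization[where S="closed_segment z (z + h)" and f'="\<lambda>x v. pd v f x"])
    show "z + t *\<^sub>R (z + h - z) \<in> closed_segment z (z + h)" if "t \<in> {0..1}" for t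
      using that by (auto simp: in_segment algebra_simps)
    show "(f has_derivative (\<lambda>v. pd v f w)) (at w within closed_segment z (z + h))" for w
      by (rule has_derivative_at_withinI[OF has_derivative_pd[OF smooth_fun_differentiable[OF f]]])
    fix w assume w: "w \<in> closed_segment z (z + h)"
    have M0: "0 \<le> M" using M[OF w SOME_Basis SOME_Basis] norm_ge_zero order_trans by blast
    show "onorm ((\<lambda>v. pd v f w) - (\<lambda>v. pd v f z)) \<le> ?d * ?d * M * norm h"
    proof (rule onorm_le)
      fix v :: 'a
      have "norm (pd v f (z + (w - z)) - pd v f z) \<le> ?d * (?d * M * norm v) * norm (w - z)"
      proof (rule smooth_diff_bound[OF smooth_fun_pd[OF f]])
        fix u b :: 'a assume "u \<in> closed_segment z (z + (w - z))" and b: "b \<in> Basis"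
        then have "u \<in> closed_segment z (z + h)"
          using w subset_closed_segment[of z w z "z + h"] by auto
        then show "norm (pd b (pd v f) u) \<le> ?d * M * norm v"
          unfolding pd_commute[OF f, of b v]
          by (intro norm_pd_le smooth_fun_differentiable smooth_fun_pd f M b)
      qed
      also have "\<dots> \<le> ?d * (?d * M * norm v) * norm h"
        using segment_bound1[OF w] M0 by (intro mult_left_mono) auto
      finally show "norm (((\<lambda>v. pd v f w) - (\<lambda>v. pd v f z)) v) \<le> ?d * ?d * M * norm h * norm v"
        by (simp add: mult_ac)
    qed
  qed simp
  then show ?thesis by (simp add: power2_eq_square mult_ac)
qed

lemma smooth_family_bounded_on_compact:
  assumes "finite I" "compact C" "\<And>i. i \<in> I \<Longrightarrow> smooth_fun (f i)"
  shows "\<exists>M. \<forall>i\<in>I. \<forall>w\<in>C. norm (f i w) \<le> M"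
proof -
  have "bounded (\<Union>i\<in>I. f i ` C)"
    by (intro bounded_UN assms ballI compact_imp_bounded compact_continuous_image smooth_fun_continuous)
  then show ?thesis unfolding bounded_iff by blast
qed

section \<open>Schwartz functions and test functions\<close>

definition rapid :: "('a::euclidean_space \<Rightarrow> complex) \<Rightarrow> bool" where
  "rapid f \<longleftrightarrow> (\<forall>k. \<exists>B. \<forall>x. (1 + norm x) ^ k * norm (f x) \<le> B)"

lemma schwartz_iff: "f \<in> schwartz_space \<longleftrightarrow> (\<forall>n. regular rapid n f)"
proof -
  have "rapid g \<longleftrightarrow> (\<forall>k. bdd_above (range (\<lambda>x. (1 + norm x) ^ k * norm (g x))))" for g :: "'a \<Rightarrow> complex"
    by (auto simp: rapid_def bdd_above_def)
  then show ?thesis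
    unfolding regular_iff schwartz_space_def smooth_fun_def by (auto simp: differentiable_on_def)
qed

lemma additive_class_rapid [simp]: "additive_class rapid"
  unfolding additive_class_def
proof (intro conjI allI impI)
  show "rapid (\<lambda>x. 0)" by (auto simp: rapid_def)
next
  fix f g :: "'a \<Rightarrow> complex" assume f: "rapid f" and g: "rapid g"
  show "rapid (\<lambda>x. f x + g x)" unfolding rapid_def
  proof
    fix k
    obtain B1 B2 where B: "\<And>x. (1 + norm x) ^ k * norm (f x) \<le> B1" "\<And>x. (1 + norm x) ^ k * norm (g x) \<le> B2"
      using f g unfolding rapid_def by meson
    have "(1 + norm x) ^ k * norm (f x + g x) \<le> B1 + B2" for x
    proof -
      have "(1 + norm x) ^ k * norm (f x + g x) \<le> (1 + norm x) ^ k * (norm (f x) + norm (g x))"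
        by (intro mult_left_mono norm_triangle_ineq) auto
      then show ?thesis using B[of x] by (simp add: distrib_left)
    qed
    then show "\<exists>B. \<forall>x. (1 + norm x) ^ k * norm (f x + g x) \<le> B" by blast
  qed
next
  fix f :: "'a \<Rightarrow> complex" and c assume f: "rapid f"
  show "rapid (\<lambda>x. c * f x)" unfolding rapid_def
  proof
    fix k
    obtain B1 where B: "\<And>x. (1 + norm x) ^ k * norm (f x) \<le> B1"
      using f unfolding rapid_def by meson
    have "(1 + norm x) ^ k * norm (c * f x) \<le> norm c * B1" for x
      using mult_left_mono[OF B[of x], of "norm c"] by (simp add: norm_mult mult_ac)
    then show "\<exists>B. \<forall>x. (1 + norm x) ^ k * norm (c * f x) \<le> B" by blast
  qed
qed

lemma schwartz_smooth: "f \<in> schwartz_space \<Longrightarrow> smooth_fun f"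
  by (simp add: schwartz_space_def)

lemma schwartz_add: "f \<in> schwartz_space \<Longrightarrow> g \<in> schwartz_space \<Longrightarrow> (\<lambda>x. f x + g x) \<in> schwartz_space"
  by (simp add: schwartz_iff regular_add)

lemma schwartz_cmult: "f \<in> schwartz_space \<Longrightarrow> (\<lambda>x. c * f x) \<in> schwartz_space"
  by (simp add: schwartz_iff regular_cmult)

lemma schwartz_diff: "f \<in> schwartz_space \<Longrightarrow> g \<in> schwartz_space \<Longrightarrow> (\<lambda>x. f x - g x) \<in> schwartz_space"
  using schwartz_add[OF _ schwartz_cmult[of g "-1"], of f] by simp

lemma schwartz_zero: "(\<lambda>x. 0) \<in> schwartz_space"
  by (simp add: schwartz_iff regular_zero)

lemma schwartz_sum: "(\<And>i. i \<in> I \<Longrightarrow> f i \<in> schwartz_space) \<Longrightarrow> (\<lambda>x. \<Sum>i\<in>I. f i x) \<in> schwartz_space"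
  by (simp add: schwartz_iff regular_sum)

lemma schwartz_cnj: "f \<in> schwartz_space \<Longrightarrow> (\<lambda>x. cnj (f x)) \<in> schwartz_space"
  unfolding schwartz_iff by (intro allI regular_cnj) (auto simp: rapid_def)

lemma schwartz_pd: "f \<in> schwartz_space \<Longrightarrow> b \<in> Basis \<Longrightarrow> pd b f \<in> schwartz_space"
  unfolding schwartz_iff by (metis regular.simps(2))

lemma schwartz_iterated:
  "f \<in> schwartz_space \<Longrightarrow> bs \<in> lists Basis \<Longrightarrow> iterated_partial bs f \<in> schwartz_space"
  by (induction bs) (auto intro: schwartz_pd)

lemma schwartz_coinduct:
  assumes "P f"
    and "\<And>g. P g \<Longrightarrow> (\<forall>x. g differentiable (at x)) \<and> rapid g \<and> (\<forall>b\<in>Basis. P (pd b g))"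
  shows "f \<in> schwartz_space"
  unfolding schwartz_iff by (intro allI regular_coinduct[where P=P]) (use assms in auto)

text \<open>The growth condition says that \<open>L x + c\<close> is large whenever \<open>x\<close> is, so that rapid decrease survives the
composition; injective linear maps and coordinate slices satisfy it.\<close>

lemma schwartz_affine:
  fixes L :: "'a::euclidean_space \<Rightarrow> 'b::euclidean_space"
  assumes f: "f \<in> schwartz_space" and L: "linear L"
    and C: "\<And>x. 1 + norm x \<le> C * (1 + norm (L x + c))"
  shows "(\<lambda>x. f (L x + c)) \<in> schwartz_space"
  unfolding schwartz_iff
proof (intro allI regular_affine[OF L, where Q=rapid])
  fix f :: "'b \<Rightarrow> complex" assume "rapid f"
  show "rapid (\<lambda>x. f (L x + c))" unfolding rapid_def
  proof
    fix k
    obtain B where B: "\<And>x. (1 + norm x) ^ k * norm (f x) \<le> B"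
      using \<open>rapid f\<close> unfolding rapid_def by meson
    have C0: "0 \<le> C" using C[of 0] by (smt (verit) mult_nonneg_nonneg mult_neg_pos norm_ge_zero norm_zero)
    have "(1 + norm x) ^ k * norm (f (L x + c)) \<le> C ^ k * B" for x
    proof -
      have "(1 + norm x) ^ k * norm (f (L x + c)) \<le> (C * (1 + norm (L x + c))) ^ k * norm (f (L x + c))"
        by (intro mult_right_mono power_mono C) auto
      also have "\<dots> \<le> C ^ k * B"
        using mult_left_mono[OF B[of "L x + c"], of "C ^ k"] C0 by (simp add: power_mult_distrib mult_ac)
      finally show ?thesis .
    qed
    then show "\<exists>B. \<forall>x. (1 + norm x) ^ k * norm (f (L x + c)) \<le> B" by blast
  qed
qed (use f in \<open>auto simp: schwartz_iff\<close>)

lemma schwartz_linear_bij: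
  fixes L :: "'a::euclidean_space \<Rightarrow> 'b::euclidean_space"
  assumes f: "f \<in> schwartz_space" and L: "linear L" "inj L"
  shows "(\<lambda>x. f (L x)) \<in> schwartz_space"
proof -
  obtain B where B: "B > 0" "\<And>x. norm x * B \<le> norm (L x)"
    using linear_inj_bounded_below_pos[OF L] by (metis mult.commute)
  have "1 + norm x \<le> (1 + 1 / B) * (1 + norm (L x + 0))" for x
  proof -
    have "norm x * B \<le> norm (L x)" "0 \<le> norm (L x) * B" using B by auto
    then have "(1 + norm x) * B \<le> (B + 1) * (1 + norm (L x))" by (simp add: algebra_simps)
    then show ?thesis using B(1) by (simp add: field_simps)
  qed
  then show ?thesis using schwartz_affine[OF f L(1), of "1 + 1/B" 0] by simp
qed

lemma schwartz_slice:
  assumes "f \<in> schwartz_space" shows "(\<lambda>y. f (x, y)) \<in> schwartz_space"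
proof -
  have "linear (\<lambda>y::'b. (0::'a, y))" by (auto intro!: linearI)
  from schwartz_affine[OF assms this, of 1 "(x, 0)"]
  show ?thesis by (simp add: norm_snd_le)
qed

lemma test_function_iff: "test_function f \<longleftrightarrow> smooth_fun f \<and> bounded {x. f x \<noteq> 0}"
  by (simp add: test_function_def compact_closure)

lemma test_functionI:
  assumes "smooth_fun f" "\<And>x. f x \<noteq> 0 \<Longrightarrow> norm x \<le> r" shows "test_function f"
  unfolding test_function_iff using assms by (auto simp: bounded_iff)

lemma test_functionD:
  assumes "test_function f" shows "smooth_fun f" "\<exists>r>0. \<forall>x. f x \<noteq> 0 \<longrightarrow> norm x \<le> r"
  using assms by (auto simp: test_function_iff bounded_pos)

lemma test_function_mult: "test_function f \<Longrightarrow> smooth_fun g \<Longrightarrow> test_function (\<lambda>x. f x * g x)"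
  unfolding test_function_iff by (auto intro: smooth_fun_mult bounded_subset)

lemma test_function_cmult: "test_function f \<Longrightarrow> test_function (\<lambda>x. c * f x)"
  unfolding test_function_iff by (auto intro: smooth_fun_cmult bounded_subset)

lemma test_function_add:
  assumes "test_function f" "test_function g" shows "test_function (\<lambda>x. f x + g x)"
proof -
  have "{x. f x + g x \<noteq> 0} \<subseteq> {x. f x \<noteq> 0} \<union> {x. g x \<noteq> 0}" by auto
  moreover have "bounded ({x. f x \<noteq> 0} \<union> {x. g x \<noteq> 0})" using assms by (simp add: test_function_iff)
  ultimately have "bounded {x. f x + g x \<noteq> 0}" using bounded_subset by blast
  then show ?thesis using assms by (simp add: test_function_iff smooth_fun_add)
qed

lemma test_function_cnj: "test_function f \<Longrightarrow> test_function (\<lambda>x. cnj (f x))"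
  unfolding test_function_iff by (simp add: smooth_fun_cnj)

lemma pd_eq_0_outside:
  assumes "x \<notin> closure {x. f x \<noteq> 0}" shows "pd b f x = 0"
proof -
  have "(f has_derivative (\<lambda>v. 0)) (at x)"
  proof (rule has_derivative_transform_within_open)
    show "((\<lambda>x. 0) has_derivative (\<lambda>v. 0)) (at x)" by simp
    show "open (- closure {x. f x \<noteq> 0})" by auto
    show "x \<in> - closure {x. f x \<noteq> 0}" using assms by auto
    fix y assume "y \<in> - closure {x. f x \<noteq> 0}"
    then show "0 = f y" using closure_subset[of "{x. f x \<noteq> 0}"] by auto
  qed
  then show ?thesis by (rule pd_eq)
qed

lemma test_function_pd: assumes "test_function f" shows "test_function (pd b f)"
proof -
  have "{x. pd b f x \<noteq> 0} \<subseteq> closure {x. f x \<noteq> 0}" using pd_eq_0_outside by blast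
  then have "bounded {x. pd b f x \<noteq> 0}"
    using assms bounded_subset bounded_closure by (metis test_function_iff)
  then show ?thesis using assms by (simp add: test_function_iff smooth_fun_pd)
qed

lemma continuous_compact_support_bounded:
  fixes f :: "'a::euclidean_space \<Rightarrow> complex"
  assumes "continuous_on UNIV f" "\<And>x. f x \<noteq> 0 \<Longrightarrow> norm x \<le> r"
  shows "\<exists>B. \<forall>x. norm (f x) \<le> B"
proof -
  have "bounded (f ` cball 0 r)"
    using assms(1) by (intro compact_imp_bounded compact_continuous_image) (auto intro: continuous_on_subset)
  then obtain B where B: "\<And>x. x \<in> cball 0 r \<Longrightarrow> norm (f x) \<le> B" unfolding bounded_iff by blast
  have "norm (f x) \<le> max B 0" for x
    using B[of x] assms(2)[of x] by (cases "f x = 0") auto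
  then show ?thesis by blast
qed

lemma test_function_rapid: assumes "test_function f" shows "rapid f"
  unfolding rapid_def
proof
  fix k
  obtain r where r: "r > 0" "\<And>x. f x \<noteq> 0 \<Longrightarrow> norm x \<le> r" using test_functionD[OF assms] by auto
  have c: "continuous_on UNIV (\<lambda>x. of_real ((1 + norm x) ^ k) * f x)"
    using smooth_fun_continuous[OF test_functionD(1)[OF assms]] by (intro continuous_intros)
  have "\<exists>B. \<forall>x. norm (of_real ((1 + norm x) ^ k) * f x) \<le> B"
    by (rule continuous_compact_support_bounded[OF c, of r]) (use r in auto)
  moreover have "norm (of_real ((1 + norm x) ^ k) * f x) = (1 + norm x) ^ k * norm (f x)" for x
    unfolding norm_mult norm_of_real by simp
  ultimately show "\<exists>B. \<forall>x. (1 + norm x) ^ k * norm (f x) \<le> B" by simp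
qed

lemma test_function_schwartz: "test_function f \<Longrightarrow> f \<in> schwartz_space"
  by (rule schwartz_coinduct[where P=test_function])
     (auto intro: test_function_pd test_function_rapid smooth_fun_differentiable test_functionD(1))

section \<open>Bump functions\<close>

text \<open>The functions \<open>t\<^sup>-\<^sup>n exp (- 1 / t)\<close>, extended by \<open>0\<close> to the left. Including the powers makes the family
closed under differentiation up to linear combinations, which gives smoothness at once.\<close>

definition flat_real :: "nat \<Rightarrow> real \<Rightarrow> real" where
  "flat_real n t = (if t \<le> 0 then 0 else inverse t ^ n * exp (- inverse t))"

lemma flat_real_deriv:
  "(flat_real n has_real_derivative flat_real (n + 2) t - n * flat_real (n + 1) t) (at t)"
proof -
  consider "t < 0" | "t = 0" | "t > 0" by linarith
  then show ?thesis
  proof cases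
    case 1
    have "(flat_real n has_real_derivative 0) (at t)"
      by (rule has_field_derivative_transform_within_open[of "\<lambda>_. 0" _ _ "{..<0}"])
         (use 1 in \<open>auto simp: flat_real_def\<close>)
    with 1 show ?thesis by (simp add: flat_real_def)
  next
    case 3
    have "((\<lambda>t. inverse t ^ n * exp (- inverse t)) has_real_derivative
            flat_real (n + 2) t - n * flat_real (n + 1) t) (at t)"
      using 3
      apply (auto intro!: derivative_eq_intros simp: flat_real_def)
      apply (cases n)
       apply (auto simp: field_simps power2_eq_square)
      done
    then show ?thesis
      by (rule has_field_derivative_transform_within_open[of _ _ _ "{0<..}"])
         (use 3 in \<open>auto simp: flat_real_def\<close>)
  next
    case 2
    have "((\<lambda>h. flat_real n h / h) \<longlongrightarrow> 0) (at_right 0)"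
    proof (rule Lim_transform_eventually)
      show "((\<lambda>h. inverse h ^ (n + 1) / exp (inverse h)) \<longlongrightarrow> 0) (at_right (0::real))"
        by (rule filterlim_compose[OF tendsto_power_div_exp_0 filterlim_inverse_at_top_right])
      show "\<forall>\<^sub>F h in at_right 0. inverse h ^ (n + 1) / exp (inverse h) = flat_real n h / h"
        unfolding eventually_at_right_field
        by (intro exI[of _ 1]) (auto simp: flat_real_def exp_minus field_simps)
    qed
    moreover have "((\<lambda>h. flat_real n h / h) \<longlongrightarrow> 0) (at_left 0)"
    proof (rule Lim_transform_eventually)
      show "\<forall>\<^sub>F h in at_left 0. 0 = flat_real n h / h"
        unfolding eventually_at_left_field
        by (intro exI[of _ "-1"]) (auto simp: flat_real_def)
    qed auto
    ultimately have "((\<lambda>h. flat_real n h / h) \<longlongrightarrow> 0) (at 0)"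
      by (simp add: filterlim_split_at)
    then show ?thesis using 2 by (simp add: DERIV_def flat_real_def)
  qed
qed

definition flat :: "nat \<Rightarrow> real \<Rightarrow> complex" where "flat n t = of_real (flat_real n t)"

lemma smooth_flat: "smooth_fun (flat n)"
proof -
  have hd: "(flat n has_derivative (\<lambda>v. of_real v * (flat (n + 2) t + (- of_nat n) * flat (n + 1) t))) (at t)" for n t
  proof -
    have "((\<lambda>t. complex_of_real (flat_real n t)) has_derivative (\<lambda>v. complex_of_real ((flat_real (n + 2) t - n * flat_real (n + 1) t) * v))) (at t)"
      by (rule has_derivative_of_real) (use flat_real_deriv[of n t] in \<open>simp add: has_field_derivative_def\<close>)
    then show ?thesis unfolding flat_def[abs_def] by (simp add: mult.commute)
  qed
  have pdf: "pd 1 (flat n) = (\<lambda>t. flat (n + 2) t + (- of_nat n) * flat (n + 1) t)" for n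
    by (rule ext, subst pd_eq[OF hd]) simp
  have "smooth_upto m (flat n)" for m
  proof (induction m arbitrary: n)
    case 0
    then show ?case using hd unfolding regular.simps differentiable_def by blast
  next
    case (Suc m)
    have "smooth_upto m (pd 1 (flat n))" unfolding pdf by (intro regular_add regular_cmult Suc additive_class_True)
    then show ?case using hd unfolding regular.simps differentiable_def Basis_real_def by blast
  qed
  then show ?thesis by (simp add: smooth_fun_iff)
qed

definition step :: "real \<Rightarrow> complex" where
  "step t = flat 0 t * inverse (flat 0 t + flat 0 (1 - t))"

lemma step_0: "t \<le> 0 \<Longrightarrow> step t = 0" and step_1: "t \<ge> 1 \<Longrightarrow> step t = 1"
  by (auto simp: step_def flat_def flat_real_def)

lemma smooth_step: "smooth_fun step"
proof -
  have "linear (\<lambda>t::real. - t)" by (auto intro!: linearI)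
  from smooth_fun_affine[OF smooth_flat this, of 0 1] have 1: "smooth_fun (\<lambda>t. flat 0 (1 - t))" by simp
  have "flat_real 0 t \<ge> 0" for t by (simp add: flat_real_def)
  moreover have "flat_real 0 t + flat_real 0 (1 - t) > 0" for t by (auto simp: flat_real_def add_pos_pos)
  ultimately have "flat 0 t + flat 0 (1 - t) \<noteq> 0" for t
    unfolding flat_def of_real_add[symmetric] of_real_eq_0_iff by (metis less_irrefl)
  then show ?thesis unfolding step_def[abs_def]
    by (intro smooth_fun_mult smooth_fun_inverse smooth_fun_add smooth_flat 1)
qed

text \<open>One-dimensional profiles are transported to higher dimension along a single coordinate; products over all
coordinates then have supports in boxes.\<close>

lemma smooth_fun_ridge:
  fixes g :: "real \<Rightarrow> complex" and b :: "'a::euclidean_space"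
  assumes "smooth_fun g" shows "smooth_fun (\<lambda>x. g (s * (x \<bullet> b) + c))"
proof -
  have "linear (\<lambda>x. s * (x \<bullet> b))" by (auto intro!: linearI simp: inner_add_left algebra_simps)
  from smooth_fun_affine[OF assms this] show ?thesis .
qed

lemma exists_cutoff:
  "\<exists>\<theta> :: 'a::euclidean_space \<Rightarrow> complex. test_function \<theta> \<and> (\<forall>x. norm x \<le> 1 \<longrightarrow> \<theta> x = 1)"
proof -
  define \<theta> :: "'a \<Rightarrow> complex" where "\<theta> x = (\<Prod>b\<in>Basis. step (1 * (x \<bullet> b) + 2) * step ((-1) * (x \<bullet> b) + 2))" for x
  have "test_function \<theta>"
  proof (rule test_functionI)
    show "smooth_fun \<theta>" unfolding \<theta>_def[abs_def]
      by (intro smooth_fun_prod smooth_fun_mult smooth_fun_ridge smooth_step)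
    fix x assume "\<theta> x \<noteq> 0"
    then have "step (1 * (x \<bullet> b) + 2) \<noteq> 0 \<and> step ((-1) * (x \<bullet> b) + 2) \<noteq> 0" if "b \<in> Basis" for b
      using that by (auto simp: \<theta>_def)
    then have "\<bar>x \<bullet> b\<bar> \<le> 2" if "b \<in> Basis" for b using that step_0 by (smt (verit))
    then have "(\<Sum>b\<in>Basis. \<bar>x \<bullet> b\<bar>) \<le> (\<Sum>b\<in>(Basis::'a set). 2)" by (intro sum_mono) auto
    with norm_le_l1[of x] show "norm x \<le> real DIM('a) * 2" by simp
  qed
  moreover have "\<theta> x = 1" if "norm x \<le> 1" for x
  proof -
    have "\<bar>x \<bullet> b\<bar> \<le> 1" if "b \<in> Basis" for b using Basis_le_norm[OF that, of x] \<open>norm x \<le> 1\<close> by linarith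
    then have "step (1 * (x \<bullet> b) + 2) = 1 \<and> step ((-1) * (x \<bullet> b) + 2) = 1" if "b \<in> Basis" for b
      using that by (intro conjI step_1) fastforce+
    then show ?thesis by (simp add: \<theta>_def)
  qed
  ultimately show ?thesis by blast
qed

lemma exists_nonneg_bump:
  "\<exists>\<eta> :: 'a::euclidean_space \<Rightarrow> real. test_function (\<lambda>x. complex_of_real (\<eta> x)) \<and> (\<forall>x. \<eta> x \<ge> 0) \<and> \<eta> 0 > 0"
proof -
  define \<eta> :: "'a \<Rightarrow> real" where "\<eta> x = (\<Prod>b\<in>Basis. flat_real 0 (1 * (x \<bullet> b) + 1) * flat_real 0 ((-1) * (x \<bullet> b) + 1))" for x
  have e: "complex_of_real (\<eta> x) = (\<Prod>b\<in>Basis. flat 0 (1 * (x \<bullet> b) + 1) * flat 0 ((-1) * (x \<bullet> b) + 1))" for x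
    by (simp add: \<eta>_def flat_def)
  have "test_function (\<lambda>x. complex_of_real (\<eta> x))"
  proof (rule test_functionI)
    show "smooth_fun (\<lambda>x. complex_of_real (\<eta> x))" unfolding e
      by (intro smooth_fun_prod smooth_fun_mult smooth_fun_ridge smooth_flat)
    fix x assume "complex_of_real (\<eta> x) \<noteq> 0"
    then have "flat 0 (1 * (x \<bullet> b) + 1) \<noteq> 0 \<and> flat 0 ((-1) * (x \<bullet> b) + 1) \<noteq> 0" if "b \<in> Basis" for b
      using that by (auto simp: e)
    then have "\<bar>x \<bullet> b\<bar> \<le> 1" if "b \<in> Basis" for b using that
      by (fastforce simp: flat_def flat_real_def split: if_splits)
    then have "(\<Sum>b\<in>Basis. \<bar>x \<bullet> b\<bar>) \<le> (\<Sum>b\<in>(Basis::'a set). 1)" by (intro sum_mono) auto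
    with norm_le_l1[of x] show "norm x \<le> real DIM('a)" by simp
  qed
  moreover have "\<eta> x \<ge> 0" for x by (auto simp: \<eta>_def flat_real_def intro!: prod_nonneg)
  moreover have "\<eta> 0 > 0" by (auto simp: \<eta>_def flat_real_def intro!: prod_pos)
  ultimately show ?thesis by blast
qed

section \<open>Tempered distributions and seminorm bounds\<close>

lemma iterated_partial_add:
  assumes "smooth_fun f" "smooth_fun g"
  shows "iterated_partial bs (\<lambda>x. f x + g x) = (\<lambda>x. iterated_partial bs f x + iterated_partial bs g x)"
  by (induction bs) (simp_all add: pd_add smooth_fun_differentiable smooth_fun_iterated_partial assms)

lemma iterated_partial_cmult:
  assumes "smooth_fun f"
  shows "iterated_partial bs (\<lambda>x. c * f x) = (\<lambda>x. c * iterated_partial bs f x)"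
  by (induction bs) (simp_all add: pd_cmult smooth_fun_differentiable smooth_fun_iterated_partial assms)

lemma iterated_partial_diff:
  assumes "smooth_fun f" "smooth_fun g"
  shows "iterated_partial bs (\<lambda>x. f x - g x) = (\<lambda>x. iterated_partial bs f x - iterated_partial bs g x)"
  using iterated_partial_add[OF assms(1) smooth_fun_cmult[OF assms(2), of "-1"], of bs]
    iterated_partial_cmult[OF assms(2), of bs "-1"] by simp

lemma iterated_partial_cnj:
  assumes "smooth_fun f"
  shows "iterated_partial bs (\<lambda>x. cnj (f x)) = (\<lambda>x. cnj (iterated_partial bs f x))"
proof (induction bs)
  case (Cons b bs)
  have "pd b (\<lambda>x. cnj (iterated_partial bs f x)) = (\<lambda>x. cnj (pd b (iterated_partial bs f) x))"
    by (rule ext, rule pd_eq)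
       (intro has_derivative_cnj has_derivative_pd smooth_fun_differentiable smooth_fun_iterated_partial assms)
  then show ?case by (simp add: Cons)
qed simp

text \<open>One bound \<open>M\<close> for all Schwartz seminorms of weight and order up to \<open>N\<close>, stated pointwise to avoid
suprema.\<close>

definition seminorms_le :: "nat \<Rightarrow> real \<Rightarrow> ('a::euclidean_space \<Rightarrow> complex) \<Rightarrow> bool" where
  "seminorms_le N M f \<longleftrightarrow> (\<forall>bs\<in>lists Basis. length bs \<le> N \<longrightarrow>
     (\<forall>x. (1 + norm x) ^ N * norm (iterated_partial bs f x) \<le> M))"

text \<open>Continuity on Schwartz space in quantitative form. Unlike the topological definition, this form passes
easily to conjugates and to tensor products.\<close>

definition bounded_functional :: "('a::euclidean_space) functional \<Rightarrow> bool" where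
  "bounded_functional u \<longleftrightarrow>
     (\<forall>f \<in> schwartz_space. \<forall>g \<in> schwartz_space. u (\<lambda>x. f x + g x) = u f + u g) \<and>
     (\<forall>c. \<forall>f \<in> schwartz_space. u (\<lambda>x. c * f x) = c * u f) \<and>
     (\<exists>N C. 0 \<le> C \<and> (\<forall>f \<in> schwartz_space. \<forall>M. seminorms_le N M f \<longrightarrow> norm (u f) \<le> C * M))"

lemma seminorms_le_nonneg:
  assumes "seminorms_le N M f" shows "0 \<le> M"
proof -
  have "norm (f 0) \<le> M" using assms[unfolded seminorms_le_def, rule_format, of "[]" 0] by simp
  then show ?thesis using norm_ge_zero order_trans by blast
qed

lemma seminorms_le_mono:
  fixes f :: "'a::euclidean_space \<Rightarrow> complex"
  assumes "seminorms_le N M f" "N' \<le> N" "M \<le> M'" shows "seminorms_le N' M' f"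
  unfolding seminorms_le_def
proof (intro ballI impI allI)
  fix bs :: "'a list" and x assume bs: "bs \<in> lists Basis" "length bs \<le> N'"
  have "(1 + norm x) ^ N' * norm (iterated_partial bs f x) \<le> (1 + norm x) ^ N * norm (iterated_partial bs f x)"
    using assms(2) by (intro mult_right_mono power_increasing) auto
  also have "\<dots> \<le> M" using assms bs unfolding seminorms_le_def by auto
  finally show "(1 + norm x) ^ N' * norm (iterated_partial bs f x) \<le> M'" using assms(3) by linarith
qed

lemma seminorms_le_cmult:
  assumes "smooth_fun f" "seminorms_le N M f" shows "seminorms_le N (norm c * M) (\<lambda>x. c * f x)"
  using assms(2) unfolding seminorms_le_def iterated_partial_cmult[OF assms(1)] norm_mult
  by (metis (no_types, opaque_lifting) mult.left_commute mult_left_mono norm_ge_zero)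

lemma schwartz_seminorms_bound:
  assumes "f \<in> schwartz_space" shows "\<exists>M. seminorms_le N M f"
proof -
  let ?L = "{bs. set bs \<subseteq> (Basis::'a set) \<and> length bs \<le> N}"
  have "rapid (iterated_partial bs f)" if "bs \<in> ?L" for bs
    using that assms by (auto simp: schwartz_iff regular_iff lists_eq_set)
  then have "\<forall>bs\<in>?L. \<exists>B. \<forall>x. (1 + norm x) ^ N * norm (iterated_partial bs f x) \<le> B"
    unfolding rapid_def by blast
  from bchoice[OF this] obtain B where
    B: "\<And>bs x. bs \<in> ?L \<Longrightarrow> (1 + norm x) ^ N * norm (iterated_partial bs f x) \<le> B bs" by blast
  have fin: "finite ?L" by (rule finite_lists_length_le) simp
  have "B bs \<le> (\<Sum>bs\<in>?L. \<bar>B bs\<bar>)" if "bs \<in> ?L" for bs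
    using member_le_sum[of bs ?L "\<lambda>bs. \<bar>B bs\<bar>"] that fin by force
  then have "(1 + norm x) ^ N * norm (iterated_partial bs f x) \<le> (\<Sum>bs\<in>?L. \<bar>B bs\<bar>)" if "bs \<in> ?L" for bs x
    using B[OF that, of x] that by (meson order_trans)
  then have "seminorms_le N (\<Sum>bs\<in>?L. \<bar>B bs\<bar>) f"
    unfolding seminorms_le_def lists_eq_set by blast
  then show ?thesis ..
qed

lemma schwartz_bounded: assumes "f \<in> schwartz_space" shows "\<exists>B. \<forall>x. norm (f x) \<le> B"
proof -
  obtain M where "seminorms_le 0 M f" using schwartz_seminorms_bound[OF assms] by blast
  then have "norm (f x) \<le> M" for x unfolding seminorms_le_def by (auto dest: bspec[of _ _ "[]"])
  then show ?thesis by blast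
qed

lemma schwartz_seminorm_le:
  assumes "seminorms_le N M f" "k \<le> N" "bs \<in> lists Basis" "length bs \<le> N"
  shows "schwartz_seminorm k bs f \<le> M"
  unfolding schwartz_seminorm_def
proof (rule cSUP_least)
  fix x
  have "(1 + norm x) ^ k * norm (iterated_partial bs f x) \<le> (1 + norm x) ^ N * norm (iterated_partial bs f x)"
    using assms(2) by (intro mult_right_mono power_increasing) auto
  also have "\<dots> \<le> M" using assms unfolding seminorms_le_def by auto
  finally show "(1 + norm x) ^ k * norm (iterated_partial bs f x) \<le> M" .
qed simp

lemma schwartz_seminorm_upper:
  assumes "f \<in> schwartz_space" "bs \<in> lists Basis"
  shows "(1 + norm x) ^ k * norm (iterated_partial bs f x) \<le> schwartz_seminorm k bs f"
  unfolding schwartz_seminorm_def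
  by (rule cSUP_upper) (use assms in \<open>auto simp: schwartz_space_def\<close>)

lemma schwartz_seminorm_triangle:
  assumes f: "f \<in> schwartz_space" and g: "g \<in> schwartz_space" and bs: "bs \<in> lists Basis"
  shows "schwartz_seminorm k bs (\<lambda>x. f x + g x) \<le> schwartz_seminorm k bs f + schwartz_seminorm k bs g"
  unfolding schwartz_seminorm_def[of k bs "\<lambda>x. f x + g x"]
proof (rule cSUP_least)
  fix x
  have "(1 + norm x) ^ k * norm (iterated_partial bs (\<lambda>x. f x + g x) x)
      \<le> (1 + norm x) ^ k * (norm (iterated_partial bs f x) + norm (iterated_partial bs g x))"
    unfolding iterated_partial_add[OF schwartz_smooth[OF f] schwartz_smooth[OF g]]
    by (intro mult_left_mono norm_triangle_ineq) auto
  also have "\<dots> \<le> schwartz_seminorm k bs f + schwartz_seminorm k bs g"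
    unfolding distrib_left by (intro add_mono schwartz_seminorm_upper f g bs)
  finally show "(1 + norm x) ^ k * norm (iterated_partial bs (\<lambda>x. f x + g x) x)
      \<le> schwartz_seminorm k bs f + schwartz_seminorm k bs g" .
qed simp

text \<open>Induction over the generation of the open sets: a subbasic set is a seminorm ball around another centre,
and the triangle inequality leaves room for a ball around \<open>f\<close>.\<close>

lemma schwartz_topology_nbhd:
  assumes "openin schwartz_topology V" "f \<in> V" "f \<in> schwartz_space"
  shows "\<exists>N \<delta>. 0 < \<delta> \<and> (\<forall>g\<in>schwartz_space. seminorms_le N \<delta> (\<lambda>x. g x - f x) \<longrightarrow> g \<in> V)"
proof -
  let ?B = "{{g \<in> schwartz_space. schwartz_seminorm k bs (\<lambda>x. g x - f x) < e} | (f :: 'a \<Rightarrow> complex) k bs e.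
        f \<in> schwartz_space \<and> bs \<in> lists Basis \<and> 0 < e}"
  have "generate_topology_on ?B V"
    using assms(1) unfolding schwartz_topology_def openin_topology_generated_by_iff .
  then show ?thesis using assms(2)
  proof (induction V rule: generate_topology_on.induct)
    case Empty then show ?case by simp
  next
    case (Int V W)
    then obtain N1 d1 N2 d2 where N: "0 < d1" "0 < d2"
      "\<And>g. g \<in> schwartz_space \<Longrightarrow> seminorms_le N1 d1 (\<lambda>x. g x - f x) \<Longrightarrow> g \<in> V"
      "\<And>g. g \<in> schwartz_space \<Longrightarrow> seminorms_le N2 d2 (\<lambda>x. g x - f x) \<Longrightarrow> g \<in> W"
      by auto metis
    have "g \<in> V \<inter> W" if g: "g \<in> schwartz_space" and s: "seminorms_le (max N1 N2) (min d1 d2) (\<lambda>x. g x - f x)" for g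
      using N(3,4)[OF g] seminorms_le_mono[OF s] by auto
    then show ?case using N(1,2) by (intro exI[of _ "max N1 N2"] exI[of _ "min d1 d2"]) auto
  next
    case (UN K)
    then obtain V where "V \<in> K" "f \<in> V" by auto
    then show ?case using UN.IH[of V] by (metis UnionI)
  next
    case (Basis V)
    then obtain f0 k bs e where V: "V = {g \<in> schwartz_space. schwartz_seminorm k bs (\<lambda>x. g x - f0 x) < e}"
      and f0: "f0 \<in> schwartz_space" and bs: "bs \<in> lists Basis" and "0 < e" by auto
    define s where "s = schwartz_seminorm k bs (\<lambda>x. f x - f0 x)"
    have s: "s < e" using Basis.prems V s_def by auto
    have "g \<in> V" if g: "g \<in> schwartz_space" and gs: "seminorms_le (max k (length bs)) ((e - s) / 2) (\<lambda>x. g x - f x)" for g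
    proof -
      have "schwartz_seminorm k bs (\<lambda>x. g x - f0 x) = schwartz_seminorm k bs (\<lambda>x. (g x - f x) + (f x - f0 x))"
        by simp
      also have "\<dots> \<le> schwartz_seminorm k bs (\<lambda>x. g x - f x) + s"
        unfolding s_def by (intro schwartz_seminorm_triangle schwartz_diff g f0 assms bs)
      also have "\<dots> \<le> (e - s) / 2 + s"
        using schwartz_seminorm_le[OF gs, of k bs] bs by simp
      also have "\<dots> < e" using s by (simp add: field_simps)
      finally show ?thesis using V g by simp
    qed
    then show ?case using s by (intro exI[of _ "max k (length bs)"] exI[of _ "(e - s) / 2"]) auto
  qed
qed

lemma zero_in_topspace: "(\<lambda>x. 0) \<in> topspace schwartz_topology"
proof -
  have z: "(\<lambda>x. 0) \<in> {g \<in> schwartz_space. schwartz_seminorm 0 [] (\<lambda>x. g x - (\<lambda>x. 0) x) < (1::real)}"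
    by (simp add: schwartz_seminorm_def schwartz_zero)
  show ?thesis
    unfolding schwartz_topology_def topology_generated_by_topspace
    by (rule UnionI[OF _ z], rule CollectI, intro exI conjI, rule refl) (auto simp: schwartz_zero)
qed

text \<open>Continuity at \<open>0\<close> yields a seminorm ball on which \<open>u\<close> is less than \<open>1\<close> in modulus; scaling an arbitrary
Schwartz function into this ball gives the bound.\<close>

lemma tempered_imp_bounded:
  assumes "tempered_distribution u" shows "bounded_functional u"
proof -
  note t = assms[unfolded tempered_distribution_def]
  define V where "V = {f \<in> topspace schwartz_topology. u f \<in> ball 0 1}"
  have "openin schwartz_topology V"
    unfolding V_def using t by (intro openin_continuous_map_preimage[where Y=euclidean]) auto
  moreover have c: "u (\<lambda>x. c * f x) = c * u f" if "f \<in> schwartz_space" for c f using t that by blast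
  have "u (\<lambda>x. 0) = 0" using c[OF schwartz_zero, of 0] by simp
  then have "(\<lambda>x. 0) \<in> V" using zero_in_topspace by (simp add: V_def)
  ultimately obtain N \<delta> where N: "0 < \<delta>" "\<And>g. g \<in> schwartz_space \<Longrightarrow> seminorms_le N \<delta> g \<Longrightarrow> g \<in> V"
    using schwartz_topology_nbhd[OF _ _ schwartz_zero] by force
  have "norm (u f) \<le> (1 / \<delta>) * M" if f: "f \<in> schwartz_space" and M: "seminorms_le N M f" for f M
  proof -
    have "norm (u f) \<le> M' / \<delta>" if "M < M'" for M'
    proof -
      have M': "0 < M'" using seminorms_le_nonneg[OF M] that by linarith
      \<comment> \<open>A bound strictly above M is used because M itself may be 0.\<close>
      let ?c = "complex_of_real (\<delta> / M')"
      have "seminorms_le N (norm ?c * M) (\<lambda>x. ?c * f x)"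
        by (rule seminorms_le_cmult[OF schwartz_smooth[OF f] M])
      then have "seminorms_le N \<delta> (\<lambda>x. ?c * f x)"
      proof (rule seminorms_le_mono)
        show "norm ?c * M \<le> \<delta>" unfolding norm_of_real using M' N(1) that by (simp add: field_simps)
      qed simp
      then have "(\<lambda>x. ?c * f x) \<in> V" by (intro N schwartz_cmult f)
      then have "norm (?c * u f) < 1" by (simp add: V_def c[OF f] del: of_real_divide)
      then show ?thesis unfolding norm_mult norm_of_real using M' N(1) by (simp add: field_simps)
    qed
    then have "norm (u f) * \<delta> \<le> M'" if "M < M'" for M' using that N(1) by (simp add: field_simps)
    then have "norm (u f) * \<delta> \<le> M" by (rule dense_ge)
    then show ?thesis using N(1) by (simp add: field_simps)
  qed
  then have "0 \<le> 1 / \<delta> \<and> (\<forall>f \<in> schwartz_space. \<forall>M. seminorms_le N M f \<longrightarrow> norm (u f) \<le> (1 / \<delta>) * M)"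
    using N(1) by simp
  then have "\<exists>N C. 0 \<le> C \<and> (\<forall>f \<in> schwartz_space. \<forall>M. seminorms_le N M f \<longrightarrow> norm (u f) \<le> C * M)" by blast
  with t show ?thesis unfolding bounded_functional_def by simp
qed

lemma bounded_functionalD:
  assumes "bounded_functional u"
  shows "f \<in> schwartz_space \<Longrightarrow> g \<in> schwartz_space \<Longrightarrow> u (\<lambda>x. f x + g x) = u f + u g"
    and "f \<in> schwartz_space \<Longrightarrow> u (\<lambda>x. c * f x) = c * u f"
    and "\<exists>N C. 0 \<le> C \<and> (\<forall>f \<in> schwartz_space. \<forall>M. seminorms_le N M f \<longrightarrow> norm (u f) \<le> C * M)"
    and "u (\<lambda>x. 0) = 0"
proof -
  note * = assms[unfolded bounded_functional_def]
  show "f \<in> schwartz_space \<Longrightarrow> g \<in> schwartz_space \<Longrightarrow> u (\<lambda>x. f x + g x) = u f + u g"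
    using * by simp
  show c: "f \<in> schwartz_space \<Longrightarrow> u (\<lambda>x. c * f x) = c * u f" for c f
    using * by simp
  show "\<exists>N C. 0 \<le> C \<and> (\<forall>f \<in> schwartz_space. \<forall>M. seminorms_le N M f \<longrightarrow> norm (u f) \<le> C * M)"
    using * by (elim conjE)
  show "u (\<lambda>x. 0) = 0" using c[OF schwartz_zero, of 0] by simp
qed

lemma bounded_functional_diff:
  assumes "bounded_functional u" "f \<in> schwartz_space" "g \<in> schwartz_space"
  shows "u (\<lambda>x. f x - g x) = u f - u g"
  using bounded_functionalD(1)[OF assms(1,2) schwartz_cmult[OF assms(3), of "-1"]]
    bounded_functionalD(2)[OF assms(1,3), of "-1"] by simp

lemma bounded_functional_sum:
  assumes "bounded_functional u" "\<And>i. i \<in> I \<Longrightarrow> f i \<in> schwartz_space"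
  shows "u (\<lambda>x. \<Sum>i\<in>I. f i x) = (\<Sum>i\<in>I. u (f i))"
  using assms(2)
  by (induction I rule: infinite_finite_induct)
     (simp_all add: bounded_functionalD[OF assms(1)] schwartz_sum)

text \<open>If every seminorm of \<open>F \<epsilon>\<close> is \<open>O(\<epsilon>)\<close>, then \<open>u (F \<epsilon>)\<close> tends to \<open>0\<close>. Applied to the error of an
approximation whose approximants have the value \<open>0\<close> under \<open>u\<close>, this shows that \<open>u\<close> vanishes on the
limit.\<close>

lemma bounded_functional_limit:
  fixes u :: "('a::euclidean_space) functional"
  assumes u: "bounded_functional u" and F: "\<And>\<epsilon>. 0 < \<epsilon> \<Longrightarrow> \<epsilon> \<le> 1 \<Longrightarrow> F \<epsilon> \<in> schwartz_space"
    and small: "\<And>k bs. bs \<in> lists Basis \<Longrightarrow> \<exists>C. \<forall>\<epsilon> x. 0 < \<epsilon> \<longrightarrow> \<epsilon> \<le> 1 \<longrightarrow>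
       (1 + norm x) ^ k * norm (iterated_partial bs (F \<epsilon>) x) \<le> C * \<epsilon>"
    and const: "\<And>\<epsilon>. 0 < \<epsilon> \<Longrightarrow> \<epsilon> \<le> 1 \<Longrightarrow> u (F \<epsilon>) = c"
  shows "c = 0"
proof -
  obtain N C where N: "0 \<le> C" "\<And>f M. f \<in> schwartz_space \<Longrightarrow> seminorms_le N M f \<Longrightarrow> norm (u f) \<le> C * M"
    using bounded_functionalD(3)[OF u] by blast
  let ?L = "{bs. set bs \<subseteq> (Basis::'a set) \<and> length bs \<le> N}"
  have "\<forall>bs\<in>?L. \<exists>C. \<forall>\<epsilon> x. 0 < \<epsilon> \<longrightarrow> \<epsilon> \<le> 1 \<longrightarrow>
      (1 + norm x) ^ N * norm (iterated_partial bs (F \<epsilon>) x) \<le> C * \<epsilon>"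
    by (intro ballI small) (auto simp: lists_eq_set)
  from bchoice[OF this] obtain D where D: "\<And>bs \<epsilon> x. bs \<in> ?L \<Longrightarrow> 0 < \<epsilon> \<Longrightarrow> \<epsilon> \<le> 1 \<Longrightarrow>
      (1 + norm x) ^ N * norm (iterated_partial bs (F \<epsilon>) x) \<le> D bs * \<epsilon>" by blast
  define M where "M = (\<Sum>bs\<in>?L. \<bar>D bs\<bar>)"
  have fin: "finite ?L" by (rule finite_lists_length_le) simp
  have DM: "D bs \<le> M" if "bs \<in> ?L" for bs
    using member_le_sum[of bs ?L "\<lambda>bs. \<bar>D bs\<bar>"] that fin unfolding M_def by force
  have bound: "norm c \<le> C * (M * \<epsilon>)" if \<epsilon>: "0 < \<epsilon>" "\<epsilon> \<le> 1" for \<epsilon>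
  proof -
    have "seminorms_le N (M * \<epsilon>) (F \<epsilon>)"
      unfolding seminorms_le_def
    proof (intro ballI impI allI)
      fix bs :: "'a list" and x assume "bs \<in> lists Basis" "length bs \<le> N"
      then have bs: "bs \<in> ?L" by (simp add: lists_eq_set)
      have "D bs * \<epsilon> \<le> M * \<epsilon>" using DM[OF bs] \<epsilon> by (intro mult_right_mono) auto
      then show "(1 + norm x) ^ N * norm (iterated_partial bs (F \<epsilon>) x) \<le> M * \<epsilon>"
        using D[OF bs \<epsilon>, of x] by linarith
    qed
    from N(2)[OF F[OF \<epsilon>] this] show ?thesis by (simp add: const[OF \<epsilon>])
  qed
  have "((\<lambda>\<epsilon>. C * (M * \<epsilon>)) \<longlongrightarrow> C * (M * 0)) (at_right 0)" by (intro tendsto_intros)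
  moreover have "\<forall>\<^sub>F \<epsilon> in at_right 0. norm c \<le> C * (M * \<epsilon>)"
    unfolding eventually_at_right_field using bound by (intro exI[of _ 1]) auto
  ultimately have "norm c \<le> C * (M * 0)" by (rule tendsto_lowerbound) simp
  then show ?thesis by simp
qed

lemma bounded_functional_conj:
  assumes "bounded_functional u" shows "bounded_functional (conj_distr u)"
proof -
  obtain N C where N: "0 \<le> C" "\<And>f M. f \<in> schwartz_space \<Longrightarrow> seminorms_le N M f \<Longrightarrow> norm (u f) \<le> C * M"
    using bounded_functionalD(3)[OF assms] by blast
  have "norm (conj_distr u f) \<le> C * M" if f: "f \<in> schwartz_space" and M: "seminorms_le N M f" for f M
  proof -
    have "seminorms_le N M (\<lambda>x. cnj (f x))"
      using M unfolding seminorms_le_def iterated_partial_cnj[OF schwartz_smooth[OF f]] by simp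
    from N(2)[OF schwartz_cnj[OF f] this] show ?thesis by (simp add: conj_distr_def)
  qed
  moreover have "conj_distr u (\<lambda>x. f x + g x) = conj_distr u f + conj_distr u g"
    if "f \<in> schwartz_space" "g \<in> schwartz_space" for f g
    using bounded_functionalD(1)[OF assms that[THEN schwartz_cnj]] by (simp add: conj_distr_def)
  moreover have "conj_distr u (\<lambda>x. c * f x) = c * conj_distr u f" if "f \<in> schwartz_space" for c f
    using bounded_functionalD(2)[OF assms schwartz_cnj[OF that]] by (simp add: conj_distr_def)
  ultimately show ?thesis unfolding bounded_functional_def using N(1) by blast
qed

section \<open>Tensor products of tempered distributions\<close>

lemma has_derivative_quadratic:
  fixes F :: "'a::euclidean_space \<Rightarrow> complex"
  assumes "linear D" and "\<And>h. norm h \<le> 1 \<Longrightarrow> norm (F (x + h) - F x - D h) \<le> K * (norm h)\<^sup>2"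
  shows "(F has_derivative D) (at x)"
  unfolding has_derivative_at_alt
proof (intro conjI allI impI)
  show "bounded_linear D" using assms(1) linear_conv_bounded_linear by blast
  fix e :: real assume e: "0 < e"
  let ?d = "min 1 (e / (\<bar>K\<bar> + 1))"
  show "\<exists>d>0. \<forall>y. norm (y - x) < d \<longrightarrow> norm (F y - F x - D (y - x)) \<le> e * norm (y - x)"
  proof (intro exI[of _ ?d] conjI allI impI)
    show "0 < ?d" using e by simp
    fix y assume y: "norm (y - x) < ?d"
    have "norm (F y - F x - D (y - x)) \<le> K * (norm (y - x))\<^sup>2"
      using assms(2)[of "y - x"] y by simp
    also have "\<dots> \<le> (\<bar>K\<bar> + 1) * (norm (y - x))\<^sup>2"
      by (intro mult_right_mono) auto
    also have "\<dots> = ((\<bar>K\<bar> + 1) * norm (y - x)) * norm (y - x)"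
      by (simp add: power2_eq_square)
    also have "\<dots> \<le> e * norm (y - x)"
      using y by (intro mult_right_mono) (auto simp: field_simps)
    finally show "norm (F y - F x - D (y - x)) \<le> e * norm (y - x)" .
  qed
qed

lemma iterated_partial_slice:
  fixes e :: "'a::euclidean_space \<times> 'b::euclidean_space \<Rightarrow> complex"
  assumes "smooth_fun e"
  shows "iterated_partial bs (\<lambda>y. e (x, y)) = (\<lambda>y. iterated_partial (map (\<lambda>b. (0, b)) bs) e (x, y))"
proof (induction bs)
  case (Cons b bs)
  let ?E = "iterated_partial (map (\<lambda>b. (0::'a, b)) bs) e"
  have l: "linear (\<lambda>y::'b. (0::'a, y))" by (auto intro!: linearI)
  from pd_affine[OF l smooth_fun_differentiable[OF smooth_fun_iterated_partial[OF assms]], of b "map (\<lambda>b. (0, b)) bs" "(x, 0)"]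
  show ?case by (simp add: Cons)
qed simp

lemma pd_iterated_commute:
  assumes "smooth_fun f" shows "pd a (iterated_partial bs f) = iterated_partial bs (pd a f)"
proof (induction bs)
  case (Cons b bs)
  then show ?case using pd_commute[OF smooth_fun_iterated_partial[OF assms], of a b bs] by simp
qed simp

lemma sum_Basis_prod:
  "(\<Sum>z\<in>Basis. F z) = (\<Sum>a\<in>Basis. F (a, 0)) + (\<Sum>b\<in>Basis. F (0, b) :: complex)"
  unfolding Basis_prod_def by (subst sum.union_disjoint) (auto simp: sum.reindex inj_on_def)

text \<open>The remainder of the first-order expansion of \<open>e (x + h, y)\<close> in \<open>h\<close> is a Schwartz function of \<open>y\<close> whose
seminorms are \<open>O(|h|\<^sup>2)\<close>. Indeed, its \<open>y\<close>-derivatives are the remainders of the \<open>y\<close>-derivatives of \<open>e\<close>,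
because partial derivatives commute, and the weight in \<open>y\<close> is constant along the segment from \<open>(x, y)\<close>
to \<open>(x + h, y)\<close>.\<close>

lemma slice_functional_deriv:
  fixes v :: "'b::euclidean_space functional" and e :: "'a::euclidean_space \<times> 'b \<Rightarrow> complex"
  assumes v: "bounded_functional v" and e: "e \<in> schwartz_space"
  shows "((\<lambda>x. v (\<lambda>y. e (x, y))) has_derivative (\<lambda>h. \<Sum>b\<in>Basis. of_real (h \<bullet> b) * v (\<lambda>y. pd (b, 0) e (x, y)))) (at x)"
proof -
  note se = schwartz_smooth[OF e]
  obtain N C where N: "0 \<le> C" "\<And>f M. f \<in> schwartz_space \<Longrightarrow> seminorms_le N M f \<Longrightarrow> norm (v f) \<le> C * M"
    using bounded_functionalD(3)[OF v] by blast
  obtain B where B: "seminorms_le (N + 2) B e" using schwartz_seminorms_bound[OF e] by blast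
  have "linear (\<lambda>h. \<Sum>b\<in>Basis. of_real (h \<bullet> b) * v (\<lambda>y. pd (b, 0) e (x, y)))"
    by (intro linear_compose_sum ballI linearI) (auto simp: inner_add_left algebra_simps scaleR_conv_of_real)
  then show ?thesis
  proof (rule has_derivative_quadratic)
    fix h :: 'a assume "norm h \<le> 1"
    have pds: "(\<lambda>y. pd (b, 0) e (x, y)) \<in> schwartz_space" if "b \<in> Basis" for b
      using that by (intro schwartz_slice schwartz_pd e) (auto simp: Basis_prod_def)
    have sum_in: "(\<lambda>y. \<Sum>b\<in>Basis. of_real (h \<bullet> b) * pd (b, 0) e (x, y)) \<in> schwartz_space"
      by (intro schwartz_sum schwartz_cmult pds)
    have pdh: "(\<Sum>b\<in>Basis. of_real (h \<bullet> b) * pd (b, 0) e w) = pd (h, 0) e w" for w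
      unfolding pd_expand[OF smooth_fun_differentiable[OF se], of "(h, 0)"]
      by (simp add: sum_Basis_prod)
    let ?r = "\<lambda>y. e (x + h, y) - e (x, y) - (\<Sum>b\<in>Basis. of_real (h \<bullet> b) * pd (b, 0) e (x, y))"
    have r: "?r \<in> schwartz_space" by (intro schwartz_diff schwartz_slice e sum_in)
    have "v ?r = v (\<lambda>y. e (x + h, y)) - v (\<lambda>y. e (x, y)) - v (\<lambda>y. \<Sum>b\<in>Basis. of_real (h \<bullet> b) * pd (b, 0) e (x, y))"
      by (subst bounded_functional_diff[OF v] , intro schwartz_diff schwartz_slice e, rule sum_in,
          subst bounded_functional_diff[OF v], intro schwartz_slice e, intro schwartz_slice e, simp)
    also have "v (\<lambda>y. \<Sum>b\<in>Basis. of_real (h \<bullet> b) * pd (b, 0) e (x, y)) =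
        (\<Sum>b\<in>Basis. of_real (h \<bullet> b) * v (\<lambda>y. pd (b, 0) e (x, y)))"
      by (subst bounded_functional_sum[OF v]) (simp_all add: schwartz_cmult pds bounded_functionalD(2)[OF v])
    finally have vr: "v ?r = v (\<lambda>y. e (x + h, y)) - v (\<lambda>y. e (x, y)) -
        (\<Sum>b\<in>Basis. of_real (h \<bullet> b) * v (\<lambda>y. pd (b, 0) e (x, y)))" .
    have "seminorms_le N ((real DIM('a \<times> 'b))\<^sup>2 * B * (norm h)\<^sup>2) ?r"
      unfolding seminorms_le_def
    proof (intro ballI impI allI)
      fix bs :: "'b list" and y assume bs: "bs \<in> lists Basis" "length bs \<le> N"
      let ?bs = "map (\<lambda>b. (0::'a, b)) bs"
      have bs': "?bs \<in> lists Basis" "length ?bs \<le> N" using bs by (auto simp: Basis_prod_def)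
      let ?E = "iterated_partial ?bs e"
      have sE: "smooth_fun ?E" by (intro smooth_fun_iterated_partial se)
      have lid: "linear (\<lambda>y::'b. (0::'a, y))" by (auto intro!: linearI)
      have s1: "smooth_fun (\<lambda>y. f (u, y))" if "smooth_fun f" for f :: "'a \<times> 'b \<Rightarrow> complex" and u
        using smooth_fun_affine[OF that lid, of "(u, 0)"] by simp
      have "iterated_partial bs ?r y = ?E (x + h, y) - ?E (x, y) - iterated_partial ?bs (pd (h, 0) e) (x, y)"
        unfolding pdh
        by (subst iterated_partial_diff, (intro s1 se smooth_fun_pd schwartz_smooth[OF schwartz_diff] schwartz_slice e)+,
            subst iterated_partial_diff, (intro s1 se)+)
           (simp add: iterated_partial_slice se smooth_fun_pd)
      also have "iterated_partial ?bs (pd (h, 0) e) = pd (h, 0) ?E"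
        by (rule pd_iterated_commute[OF se, symmetric])
      finally have eq: "iterated_partial bs ?r y = ?E ((x, y) + (h, 0)) - ?E (x, y) - pd (h, 0) ?E (x, y)" by simp
      have "norm (iterated_partial bs ?r y) \<le> (real DIM('a \<times> 'b))\<^sup>2 * (B / (1 + norm y) ^ N) * (norm (h, 0::'b))\<^sup>2"
        unfolding eq
      proof (rule smooth_taylor_bound[OF sE])
        fix w b c :: "'a \<times> 'b" assume w: "w \<in> closed_segment (x, y) ((x, y) + (h, 0))" and bc: "b \<in> Basis" "c \<in> Basis"
        have "snd w = y" using w by (auto simp: closed_segment_def algebra_simps)
        then have yw: "norm y \<le> norm w" using norm_snd_le[of "snd w" "fst w"] by (cases w) simp
        have "(1 + norm y) ^ N * norm (pd c (pd b ?E) w) \<le> (1 + norm w) ^ (N + 2) * norm (pd c (pd b ?E) w)"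
          using yw by (intro mult_right_mono order_trans[OF power_mono[of "1 + norm y" "1 + norm w"] power_increasing]) auto
        also have "\<dots> \<le> B"
          using B[unfolded seminorms_le_def, rule_format, of "c # b # ?bs" w] bs' bc by simp
        finally show "norm (pd c (pd b ?E) w) \<le> B / (1 + norm y) ^ N"
          by (simp add: field_simps add_pos_nonneg)
      qed
      then show "(1 + norm y) ^ N * norm (iterated_partial bs ?r y) \<le> (real DIM('a \<times> 'b))\<^sup>2 * B * (norm h)\<^sup>2"
        by (simp add: field_simps add_pos_nonneg norm_Pair)
    qed
    from N(2)[OF r this] show "norm (v (\<lambda>y. e (x + h, y)) - v (\<lambda>y. e (x, y)) -
        (\<Sum>b\<in>Basis. of_real (h \<bullet> b) * v (\<lambda>y. pd (b, 0) e (x, y)))) \<le> (C * ((real DIM('a \<times> 'b))\<^sup>2 * B)) * (norm h)\<^sup>2"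
      unfolding vr by (simp add: mult_ac)
  qed
qed

lemma
  fixes v :: "'b::euclidean_space functional" and e :: "'a::euclidean_space \<times> 'b \<Rightarrow> complex"
  assumes v: "bounded_functional v" and e: "e \<in> schwartz_space"
  shows slice_functional_differentiable: "(\<lambda>x. v (\<lambda>y. e (x, y))) differentiable (at x)"
    and slice_functional_pd: "b \<in> Basis \<Longrightarrow> pd b (\<lambda>x. v (\<lambda>y. e (x, y))) = (\<lambda>x. v (\<lambda>y. pd (b, 0) e (x, y)))"
proof -
  show "(\<lambda>x. v (\<lambda>y. e (x, y))) differentiable (at x)"
    using slice_functional_deriv[OF assms] differentiable_def by blast
  assume b: "b \<in> Basis"
  show "pd b (\<lambda>x. v (\<lambda>y. e (x, y))) = (\<lambda>x. v (\<lambda>y. pd (b, 0) e (x, y)))"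
    by (rule ext, rule pd_eq_coefficient[OF slice_functional_deriv[OF assms] b])
qed

lemma slice_functional_iterated:
  fixes v :: "'b::euclidean_space functional" and e :: "'a::euclidean_space \<times> 'b \<Rightarrow> complex"
  assumes v: "bounded_functional v" and e: "e \<in> schwartz_space" and bs: "bs \<in> lists Basis"
  shows "iterated_partial bs (\<lambda>x. v (\<lambda>y. e (x, y))) = (\<lambda>x. v (\<lambda>y. iterated_partial (map (\<lambda>b. (b, 0)) bs) e (x, y)))"
  using bs
proof (induction bs)
  case (Cons b bs)
  then have "map (\<lambda>b. (b, 0::'b)) bs \<in> lists Basis" by (auto simp: Basis_prod_def)
  then show ?case using Cons slice_functional_pd[OF v schwartz_iterated[OF e]] by simp
qed simp

text \<open>The weight in \<open>x\<close> is paid for by weights in the joint variable, since both \<open>1 + |x|\<close> and \<open>1 + |y|\<close> are at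
most \<open>1 + |(x, y)|\<close>.\<close>

lemma slice_functional_bound:
  fixes v :: "'b::euclidean_space functional" and e :: "'a::euclidean_space \<times> 'b \<Rightarrow> complex"
  assumes N: "\<forall>f\<in>schwartz_space. \<forall>M. seminorms_le N M f \<longrightarrow> norm (v f) \<le> C * M"
    and e: "e \<in> schwartz_space"
    and M: "\<And>bs z. bs \<in> lists Basis \<Longrightarrow> length bs \<le> N \<Longrightarrow>
       (1 + norm z) ^ (k + N) * norm (iterated_partial bs e z) \<le> M"
  shows "(1 + norm x) ^ k * norm (v (\<lambda>y. e (x, y))) \<le> C * M"
proof -
  have "seminorms_le N (M / (1 + norm x) ^ k) (\<lambda>y. e (x, y))"
    unfolding seminorms_le_def
  proof (intro ballI impI allI)
    fix bs :: "'b list" and y assume bs: "bs \<in> lists Basis" "length bs \<le> N"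
    let ?bs = "map (\<lambda>b. (0::'a, b)) bs"
    have bs': "?bs \<in> lists Basis" "length ?bs \<le> N" using bs by (auto simp: Basis_prod_def)
    have "(1 + norm x) ^ k * ((1 + norm y) ^ N * norm (iterated_partial bs (\<lambda>y. e (x, y)) y))
       = ((1 + norm x) ^ k * (1 + norm y) ^ N) * norm (iterated_partial ?bs e (x, y))"
      by (simp add: iterated_partial_slice[OF schwartz_smooth[OF e]])
    also have "\<dots> \<le> (1 + norm (x, y)) ^ (k + N) * norm (iterated_partial ?bs e (x, y))"
      unfolding power_add using norm_fst_le[of x y] norm_snd_le[of y x]
      by (intro mult_right_mono mult_mono power_mono) auto
    also have "\<dots> \<le> M" using M bs' by blast
    finally show "(1 + norm y) ^ N * norm (iterated_partial bs (\<lambda>y. e (x, y)) y) \<le> M / (1 + norm x) ^ k"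
      by (simp add: field_simps add_pos_nonneg)
  qed
  from N[rule_format, OF schwartz_slice[OF e] this] show ?thesis by (simp add: field_simps add_pos_nonneg)
qed

lemma slice_functional_schwartz:
  fixes v :: "'b::euclidean_space functional" and e :: "'a::euclidean_space \<times> 'b \<Rightarrow> complex"
  assumes v: "bounded_functional v" and e: "e \<in> schwartz_space"
  shows "(\<lambda>x. v (\<lambda>y. e (x, y))) \<in> schwartz_space"
proof (rule schwartz_coinduct[where P="\<lambda>g. \<exists>e\<in>schwartz_space. g = (\<lambda>x. v (\<lambda>y. e (x, y)))"])
  show "\<exists>f\<in>schwartz_space. (\<lambda>x. v (\<lambda>y. e (x, y))) = (\<lambda>x. v (\<lambda>y. f (x, y)))" using e by blast
  fix g :: "'a \<Rightarrow> complex" assume "\<exists>e\<in>schwartz_space. g = (\<lambda>x. v (\<lambda>y. e (x, y)))"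
  then obtain e where e: "e \<in> schwartz_space" and g: "g = (\<lambda>x. v (\<lambda>y. e (x, y)))" by blast
  obtain N C where N: "0 \<le> C" "\<forall>f\<in>schwartz_space. \<forall>M. seminorms_le N M f \<longrightarrow> norm (v f) \<le> C * M"
    using bounded_functionalD(3)[OF v] by (elim exE conjE)
  have "rapid g" unfolding rapid_def g
  proof
    fix k
    obtain M where "seminorms_le (k + N) M e" using schwartz_seminorms_bound[OF e] by blast
    then have *: "(1 + norm z) ^ (k + N) * norm (iterated_partial bs e z) \<le> M"
      if "bs \<in> lists Basis" "length bs \<le> N" for bs z using that by (simp add: seminorms_le_def del: split_paired_All)
    have "(1 + norm x) ^ k * norm (v (\<lambda>y. e (x, y))) \<le> C * M" for x
      by (rule slice_functional_bound[OF N(2) e *])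
    then show "\<exists>B. \<forall>x. (1 + norm x) ^ k * norm (v (\<lambda>y. e (x, y))) \<le> B" by blast
  qed
  moreover have "\<exists>e'\<in>schwartz_space. pd b g = (\<lambda>x. v (\<lambda>y. e' (x, y)))" if "b \<in> Basis" for b
    unfolding g slice_functional_pd[OF v e that]
    by (intro bexI[of _ "pd (b, 0) e"] schwartz_pd e refl) (use that in \<open>auto simp: Basis_prod_def\<close>)
  ultimately show "(\<forall>x. g differentiable (at x)) \<and> rapid g \<and>
      (\<forall>b\<in>Basis. \<exists>e\<in>schwartz_space. pd b g = (\<lambda>x. v (\<lambda>y. e (x, y))))"
    using slice_functional_differentiable[OF v e] g by blast
qed

lemma bounded_functional_tensor:
  fixes u :: "'a::euclidean_space functional" and v :: "'b::euclidean_space functional"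
  assumes u: "bounded_functional u" and v: "bounded_functional v"
  shows "bounded_functional (tensor_distr u v)"
proof -
  obtain N C where N: "0 \<le> C" "\<forall>f\<in>schwartz_space. \<forall>M. seminorms_le N M f \<longrightarrow> norm (v f) \<le> C * M"
    using bounded_functionalD(3)[OF v] by (elim exE conjE)
  obtain N' C' where N': "0 \<le> C'" "\<And>f M. f \<in> schwartz_space \<Longrightarrow> seminorms_le N' M f \<Longrightarrow> norm (u f) \<le> C' * M"
    using bounded_functionalD(3)[OF u] by blast
  have "norm (tensor_distr u v e) \<le> (C' * C) * M" if e: "e \<in> schwartz_space" and M: "seminorms_le (N' + N) M e" for e M
  proof -
    have "seminorms_le N' (C * M) (\<lambda>x. v (\<lambda>y. e (x, y)))"
      unfolding seminorms_le_def
    proof (intro ballI impI allI)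
      fix bs :: "'a list" and x assume bs: "bs \<in> lists Basis" "length bs \<le> N'"
      let ?bs = "map (\<lambda>b. (b, 0::'b)) bs"
      have bs': "?bs \<in> lists Basis" "length ?bs \<le> N'" using bs by (auto simp: Basis_prod_def)
      show "(1 + norm x) ^ N' * norm (iterated_partial bs (\<lambda>x. v (\<lambda>y. e (x, y))) x) \<le> C * M"
        unfolding slice_functional_iterated[OF v e bs(1)]
      proof (rule slice_functional_bound[OF N(2) schwartz_iterated[OF e bs'(1)]])
        fix cs :: "('a \<times> 'b) list" and z assume "cs \<in> lists Basis" "length cs \<le> N"
        then show "(1 + norm z) ^ (N' + N) * norm (iterated_partial cs (iterated_partial ?bs e) z) \<le> M"
          using M[unfolded seminorms_le_def, rule_format, of "cs @ ?bs" z] bs'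
          by (simp add: iterated_partial_append)
      qed
    qed
    from N'(2)[OF slice_functional_schwartz[OF v e] this] show ?thesis by (simp add: tensor_distr_def)
  qed
  moreover have "tensor_distr u v (\<lambda>z. f z + g z) = tensor_distr u v f + tensor_distr u v g"
    if f: "f \<in> schwartz_space" and g: "g \<in> schwartz_space" for f g
    unfolding tensor_distr_def bounded_functionalD(1)[OF v schwartz_slice[OF f] schwartz_slice[OF g]]
    by (intro bounded_functionalD(1)[OF u] slice_functional_schwartz v f g)
  moreover have "tensor_distr u v (\<lambda>z. c * f z) = c * tensor_distr u v f"
    if f: "f \<in> schwartz_space" for f c
    unfolding tensor_distr_def bounded_functionalD(2)[OF v schwartz_slice[OF f]]
    by (intro bounded_functionalD(2)[OF u] slice_functional_schwartz v f)
  ultimately show ?thesis unfolding bounded_functional_def using N(1) N'(1)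
    by (intro conjI exI[of _ "N' + N"] exI[of _ "C' * C"]) auto
qed

section \<open>Supports and localisation\<close>

lemma support_nonzero:
  assumes "x \<in> distr_supp u" "open V" "x \<in> V"
  shows "\<exists>\<phi>. test_function \<phi> \<and> closure {x. \<phi> x \<noteq> 0} \<subseteq> V \<and> u \<phi> \<noteq> 0"
  using assms unfolding distr_supp_def vanishes_on_def by blast

text \<open>Supports involve the values on test functions only, and so does the localisation argument; the
matrix-Wigner transform is treated as a functional of this kind.\<close>

definition additive_on_tests :: "('a::euclidean_space) functional \<Rightarrow> bool" where
  "additive_on_tests u \<longleftrightarrow> (\<forall>f g. test_function f \<longrightarrow> test_function g \<longrightarrow> u (\<lambda>x. f x + g x) = u f + u g)"

lemma additive_on_testsD:
  "additive_on_tests u \<Longrightarrow> test_function f \<Longrightarrow> test_function g \<Longrightarrow> u (\<lambda>x. f x + g x) = u f + u g"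
  by (simp add: additive_on_tests_def)

lemma additive_on_tests_zero:
  fixes u :: "('a::euclidean_space) functional"
  assumes "additive_on_tests u"
  shows "u (\<lambda>x. 0) = 0"
proof -
  have "test_function (\<lambda>x::'a. 0::complex)" by (simp add: test_function_iff smooth_fun_const)
  from additive_on_testsD[OF assms this this] show ?thesis by simp
qed

lemma additive_on_tests_sum:
  fixes u :: "('a::euclidean_space) functional" and F :: "nat \<Rightarrow> 'a \<Rightarrow> complex"
  assumes add: "additive_on_tests u"
    and F: "\<And>i. test_function (F i)"
  shows "test_function (\<lambda>x. \<Sum>i<n. F i x) \<and> u (\<lambda>x. \<Sum>i<n. F i x) = (\<Sum>i<n. u (F i))"
proof (induction n)
  case 0
  then show ?case by (simp add: additive_on_tests_zero[OF add] test_function_iff smooth_fun_const)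
next
  case (Suc n)
  then show ?case by (simp add: additive_on_testsD[OF add] F test_function_add)
qed

text \<open>Differences of consecutive translates of a smooth step telescope, so finitely many of them sum to \<open>1\<close> on
the support of \<open>f\<close>, and each is supported in a slab. By additivity \<open>u\<close> does not vanish on one of the
pieces of \<open>f\<close>.\<close>

lemma slab_localise:
  fixes u :: "('a::euclidean_space) functional"
  assumes add: "additive_on_tests u"
    and f: "test_function f" "u f \<noteq> 0" and b: "b \<in> Basis" and \<epsilon>: "0 < \<epsilon>"
  shows "\<exists>g c. test_function g \<and> u g \<noteq> 0 \<and> (\<forall>x. g x \<noteq> 0 \<longrightarrow> f x \<noteq> 0 \<and> c \<le> x \<bullet> b \<and> x \<bullet> b \<le> c + \<epsilon>)"
proof -
  obtain r where r: "0 < r" "\<And>x. f x \<noteq> 0 \<Longrightarrow> norm x \<le> r" using test_functionD(2)[OF f(1)] by auto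
  \<comment> \<open>In the rescaled coordinate the pieces below are supported in intervals of length 2.\<close>
  define s where "s = 2 / \<epsilon>"
  have s: "0 < s" using \<epsilon> by (simp add: s_def)
  obtain m :: nat where m: "s * r + 1 \<le> real m" using real_arch_simple by blast
  define \<theta> :: "nat \<Rightarrow> 'a \<Rightarrow> complex" where
    "\<theta> k x = step (s * (x \<bullet> b) + (real m - real k)) + (-1) * step (s * (x \<bullet> b) + (real m - real (Suc k)))" for k x
  have sm: "smooth_fun (\<theta> k)" for k
    unfolding \<theta>_def[abs_def] by (intro smooth_fun_add smooth_fun_cmult smooth_fun_ridge smooth_step)
  have tel: "(\<Sum>k<2*m. \<theta> k x) = step (s * (x \<bullet> b) + real m) - step (s * (x \<bullet> b) - real m)" for x
    using sum_lessThan_telescope'[of "\<lambda>k. step (s * (x \<bullet> b) + (real m - real k))" "2*m"]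
    by (simp add: \<theta>_def)
  have one: "(\<Sum>k<2*m. f x * \<theta> k x) = f x" for x
  proof (cases "f x = 0")
    case False
    have "\<bar>x \<bullet> b\<bar> \<le> r" using Basis_le_norm[OF b, of x] r(2)[OF False] by linarith
    then have "\<bar>s * (x \<bullet> b)\<bar> \<le> s * r" using s by (simp add: abs_mult)
    then have "(\<Sum>k<2*m. \<theta> k x) = 1" unfolding tel using m by (simp add: step_0 step_1)
    then show ?thesis by (simp add: sum_distrib_left[symmetric])
  qed simp
  have t: "test_function (\<lambda>x. f x * \<theta> k x)" for k by (intro test_function_mult f sm)
  have "u f = (\<Sum>k<2*m. u (\<lambda>x. f x * \<theta> k x))"
    using additive_on_tests_sum[of u "\<lambda>k x. f x * \<theta> k x" "2*m", OF add t] one by simp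
  with f(2) obtain k where k: "u (\<lambda>x. f x * \<theta> k x) \<noteq> 0" by (metis sum.neutral)
  define c where "c = (real k - real m) / s"
  have "c \<le> x \<bullet> b \<and> x \<bullet> b \<le> c + \<epsilon>" if "\<theta> k x \<noteq> 0" for x
  proof -
    let ?t = "s * (x \<bullet> b) + (real m - real k)"
    have "0 < ?t"
      using that by (rule contrapos_np) (simp add: \<theta>_def step_0)
    moreover have "?t < 2"
      using that by (rule contrapos_np) (simp add: \<theta>_def step_1)
    moreover have "c + \<epsilon> = (real k - real m + 2) / s" using \<epsilon> by (simp add: c_def s_def field_simps)
    ultimately show ?thesis unfolding c_def using s by (simp add: field_simps)
  qed
  then show ?thesis using t[of k] k by (intro exI[of _ "\<lambda>x. f x * \<theta> k x"] exI[of _ c]) auto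
qed

lemma box_localise:
  fixes u :: "('a::euclidean_space) functional"
  assumes add: "additive_on_tests u"
    and f: "test_function f" "u f \<noteq> 0" and \<epsilon>: "0 < \<epsilon>"
  shows "\<exists>g. test_function g \<and> u g \<noteq> 0 \<and> (\<forall>x. g x \<noteq> 0 \<longrightarrow> f x \<noteq> 0) \<and>
           (\<forall>x y. g x \<noteq> 0 \<longrightarrow> g y \<noteq> 0 \<longrightarrow> dist x y \<le> real DIM('a) * \<epsilon>)"
proof -
  have "\<exists>g. test_function g \<and> u g \<noteq> 0 \<and> (\<forall>x. g x \<noteq> 0 \<longrightarrow> f x \<noteq> 0) \<and>
        (\<forall>b\<in>S. \<exists>c. \<forall>x. g x \<noteq> 0 \<longrightarrow> c \<le> x \<bullet> b \<and> x \<bullet> b \<le> c + \<epsilon>)"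
    if "finite S" "S \<subseteq> Basis" for S :: "'a set"
    using that
  proof (induction S rule: finite_induct)
    case empty then show ?case using f by blast
  next
    case (insert b S)
    then obtain g where g: "test_function g" "u g \<noteq> 0" "\<And>x. g x \<noteq> 0 \<Longrightarrow> f x \<noteq> 0"
      "\<And>b. b \<in> S \<Longrightarrow> \<exists>c. \<forall>x. g x \<noteq> 0 \<longrightarrow> c \<le> x \<bullet> b \<and> x \<bullet> b \<le> c + \<epsilon>" by auto
    obtain h c where h: "test_function h" "u h \<noteq> 0"
      "\<And>x. h x \<noteq> 0 \<Longrightarrow> g x \<noteq> 0 \<and> c \<le> x \<bullet> b \<and> x \<bullet> b \<le> c + \<epsilon>"
      using slab_localise[OF add g(1,2) _ \<epsilon>, of b] insert.prems by auto
    have "\<exists>c. \<forall>x. h x \<noteq> 0 \<longrightarrow> c \<le> x \<bullet> b' \<and> x \<bullet> b' \<le> c + \<epsilon>" if "b' \<in> insert b S" for b'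
      using that h(3) g(4)[of b'] by blast
    then show ?case using h g(3) by blast
  qed
  from this[of Basis] obtain g where g: "test_function g" "u g \<noteq> 0" "\<And>x. g x \<noteq> 0 \<Longrightarrow> f x \<noteq> 0"
      "\<And>b. b \<in> Basis \<Longrightarrow> \<exists>c. \<forall>x. g x \<noteq> 0 \<longrightarrow> c \<le> x \<bullet> b \<and> x \<bullet> b \<le> c + \<epsilon>" by auto
  have "dist x y \<le> real DIM('a) * \<epsilon>" if "g x \<noteq> 0" "g y \<noteq> 0" for x y
  proof -
    have "\<bar>(x - y) \<bullet> b\<bar> \<le> \<epsilon>" if b: "b \<in> Basis" for b
    proof -
      obtain c where "\<forall>x. g x \<noteq> 0 \<longrightarrow> c \<le> x \<bullet> b \<and> x \<bullet> b \<le> c + \<epsilon>" using g(4)[OF b] by blast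
      with \<open>g x \<noteq> 0\<close> \<open>g y \<noteq> 0\<close> have "c \<le> x \<bullet> b" "x \<bullet> b \<le> c + \<epsilon>" "c \<le> y \<bullet> b" "y \<bullet> b \<le> c + \<epsilon>" by auto
      then show ?thesis by (simp add: inner_diff_left abs_le_iff)
    qed
    then have "(\<Sum>b\<in>Basis. \<bar>(x - y) \<bullet> b\<bar>) \<le> (\<Sum>b\<in>(Basis::'a set). \<epsilon>)" by (intro sum_mono)
    then show ?thesis using norm_le_l1[of "x - y"] by (simp add: dist_norm)
  qed
  then show ?thesis using g by blast
qed

text \<open>A nonzero value of \<open>u f\<close> would be inherited by a piece of \<open>f\<close> with arbitrarily small support. Once its diameter is below a Lebesgue number of the cover by open sets on which
\<open>u\<close> vanishes, this is a contradiction.\<close>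

lemma vanishes_off_support:
  fixes u :: "('a::euclidean_space) functional"
  assumes add: "additive_on_tests u"
    and f: "test_function f" and supp: "closure {x. f x \<noteq> 0} \<inter> distr_supp u = {}"
  shows "u f = 0"
proof (rule ccontr)
  assume uf: "u f \<noteq> 0"
  let ?K = "closure {x. f x \<noteq> 0}"
  have "compact ?K" using f by (simp add: test_function_def)
  moreover have "?K \<subseteq> \<Union>{U. open U \<and> vanishes_on u U}" using supp by (auto simp: distr_supp_def)
  ultimately obtain e where e0: "0 < e" "\<forall>x\<in>?K. \<exists>U\<in>{U. open U \<and> vanishes_on u U}. ball x e \<subseteq> U"
    by (rule Heine_Borel_lemma[of ?K "{U. open U \<and> vanishes_on u U}"]) blast+
  have e: "0 < e" "\<And>x. x \<in> ?K \<Longrightarrow> \<exists>U. vanishes_on u U \<and> ball x e \<subseteq> U" using e0 by blast+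
  define \<epsilon> where "\<epsilon> = e / (2 * real DIM('a))"
  have \<epsilon>: "0 < \<epsilon>" using e(1) by (simp add: \<epsilon>_def)
  obtain g where g: "test_function g" "u g \<noteq> 0" "\<And>x. g x \<noteq> 0 \<Longrightarrow> f x \<noteq> 0"
    "\<And>x y. g x \<noteq> 0 \<Longrightarrow> g y \<noteq> 0 \<Longrightarrow> dist x y \<le> real DIM('a) * \<epsilon>"
    using box_localise[OF add f uf \<epsilon>] by blast
  have "\<exists>x. g x \<noteq> 0"
  proof (rule ccontr)
    assume "\<not> ?thesis"
    then have "g = (\<lambda>x. 0)" by (intro ext) simp
    with g(2) additive_on_tests_zero[OF add] show False by (simp only: simp_thms)
  qed
  then obtain x where x: "g x \<noteq> 0" ..
  have "x \<in> ?K" using g(3)[OF x] closure_subset[of "{x. f x \<noteq> 0}"] by blast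
  from e(2)[OF this] obtain U where U: "vanishes_on u U" "ball x e \<subseteq> U" by blast
  have "{y. g y \<noteq> 0} \<subseteq> cball x (e / 2)" using g(4)[OF x] by (auto simp: \<epsilon>_def)
  then have "closure {y. g y \<noteq> 0} \<subseteq> cball x (e / 2)" by (rule closure_minimal) simp
  also have "\<dots> \<subseteq> ball x e" using e(1) by auto
  finally show False using U g(1,2) unfolding vanishes_on_def by blast
qed

lemma smooth_fun_scale: "smooth_fun f \<Longrightarrow> smooth_fun (\<lambda>x. f (c *\<^sub>R x))"
  using smooth_fun_affine[of f "\<lambda>x. c *\<^sub>R x" 0] by (simp add: linear_scaleR)

lemma pd_scale:
  assumes "smooth_fun f" shows "pd b (\<lambda>x. f (c *\<^sub>R x)) = (\<lambda>x. of_real c * pd b f (c *\<^sub>R x))"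
proof -
  have "linear (\<lambda>x::'a. c *\<^sub>R x)" by (simp add: linear_scaleR)
  from pd_affine[OF this smooth_fun_differentiable[OF assms], of b 0]
  have "pd b (\<lambda>x. f (c *\<^sub>R x)) = (\<lambda>x. pd (c *\<^sub>R b) f (c *\<^sub>R x))" by simp
  moreover have "pd (c *\<^sub>R b) f y = of_real c * pd b f y" for y
    using linear_cmul[OF linear_pd[OF smooth_fun_differentiable[OF assms]]] by (simp add: scaleR_conv_of_real)
  ultimately show ?thesis by simp
qed

text \<open>For small \<open>\<epsilon>\<close> the product \<open>f x * \<theta> (\<epsilon> x)\<close> lives where \<open>|x| \<ge> 1 / \<epsilon>\<close>, so one extra power of the weight
gains a factor \<open>\<epsilon>\<close>. A derivative falls either on \<open>f\<close> or, with an additional factor \<open>\<epsilon>\<close>, on \<open>\<theta>\<close>. The constant \<open>c\<close> allows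
\<open>\<theta>\<close> to be one minus a cutoff as well as a derivative of it, which keeps the induction going.\<close>

lemma cutoff_remainder_bound:
  fixes f \<theta> :: "'a::euclidean_space \<Rightarrow> complex"
  assumes "f \<in> schwartz_space" "smooth_fun \<theta>" "\<And>x. norm x < 1 \<Longrightarrow> \<theta> x = 0"
    and "test_function (\<lambda>x. c + \<theta> x)" and "bs \<in> lists Basis"
  shows "\<exists>C. \<forall>\<epsilon> x. 0 < \<epsilon> \<longrightarrow> \<epsilon> \<le> 1 \<longrightarrow>
    (1 + norm x) ^ k * norm (iterated_partial bs (\<lambda>x. f x * \<theta> (\<epsilon> *\<^sub>R x)) x) \<le> C * \<epsilon>"
  using assms
proof (induction bs arbitrary: f \<theta> c rule: rev_induct)
  case Nil
  obtain B where B: "\<And>x. (1 + norm x) ^ Suc k * norm (f x) \<le> B"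
    using Nil.prems(1) regularD(2)[of rapid 0 f] unfolding schwartz_iff rapid_def by blast
  obtain B' where B': "\<And>x. norm (c + \<theta> x) \<le> B'"
    using schwartz_bounded[OF test_function_schwartz[OF Nil.prems(4)]] by blast
  have T: "norm (\<theta> x) \<le> B' + norm c" for x
    using B'[of x] norm_triangle_ineq2[of "\<theta> x" "- c"] by (simp add: add.commute)
  have B0: "0 \<le> B" using order_trans[OF _ B[of 0]] by simp
  have T0: "0 \<le> B' + norm c" using T[of 0] norm_ge_zero order_trans by blast
  have "(1 + norm x) ^ k * norm (f x * \<theta> (\<epsilon> *\<^sub>R x)) \<le> (B * (B' + norm c)) * \<epsilon>"
    if \<epsilon>: "0 < \<epsilon>" "\<epsilon> \<le> 1" for \<epsilon> x
  proof (cases "norm (\<epsilon> *\<^sub>R x) < 1")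
    case True
    then show ?thesis using Nil.prems(3)[OF True] B0 T0 \<epsilon> by simp
  next
    case False
    then have "1 \<le> \<epsilon> * (1 + norm x)" using \<epsilon> by (simp add: algebra_simps)
    then have "1 * ((1 + norm x) ^ k * norm (f x)) \<le> (\<epsilon> * (1 + norm x)) * ((1 + norm x) ^ k * norm (f x))"
      by (rule mult_right_mono) simp
    also have "\<dots> = \<epsilon> * ((1 + norm x) ^ Suc k * norm (f x))" by simp
    also have "\<dots> \<le> \<epsilon> * B" using \<epsilon> by (intro mult_left_mono B) simp
    finally have "(1 + norm x) ^ k * norm (f x) \<le> \<epsilon> * B" by simp
    then have "((1 + norm x) ^ k * norm (f x)) * norm (\<theta> (\<epsilon> *\<^sub>R x)) \<le> (\<epsilon> * B) * (B' + norm c)"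
      by (rule mult_mono[OF _ T]) (use B0 \<epsilon> in auto)
    then show ?thesis by (simp add: norm_mult mult_ac)
  qed
  then show ?case by auto
next
  case (snoc b bs)
  note s\<theta> = snoc.prems(2) and sf = schwartz_smooth[OF snoc.prems(1)]
  have b: "b \<in> Basis" and bs: "bs \<in> lists Basis" using snoc.prems(5) by auto
  have spd: "smooth_fun (pd b \<theta>)" by (rule smooth_fun_pd[OF s\<theta>])
  have pdc: "pd b (\<lambda>x. c + \<theta> x) = pd b \<theta>"
    using pd_add[OF smooth_fun_differentiable[OF smooth_fun_const[of c]] smooth_fun_differentiable[OF s\<theta>], of b] by simp
  have pt: "test_function (\<lambda>x. 0 + pd b \<theta> x)" using test_function_pd[OF snoc.prems(4), of b] pdc by simp
  have pz: "pd b \<theta> x = 0" if "norm x < 1" for x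
  proof (rule pd_eq_0_outside)
    have "open (ball (0::'a) 1)" "x \<in> ball 0 1" "ball 0 1 \<inter> {x. \<theta> x \<noteq> 0} = {}"
      using that snoc.prems(3) by auto
    then show "x \<notin> closure {x. \<theta> x \<noteq> 0}" using open_Int_closure_eq_empty by blast
  qed
  let ?F1 = "\<lambda>\<epsilon> x. f x * pd b \<theta> (\<epsilon> *\<^sub>R x)" and ?F2 = "\<lambda>\<epsilon> x. pd b f x * \<theta> (\<epsilon> *\<^sub>R x)"
  obtain C1 where C1: "\<And>\<epsilon> x. 0 < \<epsilon> \<Longrightarrow> \<epsilon> \<le> 1 \<Longrightarrow> (1 + norm x) ^ k * norm (iterated_partial bs (?F1 \<epsilon>) x) \<le> C1 * \<epsilon>"
    using snoc.IH[OF snoc.prems(1) spd pz pt bs] by blast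
  obtain C2 where C2: "\<And>\<epsilon> x. 0 < \<epsilon> \<Longrightarrow> \<epsilon> \<le> 1 \<Longrightarrow> (1 + norm x) ^ k * norm (iterated_partial bs (?F2 \<epsilon>) x) \<le> C2 * \<epsilon>"
    using snoc.IH[OF schwartz_pd[OF snoc.prems(1) b] s\<theta> snoc.prems(3,4) bs] by blast
  have "(1 + norm x) ^ k * norm (iterated_partial (bs @ [b]) (\<lambda>x. f x * \<theta> (\<epsilon> *\<^sub>R x)) x) \<le> (C1 + C2) * \<epsilon>"
    if \<epsilon>: "0 < \<epsilon>" "\<epsilon> \<le> 1" for \<epsilon> x
  proof -
    have s1: "smooth_fun (?F1 \<epsilon>)" by (intro smooth_fun_mult sf smooth_fun_scale spd)
    have s2: "smooth_fun (?F2 \<epsilon>)" by (intro smooth_fun_mult smooth_fun_pd sf smooth_fun_scale s\<theta>)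
    have "pd b (\<lambda>x. f x * \<theta> (\<epsilon> *\<^sub>R x)) = (\<lambda>x. of_real \<epsilon> * ?F1 \<epsilon> x + ?F2 \<epsilon> x)"
      using pd_mult[OF smooth_fun_differentiable[OF sf] smooth_fun_differentiable[OF smooth_fun_scale[OF s\<theta>]], of b \<epsilon>]
      unfolding pd_scale[OF s\<theta>] by (simp add: mult_ac)
    then have eq: "iterated_partial (bs @ [b]) (\<lambda>x. f x * \<theta> (\<epsilon> *\<^sub>R x)) x =
        of_real \<epsilon> * iterated_partial bs (?F1 \<epsilon>) x + iterated_partial bs (?F2 \<epsilon>) x"
      by (simp only: iterated_partial_append iterated_partial.simps(1) iterated_partial_Cons_pd
          iterated_partial_add[OF smooth_fun_cmult[OF s1] s2] iterated_partial_cmult[OF s1])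
    have "norm (of_real \<epsilon> * iterated_partial bs (?F1 \<epsilon>) x) \<le> 1 * norm (iterated_partial bs (?F1 \<epsilon>) x)"
      unfolding norm_mult norm_of_real using \<epsilon> by (intro mult_right_mono) auto
    then have "norm (iterated_partial (bs @ [b]) (\<lambda>x. f x * \<theta> (\<epsilon> *\<^sub>R x)) x)
        \<le> norm (iterated_partial bs (?F1 \<epsilon>) x) + norm (iterated_partial bs (?F2 \<epsilon>) x)"
      unfolding eq by (intro norm_triangle_le) simp
    then have "(1 + norm x) ^ k * norm (iterated_partial (bs @ [b]) (\<lambda>x. f x * \<theta> (\<epsilon> *\<^sub>R x)) x)
       \<le> (1 + norm x) ^ k * (norm (iterated_partial bs (?F1 \<epsilon>) x) + norm (iterated_partial bs (?F2 \<epsilon>) x))"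
      by (rule mult_left_mono) simp
    also have "\<dots> \<le> C1 * \<epsilon> + C2 * \<epsilon>" unfolding distrib_left by (intro add_mono C1 C2 \<epsilon>)
    finally show ?thesis by (simp add: distrib_right)
  qed
  then show ?case by blast
qed

text \<open>Cutting off \<open>f\<close> at radius of order \<open>1 / \<epsilon>\<close> changes it by a remainder with seminorms \<open>O(\<epsilon>)\<close>.\<close>

lemma test_functions_dense:
  fixes u :: "('a::euclidean_space) functional"
  assumes u: "bounded_functional u" and f: "f \<in> schwartz_space" "u f \<noteq> 0"
  shows "\<exists>g. test_function g \<and> u g \<noteq> 0"
proof (rule ccontr)
  assume neg: "\<not> ?thesis"
  obtain \<theta>0 :: "'a \<Rightarrow> complex" where \<theta>0: "test_function \<theta>0" "\<And>x. norm x \<le> 1 \<Longrightarrow> \<theta>0 x = 1"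
    using exists_cutoff by blast
  note s\<theta>0 = test_functionD(1)[OF \<theta>0(1)]
  define \<theta> where "\<theta> x = 1 + (-1) * \<theta>0 x" for x
  have s\<theta>: "smooth_fun \<theta>" unfolding \<theta>_def[abs_def]
    by (intro smooth_fun_add smooth_fun_const smooth_fun_cmult s\<theta>0)
  have t\<theta>: "test_function (\<lambda>x. -1 + \<theta> x)" using test_function_cmult[OF \<theta>0(1), of "-1"] by (simp add: \<theta>_def)
  obtain r where r: "0 < r" "\<And>x. \<theta>0 x \<noteq> 0 \<Longrightarrow> norm x \<le> r" using test_functionD(2)[OF \<theta>0(1)] by auto
  let ?g = "\<lambda>\<epsilon> x. f x * \<theta>0 (\<epsilon> *\<^sub>R x)" and ?h = "\<lambda>\<epsilon> x. f x * \<theta> (\<epsilon> *\<^sub>R x)"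
  have tg: "test_function (?g \<epsilon>)" if \<epsilon>: "0 < \<epsilon>" for \<epsilon>
  proof (rule test_functionI)
    show "smooth_fun (?g \<epsilon>)" by (intro smooth_fun_mult schwartz_smooth f smooth_fun_scale s\<theta>0)
    fix x assume "?g \<epsilon> x \<noteq> 0"
    then have "\<theta>0 (\<epsilon> *\<^sub>R x) \<noteq> 0" by simp
    then have "norm (\<epsilon> *\<^sub>R x) \<le> r" by (rule r(2))
    then show "norm x \<le> r / \<epsilon>" using \<epsilon> by (simp add: field_simps)
  qed
  have h: "?h \<epsilon> = (\<lambda>x. f x - ?g \<epsilon> x)" for \<epsilon> by (auto simp: \<theta>_def algebra_simps)
  have "u f = 0"
  proof (rule bounded_functional_limit[OF u, where F="?h"])
    fix \<epsilon> :: real assume \<epsilon>: "0 < \<epsilon>"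
    show "?h \<epsilon> \<in> schwartz_space" unfolding h by (intro schwartz_diff f test_function_schwartz tg \<epsilon>)
    show "u (?h \<epsilon>) = u f" unfolding h
      using bounded_functional_diff[OF u f(1) test_function_schwartz[OF tg[OF \<epsilon>]]] neg tg[OF \<epsilon>] by simp
  next
    fix k and bs :: "'a list" assume "bs \<in> lists Basis"
    then show "\<exists>C. \<forall>\<epsilon> x. 0 < \<epsilon> \<longrightarrow> \<epsilon> \<le> 1 \<longrightarrow> (1 + norm x) ^ k * norm (iterated_partial bs (?h \<epsilon>) x) \<le> C * \<epsilon>"
      by (intro cutoff_remainder_bound[OF f(1) s\<theta> _ t\<theta>]) (auto simp: \<theta>_def \<theta>0(2))
  qed
  with f(2) show False by simp
qed

lemma nonzero_imp_support_nonempty: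
  assumes u: "bounded_functional u" and "\<not> zero_distribution u"
  shows "distr_supp u \<noteq> {}"
proof
  assume e: "distr_supp u = {}"
  obtain f where "f \<in> schwartz_space" "u f \<noteq> 0" using assms(2) by (auto simp: zero_distribution_def)
  then obtain g where g: "test_function g" "u g \<noteq> 0" using test_functions_dense[OF u] by blast
  have "u g = 0"
    by (rule vanishes_off_support[OF _ g(1)])
       (use e in \<open>auto intro!: bounded_functionalD(1)[OF u] test_function_schwartz simp: additive_on_tests_def\<close>)
  with g(2) show False by simp
qed

lemma distr_supp_conj: "distr_supp u \<subseteq> distr_supp (conj_distr u)"
proof -
  have "vanishes_on u U" if v: "vanishes_on (conj_distr u) U" for U
    unfolding vanishes_on_def
  proof (intro allI impI)
    fix f assume f: "test_function f \<and> closure {x. f x \<noteq> 0} \<subseteq> U"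
    have "conj_distr u (\<lambda>x. cnj (f x)) = 0"
      using v[unfolded vanishes_on_def, rule_format, of "\<lambda>x. cnj (f x)"] f by (simp add: test_function_cnj)
    then show "u f = 0" by (simp add: conj_distr_def)
  qed
  then show ?thesis unfolding distr_supp_def by blast
qed

section \<open>Integrals depending on a parameter\<close>

lemma integrable_compact_support:
  fixes f :: "'a::euclidean_space \<Rightarrow> complex"
  assumes "continuous_on UNIV f" "\<And>x. f x \<noteq> 0 \<Longrightarrow> norm x \<le> r"
  shows "integrable lborel f"
proof -
  have "integrable lborel (\<lambda>x. indicator (cball 0 r) x *\<^sub>R f x)"
    by (rule borel_integrable_compact) (use assms(1) in \<open>auto intro: continuous_on_subset\<close>)
  moreover have "(\<lambda>x. indicator (cball 0 r) x *\<^sub>R f x) = f"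
    using assms(2) by (fastforce simp: indicator_def fun_eq_iff)
  ultimately show ?thesis by simp
qed

lemma norm_lborel_integral_le:
  fixes f :: "'a::euclidean_space \<Rightarrow> complex"
  assumes "integrable lborel f" "integrable lborel m" "\<And>s. norm (f s) \<le> m s"
  shows "norm (\<integral>s. f s \<partial>lborel) \<le> (\<integral>s. m s \<partial>lborel)"
  by (rule order_trans[OF integral_norm_bound integral_mono[OF integrable_norm]]) (use assms in auto)

lemma integrable_indicator_cball:
  "integrable lborel (\<lambda>w::'a::euclidean_space. (B::real) * indicator (cball 0 r) w)"
  by (intro integrable_mult_right integrable_real_indicator)
     (auto simp: emeasure_lborel_cball_finite[unfolded infinity_ennreal_def])

text \<open>Differentiation under the integral sign with an integrable majorant of the quadratic remainder.\<close>

lemma has_derivative_integral_quadratic: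
  fixes F :: "'a::euclidean_space \<Rightarrow> 'b::euclidean_space \<Rightarrow> complex"
  assumes F: "\<And>h. norm h \<le> 1 \<Longrightarrow> integrable lborel (F (x + h))"
    and F': "\<And>b. b \<in> Basis \<Longrightarrow> integrable lborel (F' b)"
    and m: "integrable lborel m"
    and rem: "\<And>h s. norm h \<le> 1 \<Longrightarrow>
       norm (F (x + h) s - F x s - (\<Sum>b\<in>Basis. of_real (h \<bullet> b) * F' b s)) \<le> m s * (norm h)\<^sup>2"
  shows "((\<lambda>x. \<integral>s. F x s \<partial>lborel) has_derivative
           (\<lambda>h. \<Sum>b\<in>Basis. of_real (h \<bullet> b) * (\<integral>s. F' b s \<partial>lborel))) (at x)"
proof (rule has_derivative_quadratic)
  show "linear (\<lambda>h. \<Sum>b\<in>Basis. of_real (h \<bullet> b) * (\<integral>s. F' b s \<partial>lborel))"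
    by (intro linear_compose_sum ballI linearI) (auto simp: inner_add_left algebra_simps scaleR_conv_of_real)
  fix h :: 'a assume h: "norm h \<le> 1"
  have i: "integrable lborel (F (x + h))" "integrable lborel (F x)" using F[OF h] F[of 0] by auto
  have i': "integrable lborel (\<lambda>s. \<Sum>b\<in>Basis. of_real (h \<bullet> b) * F' b s)"
    by (intro Bochner_Integration.integrable_sum integrable_mult_right F')
  have "(\<integral>s. F (x + h) s \<partial>lborel) - (\<integral>s. F x s \<partial>lborel) - (\<Sum>b\<in>Basis. of_real (h \<bullet> b) * (\<integral>s. F' b s \<partial>lborel))
     = (\<integral>s. F (x + h) s - F x s - (\<Sum>b\<in>Basis. of_real (h \<bullet> b) * F' b s) \<partial>lborel)"
    using i i' F' by (simp add: Bochner_Integration.integral_diff Bochner_Integration.integral_sum integrable_mult_right)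
  also have "norm \<dots> \<le> (\<integral>s. m s * (norm h)\<^sup>2 \<partial>lborel)"
    by (rule norm_lborel_integral_le)
       (use i i' m rem[OF h] in \<open>auto intro: Bochner_Integration.integrable_diff\<close>)
  finally show "norm ((\<integral>s. F (x + h) s \<partial>lborel) - (\<integral>s. F x s \<partial>lborel) -
      (\<Sum>b\<in>Basis. of_real (h \<bullet> b) * (\<integral>s. F' b s \<partial>lborel))) \<le> (\<integral>s. m s \<partial>lborel) * (norm h)\<^sup>2" by simp
qed

text \<open>The \<open>s\<close>-support stays bounded as long as the parameter \<open>z\<close> does; compact support in \<open>(z, s)\<close> would be
too much, since exponentials and translations occur as integrands.\<close>

definition proper_support :: "('a::euclidean_space \<times> 'b::euclidean_space \<Rightarrow> complex) \<Rightarrow> bool" where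
  "proper_support F \<longleftrightarrow> (\<forall>R. \<exists>r. \<forall>z s. norm z \<le> R \<longrightarrow> F (z, s) \<noteq> 0 \<longrightarrow> norm s \<le> r)"

lemma proper_support_pd:
  assumes "proper_support F" shows "proper_support (pd v F)"
  unfolding proper_support_def
proof
  fix R :: real
  obtain r where r: "\<And>z s. norm z \<le> R + 1 \<Longrightarrow> F (z, s) \<noteq> 0 \<Longrightarrow> norm s \<le> r"
    using assms unfolding proper_support_def by blast
  have "norm s \<le> r" if z: "norm z \<le> R" and "pd v F (z, s) \<noteq> 0" for z s
  proof (rule ccontr)
    assume "\<not> norm s \<le> r"
    have o: "open (ball (0::'a) (R + 1) \<times> - cball (0::'b) r)" by (intro open_Times) auto
    have "(z, s) \<in> ball 0 (R + 1) \<times> - cball 0 r" using z \<open>\<not> norm s \<le> r\<close> by auto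
    moreover have "(ball 0 (R + 1) \<times> - cball 0 r) \<inter> {w. F w \<noteq> 0} = {}" using r by force
    ultimately have "(z, s) \<notin> closure {w. F w \<noteq> 0}" using open_Int_closure_eq_empty[OF o] by blast
    then show False using pd_eq_0_outside that(2) by blast
  qed
  then show "\<exists>r. \<forall>z s. norm z \<le> R \<longrightarrow> pd v F (z, s) \<noteq> 0 \<longrightarrow> norm s \<le> r" by blast
qed

lemma smooth_fun_slice:
  fixes f :: "'a::euclidean_space \<times> 'b::euclidean_space \<Rightarrow> complex"
  assumes "smooth_fun f" shows "smooth_fun (\<lambda>y. f (x, y))"
proof -
  have "linear (\<lambda>y::'b. (0::'a, y))" by (auto intro!: linearI)
  from smooth_fun_affine[OF assms this, of "(x, 0)"] show ?thesis by simp
qed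

lemma integrable_slice:
  assumes "smooth_fun F" "proper_support F" shows "integrable lborel (\<lambda>s. F (z, s))"
proof -
  obtain r where "\<And>z' s. norm z' \<le> norm z \<Longrightarrow> F (z', s) \<noteq> 0 \<Longrightarrow> norm s \<le> r"
    using assms(2) unfolding proper_support_def by blast
  then show ?thesis
    by (intro integrable_compact_support[where r=r] smooth_fun_continuous smooth_fun_slice assms(1)) auto
qed

lemma param_integral_deriv:
  fixes F :: "'a::euclidean_space \<times> 'b::euclidean_space \<Rightarrow> complex"
  assumes F: "smooth_fun F" and ps: "proper_support F"
  shows "((\<lambda>z. \<integral>s. F (z, s) \<partial>lborel) has_derivative
           (\<lambda>h. \<Sum>b\<in>Basis. of_real (h \<bullet> b) * (\<integral>s. pd (b, 0) F (z, s) \<partial>lborel))) (at z)"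
proof -
  obtain r1 where r1: "\<And>z' s. norm z' \<le> norm z + 1 \<Longrightarrow> F (z', s) \<noteq> 0 \<Longrightarrow> norm s \<le> r1"
    using ps unfolding proper_support_def by blast
  have "\<forall>b\<in>Basis. \<exists>r. \<forall>z' s. norm z' \<le> norm z \<longrightarrow> pd (b, 0) F (z', s) \<noteq> 0 \<longrightarrow> norm s \<le> r"
    using proper_support_pd[OF ps] unfolding proper_support_def by blast
  then obtain r2 where r2: "\<And>b s. b \<in> Basis \<Longrightarrow> pd (b, 0) F (z, s) \<noteq> 0 \<Longrightarrow> norm s \<le> r2 b"
    by (metis order_refl)
  \<comment> \<open>One radius works for F near z and for all first derivatives at z.\<close>
  define r where "r = \<bar>r1\<bar> + (\<Sum>b\<in>Basis. \<bar>r2 b\<bar>)"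
  have "\<bar>r2 b\<bar> \<le> (\<Sum>b\<in>Basis. \<bar>r2 b\<bar>)" if "b \<in> Basis" for b
    by (rule member_le_sum) (use that in auto)
  then have r2r: "norm s \<le> r" if "b \<in> Basis" "pd (b, 0) F (z, s) \<noteq> 0" for b s
    using r2[OF that] that unfolding r_def by (smt (verit))
  have r1r: "norm s \<le> r" if "norm z' \<le> norm z + 1" "F (z', s) \<noteq> 0" for z' s
    proof -
    have "0 \<le> (\<Sum>b\<in>Basis. \<bar>r2 b\<bar>)" by (intro sum_nonneg) auto
    with r1[OF that] show ?thesis unfolding r_def by linarith
  qed
  let ?C = "cball (0::'a) (norm z + 1) \<times> cball (0::'b) r"
  have "\<exists>M. \<forall>p\<in>Basis \<times> Basis. \<forall>w\<in>?C. norm ((\<lambda>(b, c). pd c (pd b F)) p w) \<le> M"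
    by (rule smooth_family_bounded_on_compact) (auto intro: smooth_fun_pd F compact_Times)
  then obtain M where M: "norm (pd c (pd b F) w) \<le> M" if "b \<in> Basis" "c \<in> Basis" "w \<in> ?C" for b c w
    by fastforce
  have pdh: "(\<Sum>b\<in>Basis. of_real (h \<bullet> b) * pd (b, 0) F w) = pd (h, 0) F w" for h w
    unfolding pd_expand[OF smooth_fun_differentiable[OF F], of "(h, 0)"] by (simp add: sum_Basis_prod)
  show ?thesis
  proof (rule has_derivative_integral_quadratic)
    show "integrable lborel (\<lambda>s. F (z + h, s))" for h by (rule integrable_slice[OF F ps])
    show "integrable lborel (\<lambda>s. pd (b, 0) F (z, s))" for b
      by (intro integrable_slice smooth_fun_pd F proper_support_pd ps)
    show "integrable lborel (\<lambda>s. ((real DIM('a \<times> 'b))\<^sup>2 * M) * indicator (cball 0 r) s)"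
      by (rule integrable_indicator_cball)
    fix h :: 'a and s assume h: "norm h \<le> 1"
    have zh: "norm (z + h) \<le> norm z + 1" using norm_triangle_ineq[of z h] h by linarith
    show "norm (F (z + h, s) - F (z, s) - (\<Sum>b\<in>Basis. of_real (h \<bullet> b) * pd (b, 0) F (z, s)))
       \<le> ((real DIM('a \<times> 'b))\<^sup>2 * M) * indicator (cball 0 r) s * (norm h)\<^sup>2"
    proof (cases "norm s \<le> r")
      case True
      have "norm (F ((z, s) + (h, 0)) - F (z, s) - pd (h, 0) F (z, s)) \<le> (real DIM('a \<times> 'b))\<^sup>2 * M * (norm (h, 0::'b))\<^sup>2"
      proof (rule smooth_taylor_bound[OF F])
        fix w b c :: "'a \<times> 'b" assume w: "w \<in> closed_segment (z, s) ((z, s) + (h, 0))" and bc: "b \<in> Basis" "c \<in> Basis"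
        have cv: "convex ?C" by (intro convex_Times convex_cball)
        have ends: "(z, s) \<in> ?C" "(z, s) + (h, 0) \<in> ?C" using zh True by auto
        have "w \<in> ?C" by (rule subsetD[OF closed_segment_subset[OF ends cv] w])
        with bc show "norm (pd c (pd b F) w) \<le> M" by (intro M)
      qed
      then show ?thesis unfolding pdh using True by (simp add: norm_Pair)
    next
      case False
      have "F (z + h, s) = 0" "F (z, s) = 0" using r1r[of "z + h" s] r1r[of z s] zh False by auto
      moreover have "pd (b, 0) F (z, s) = 0" if "b \<in> Basis" for b using r2r[OF that] False by blast
      ultimately show ?thesis using False by simp
    qed
  qed
qed

lemma
  fixes F :: "'a::euclidean_space \<times> 'b::euclidean_space \<Rightarrow> complex"
  assumes F: "smooth_fun F" and ps: "proper_support F"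
  shows param_integral_differentiable: "(\<lambda>z. \<integral>s. F (z, s) \<partial>lborel) differentiable (at z)"
    and param_integral_pd: "b \<in> Basis \<Longrightarrow>
          pd b (\<lambda>z. \<integral>s. F (z, s) \<partial>lborel) = (\<lambda>z. \<integral>s. pd (b, 0) F (z, s) \<partial>lborel)"
proof -
  show "(\<lambda>z. \<integral>s. F (z, s) \<partial>lborel) differentiable (at z)"
    using param_integral_deriv[OF assms] unfolding differentiable_def by blast
  assume b: "b \<in> Basis"
  show "pd b (\<lambda>z. \<integral>s. F (z, s) \<partial>lborel) = (\<lambda>z. \<integral>s. pd (b, 0) F (z, s) \<partial>lborel)"
    by (rule ext, rule pd_eq_coefficient[OF param_integral_deriv[OF assms] b])
qed

lemma smooth_param_integral:
  fixes F :: "'a::euclidean_space \<times> 'b::euclidean_space \<Rightarrow> complex"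
  assumes "smooth_fun F" "proper_support F"
  shows "smooth_fun (\<lambda>z. \<integral>s. F (z, s) \<partial>lborel)"
proof (rule smooth_fun_coinduct[where P="\<lambda>g. \<exists>F::'a \<times> 'b \<Rightarrow> complex. smooth_fun F \<and> proper_support F \<and> g = (\<lambda>z. \<integral>s. F (z, s) \<partial>lborel)"])
  fix g :: "'a \<Rightarrow> complex"
  assume "\<exists>F::'a \<times> 'b \<Rightarrow> complex. smooth_fun F \<and> proper_support F \<and> g = (\<lambda>z. \<integral>s. F (z, s) \<partial>lborel)"
  then obtain F :: "'a \<times> 'b \<Rightarrow> complex" where F: "smooth_fun F" "proper_support F" "g = (\<lambda>z. \<integral>s. F (z, s) \<partial>lborel)" by blast
  show "(\<forall>x. g differentiable (at x)) \<and> (\<forall>b\<in>Basis. \<exists>F::'a \<times> 'b \<Rightarrow> complex. smooth_fun F \<and> proper_support F \<and> pd b g = (\<lambda>z. \<integral>s. F (z, s) \<partial>lborel))"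
    using F param_integral_differentiable[OF F(1,2)] param_integral_pd[OF F(1,2)]
      smooth_fun_pd[OF F(1)] proper_support_pd[OF F(2)] by blast
qed (use assms in blast)

lemma lborel_integral_translate:
  fixes f :: "'a::euclidean_space \<Rightarrow> complex"
  assumes "f \<in> borel_measurable borel"
  shows "(\<integral>s. f (c + s) \<partial>lborel) = (\<integral>s. f s \<partial>lborel)"
  by (subst lborel_distr_plus[of c, symmetric]) (subst integral_distr, auto simp: assms)

text \<open>The integral of \<open>f (t b + s)\<close> over \<open>s\<close> does not depend on \<open>t\<close>; differentiate in \<open>t\<close>.\<close>

lemma integral_pd_eq_0:
  fixes f :: "'b::euclidean_space \<Rightarrow> complex"
  assumes f: "test_function f"
  shows "(\<integral>s. pd b f s \<partial>lborel) = 0"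
proof -
  note sf = test_functionD(1)[OF f]
  \<comment> \<open>The parameter is the length of the translation along b.\<close>
  define F :: "real \<times> 'b \<Rightarrow> complex" where "F w = f (fst w *\<^sub>R b + snd w)" for w
  have L: "linear (\<lambda>w::real \<times> 'b. fst w *\<^sub>R b + snd w)" by (auto intro!: linearI simp: algebra_simps)
  have sF: "smooth_fun F" unfolding F_def[abs_def] using smooth_fun_affine[OF sf L, of 0] by simp
  obtain r where r: "0 < r" "\<And>x. f x \<noteq> 0 \<Longrightarrow> norm x \<le> r" using test_functionD(2)[OF f] by auto
  have pF: "proper_support F" unfolding proper_support_def
  proof
    fix R
    have "norm s \<le> r + R * norm b" if "norm z \<le> R" "F (z, s) \<noteq> 0" for z :: real and s
    proof -
      have "norm (z *\<^sub>R b + s) \<le> r" using that(2) r(2) by (simp add: F_def)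
      moreover have "norm (z *\<^sub>R b) \<le> R * norm b" using that(1) by (simp add: mult_right_mono)
      ultimately show ?thesis using norm_triangle_ineq4[of "z *\<^sub>R b + s" "z *\<^sub>R b"] by simp
    qed
    then show "\<exists>r. \<forall>z s. norm z \<le> R \<longrightarrow> F (z, s) \<noteq> 0 \<longrightarrow> norm s \<le> r" by blast
  qed
  have fm: "f \<in> borel_measurable borel" by (rule borel_measurable_continuous_onI[OF smooth_fun_continuous[OF sf]])
  have "(\<lambda>z. \<integral>s. F (z, s) \<partial>lborel) = (\<lambda>z. \<integral>s. f s \<partial>lborel)"
    by (simp add: F_def lborel_integral_translate[OF fm])
  then have "(\<integral>s. pd (1, 0) F (0, s) \<partial>lborel) = 0"
    using param_integral_pd[OF sF pF, of 1] by (simp add: fun_eq_iff)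
  moreover have "pd (1, 0) F (0, s) = pd b f s" for s
    using pd_affine[OF L smooth_fun_differentiable[OF sf], of "(1, 0)" 0] by (simp add: F_def[abs_def])
  ultimately show ?thesis by simp
qed

section \<open>The partial Fourier transform of test functions\<close>

abbreviation character :: "real \<Rightarrow> 'a::real_inner \<Rightarrow> 'a \<Rightarrow> complex" where
  "character c x w \<equiv> exp (\<i> * of_real (c * (x \<bullet> w)))"

text \<open>The constant \<open>c\<close> is \<open>-2 \<pi>\<close> for the partial Fourier transform and \<open>2 \<pi>\<close> for its inverse.\<close>

definition partial_ft :: "real \<Rightarrow> ('a::euclidean_space \<times> 'b::euclidean_space \<Rightarrow> complex) \<Rightarrow> 'a \<times> 'b \<Rightarrow> complex" where
  "partial_ft c g = (\<lambda>z. \<integral>w. g (fst z, w) * character c (snd z) w \<partial>lborel)"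

definition partial_ft_integrand :: "real \<Rightarrow> ('a::euclidean_space \<times> 'b::euclidean_space \<Rightarrow> complex) \<Rightarrow> ('a \<times> 'b) \<times> 'b \<Rightarrow> complex" where
  "partial_ft_integrand c g = (\<lambda>p. g (fst (fst p), snd p) * character c (snd (fst p)) (snd p))"

lemma partial_ft_eq: "partial_ft c g = (\<lambda>z. \<integral>w. partial_ft_integrand c g (z, w) \<partial>lborel)"
  by (simp add: partial_ft_def partial_ft_integrand_def)

lemma smooth_inner:
  fixes l m :: "'a::euclidean_space \<Rightarrow> 'b::euclidean_space"
  assumes "linear l" "linear m"
  shows "smooth_fun (\<lambda>x. complex_of_real (l x \<bullet> m x))"
proof -
  have "linear (\<lambda>x. l x \<bullet> b)" "linear (\<lambda>x. m x \<bullet> b)" for b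
    using linear_add[OF assms(1)] linear_cmul[OF assms(1)] linear_add[OF assms(2)] linear_cmul[OF assms(2)]
    by (auto intro!: linearI simp: inner_add_left)
  then have "smooth_fun (\<lambda>x. \<Sum>b\<in>Basis. complex_of_real (l x \<bullet> b) * complex_of_real (m x \<bullet> b))"
    by (intro smooth_fun_sum smooth_fun_mult smooth_fun_linear)
  then show ?thesis by (simp add: euclidean_inner[of "l _" "m _"])
qed

lemma smooth_character:
  fixes l m :: "'a::euclidean_space \<Rightarrow> 'b::euclidean_space"
  assumes "linear l" "linear m"
  shows "smooth_fun (\<lambda>x. character c (l x) (m x))"
proof -
  have "smooth_fun (\<lambda>x. (\<i> * of_real c) * complex_of_real (l x \<bullet> m x))"
    by (intro smooth_fun_cmult smooth_inner assms)
  from smooth_fun_exp[OF this] show ?thesis by (simp add: mult.assoc)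
qed

lemma linear_fst_snd:
  "linear (\<lambda>p::('a::real_vector \<times> 'b::real_vector) \<times> 'c::real_vector. snd (fst p))"
  "linear (\<lambda>p::('a \<times> 'b) \<times> 'c. snd p)"
  "linear (\<lambda>p::('a \<times> 'b) \<times> 'c. (fst (fst p), snd p))"
  by (auto intro!: linearI)

lemma smooth_partial_ft_integrand:
  assumes "smooth_fun g" shows "smooth_fun (partial_ft_integrand c g)"
  unfolding partial_ft_integrand_def
  using smooth_fun_affine[OF assms linear_fst_snd(3), of 0]
  by (intro smooth_fun_mult smooth_character linear_fst_snd) simp

lemma proper_partial_ft_integrand:
  assumes "test_function g" shows "proper_support (partial_ft_integrand c g)"
proof -
  obtain r where r: "\<And>z. g z \<noteq> 0 \<Longrightarrow> norm z \<le> r" using test_functionD(2)[OF assms] by auto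
  have "norm w \<le> r" if "partial_ft_integrand c g (z, w) \<noteq> 0" for z w
  proof -
    have "g (fst z, w) \<noteq> 0" using that by (auto simp: partial_ft_integrand_def)
    from r[OF this] norm_snd_le[of w "fst z"] show ?thesis by linarith
  qed
  then show ?thesis unfolding proper_support_def by blast
qed

lemma partial_ft_differentiable:
  assumes "test_function g" shows "partial_ft c g differentiable (at z)"
  unfolding partial_ft_eq
  by (intro param_integral_differentiable smooth_partial_ft_integrand proper_partial_ft_integrand test_functionD(1) assms)

lemma pd_partial_ft_integrand:
  assumes "smooth_fun g"
  shows "pd v (partial_ft_integrand c g) p =
     pd (fst (fst v), snd v) g (fst (fst p), snd p) * character c (snd (fst p)) (snd p) +
     g (fst (fst p), snd p) * (\<i> * of_real (c * (snd (fst v) \<bullet> snd p + snd (fst p) \<bullet> snd v))) * character c (snd (fst p)) (snd p)"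
proof -
  have g: "((\<lambda>p. g (fst (fst p), snd p)) has_derivative (\<lambda>v. pd (fst (fst v), snd v) g (fst (fst p), snd p))) (at p)"
    using has_derivative_affine[OF linear_fst_snd(3), of g p 0] smooth_fun_differentiable[OF assms] by simp
  have "((\<lambda>p. \<i> * complex_of_real (c * (snd (fst p) \<bullet> snd p))) has_derivative
      (\<lambda>v. \<i> * of_real (c * (snd (fst p) \<bullet> snd v + snd (fst v) \<bullet> snd p)))) (at p)"
    by (intro has_derivative_mult_right has_derivative_of_real has_derivative_inner has_derivative_snd has_derivative_fst has_derivative_ident)
  from has_derivative_compose[OF this DERIV_exp[unfolded has_field_derivative_def]]
  have e: "((\<lambda>p. character c (snd (fst p)) (snd p)) has_derivative
      (\<lambda>v. character c (snd (fst p)) (snd p) * (\<i> * of_real (c * (snd (fst p) \<bullet> snd v + snd (fst v) \<bullet> snd p))))) (at p)" .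
  show ?thesis unfolding partial_ft_integrand_def
    by (subst pd_eq[OF has_derivative_mult[OF g e]]) (simp add: algebra_simps)
qed

lemma pd_partial_ft_fst:
  assumes g: "test_function g" and b: "b \<in> Basis"
  shows "pd (b, 0) (partial_ft c g) = partial_ft c (pd (b, 0) g)"
proof -
  have B: "(b, 0) \<in> Basis" using b by (auto simp: Basis_prod_def)
  have "pd (b, 0) (partial_ft c g) = (\<lambda>z. \<integral>s. pd ((b, 0), 0) (partial_ft_integrand c g) (z, s) \<partial>lborel)"
    unfolding partial_ft_eq
    by (rule param_integral_pd[OF smooth_partial_ft_integrand[OF test_functionD(1)[OF g]] proper_partial_ft_integrand[OF g] B])
  then show ?thesis by (simp add: pd_partial_ft_integrand[OF test_functionD(1)[OF g]] partial_ft_def)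
qed

lemma pd_partial_ft_snd:
  fixes g :: "'a::euclidean_space \<times> 'b::euclidean_space \<Rightarrow> complex"
  assumes g: "test_function g" and b: "b \<in> Basis"
  shows "pd (0, b) (partial_ft c g) = partial_ft c (\<lambda>z. g z * (\<i> * of_real c * of_real (snd z \<bullet> b)))"
proof -
  have B: "(0, b) \<in> Basis" using b by (auto simp: Basis_prod_def)
  have z: "pd (0::'a, 0::'b) g z = 0" for z
    using linear_0[OF linear_pd[OF smooth_fun_differentiable[OF test_functionD(1)[OF g]]]] by (simp add: zero_prod_def)
  have "pd (0, b) (partial_ft c g) = (\<lambda>z. \<integral>s. pd ((0, b), 0) (partial_ft_integrand c g) (z, s) \<partial>lborel)"
    unfolding partial_ft_eq
    by (rule param_integral_pd[OF smooth_partial_ft_integrand[OF test_functionD(1)[OF g]] proper_partial_ft_integrand[OF g] B])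
  then show ?thesis
    by (simp add: pd_partial_ft_integrand[OF test_functionD(1)[OF g]] partial_ft_def z inner_commute mult_ac)
qed

lemma test_mult_coordinate:
  fixes g :: "'a::euclidean_space \<times> 'b::euclidean_space \<Rightarrow> complex"
  assumes "test_function g" shows "test_function (\<lambda>z. g z * (k * of_real (snd z \<bullet> b)))"
proof -
  have "linear (\<lambda>z::'a \<times> 'b. snd z \<bullet> b)" by (auto intro!: linearI simp: inner_add_left)
  then show ?thesis by (intro test_function_mult assms smooth_fun_cmult smooth_fun_linear)
qed

text \<open>Integration by parts: the derivative of the whole integrand in \<open>w\<close> has integral \<open>0\<close>.\<close>

lemma partial_ft_mult_coordinate:
  fixes g :: "'a::euclidean_space \<times> 'b::euclidean_space \<Rightarrow> complex"
  assumes g: "test_function g" and c: "c \<noteq> 0"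
  shows "of_real (snd z \<bullet> b) * partial_ft c g z = partial_ft c (\<lambda>z. \<i> / of_real c * pd (0, b) g z) z"
proof -
  let ?e = "\<lambda>w. character c (snd z) w"
  note sg = test_functionD(1)[OF g]
  have s1: "smooth_fun (\<lambda>w. partial_ft_integrand c g (z, w))"
    by (intro smooth_fun_slice smooth_partial_ft_integrand sg)
  obtain r where r: "\<And>z' s. norm z' \<le> norm z \<Longrightarrow> partial_ft_integrand c g (z', s) \<noteq> 0 \<Longrightarrow> norm s \<le> r"
    using proper_partial_ft_integrand[OF g, of c] unfolding proper_support_def by blast
  have t: "test_function (\<lambda>w. partial_ft_integrand c g (z, w))"
    by (rule test_functionI[OF s1, of r], rule r[OF order_refl])
  have L: "linear (\<lambda>y::'b. (0::'a \<times> 'b, y))" by (auto intro!: linearI)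
  have "pd b (\<lambda>w. partial_ft_integrand c g (z, w)) w = pd (0, b) (partial_ft_integrand c g) (z, w)" for w
    using pd_affine[OF L smooth_fun_differentiable[OF smooth_partial_ft_integrand[OF sg]], of b c "(z, 0)"] by simp
  then have eq: "pd b (\<lambda>w. partial_ft_integrand c g (z, w)) w = pd (0, b) g (fst z, w) * ?e w + \<i> * of_real c * of_real (snd z \<bullet> b) * (g (fst z, w) * ?e w)" for w
    by (simp add: pd_partial_ft_integrand[OF sg])
  have i1: "integrable lborel (\<lambda>w. pd (0, b) g (fst z, w) * ?e w)"
    using integrable_slice[OF smooth_partial_ft_integrand[OF smooth_fun_pd[OF sg]] proper_partial_ft_integrand[OF test_function_pd[OF g]], of c "(0,b)" z]
    by (simp add: partial_ft_integrand_def)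
  have i2: "integrable lborel (\<lambda>w. g (fst z, w) * ?e w)"
    using integrable_slice[OF smooth_partial_ft_integrand[OF sg] proper_partial_ft_integrand[OF g], of c z]
    by (simp add: partial_ft_integrand_def)
  have "0 = (\<integral>w. pd b (\<lambda>w. partial_ft_integrand c g (z, w)) w \<partial>lborel)" by (rule integral_pd_eq_0[OF t, symmetric])
  also have "\<dots> = (\<integral>w. pd (0, b) g (fst z, w) * ?e w \<partial>lborel) + \<i> * of_real c * of_real (snd z \<bullet> b) * (\<integral>w. g (fst z, w) * ?e w \<partial>lborel)"
    unfolding eq using i1 i2 by (subst Bochner_Integration.integral_add) auto
  finally have "\<i> * of_real c * (of_real (snd z \<bullet> b) * partial_ft c g z) = - partial_ft c (pd (0, b) g) z"
    by (simp add: partial_ft_def eq_neg_iff_add_eq_0 add.commute mult_ac)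
  then have "(\<i> / of_real c) * (\<i> * of_real c * (of_real (snd z \<bullet> b) * partial_ft c g z)) = (\<i> / of_real c) * (- partial_ft c (pd (0, b) g) z)" by (simp only:)
  then have "of_real (snd z \<bullet> b) * partial_ft c g z = (\<i> / of_real c) * partial_ft c (pd (0, b) g) z" using c by (simp add: field_simps)
  also have "\<dots> = partial_ft c (\<lambda>z. \<i> / of_real c * pd (0, b) g z) z" unfolding partial_ft_def by (simp add: mult.assoc)
  finally show ?thesis .
qed

text \<open>A weight \<open>1 + |z|\<close> is controlled by the size of the \<open>x\<close>-support of \<open>g\<close> and by the coordinates of the
frequency variable, and these turn the transform of \<open>g\<close> into transforms of derivatives of \<open>g\<close>.\<close>

lemma partial_ft_weighted_bound:
  fixes g :: "'a::euclidean_space \<times> 'b::euclidean_space \<Rightarrow> complex"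
  assumes g: "test_function g" and c: "c \<noteq> 0"
  shows "\<exists>B. \<forall>z. (1 + norm z) ^ k * norm (partial_ft c g z) \<le> B"
  using g
proof (induction k arbitrary: g)
  case 0
  obtain r where r: "\<And>z. g z \<noteq> 0 \<Longrightarrow> norm z \<le> r" using test_functionD(2)[OF 0] by auto
  obtain B where B: "\<And>z. norm (g z) \<le> B"
    using continuous_compact_support_bounded[OF smooth_fun_continuous[OF test_functionD(1)[OF 0]]] r by blast
  have i: "integrable lborel (\<lambda>w::'b. B * indicator (cball 0 r) w)"
    by (rule integrable_indicator_cball)
  have "norm (partial_ft c g z) \<le> (\<integral>w. B * indicator (cball (0::'b) r) w \<partial>lborel)" for z
    unfolding partial_ft_def
  proof (rule norm_lborel_integral_le[OF _ i])
    show "integrable lborel (\<lambda>w. g (fst z, w) * character c (snd z) w)"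
      using integrable_slice[OF smooth_partial_ft_integrand[OF test_functionD(1)[OF 0]] proper_partial_ft_integrand[OF 0], of c z]
      by (simp add: partial_ft_integrand_def)
    fix w :: 'b
    show "norm (g (fst z, w) * character c (snd z) w) \<le> B * indicator (cball 0 r) w"
    proof (cases "g (fst z, w) = 0")
      case True
      then show ?thesis using order_trans[OF norm_ge_zero B] by simp
    next
      case False
      then have "norm w \<le> r" using r[OF False] norm_snd_le[of w "fst z"] by linarith
      then show ?thesis using B by (simp add: norm_mult)
    qed
  qed
  then show ?case by auto
next
  case (Suc k)
  obtain r where r: "0 < r" "\<And>z. g z \<noteq> 0 \<Longrightarrow> norm z \<le> r" using test_functionD(2)[OF Suc.prems] by auto
  obtain B0 where B0: "\<And>z. (1 + norm z) ^ k * norm (partial_ft c g z) \<le> B0" using Suc by blast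
  have "\<exists>B. \<forall>z. (1 + norm z) ^ k * norm (partial_ft c (\<lambda>z. \<i> / of_real c * pd (0, b) g z) z) \<le> B" for b
    by (intro Suc.IH test_function_cmult test_function_pd Suc.prems)
  then obtain B where B: "\<And>b z. (1 + norm z) ^ k * norm (partial_ft c (\<lambda>z. \<i> / of_real c * pd (0, b) g z) z) \<le> B b" by metis
  have "(1 + norm z) ^ Suc k * norm (partial_ft c g z) \<le> (1 + r) * \<bar>B0\<bar> + (\<Sum>b\<in>Basis. B b)" for z
  proof (cases "norm (fst z) \<le> r")
    case True
    have nz: "1 + norm z \<le> (1 + r) + (\<Sum>b\<in>Basis. \<bar>snd z \<bullet> b\<bar>)"
      using norm_Pair_le[of "fst z" "snd z"] norm_le_l1[of "snd z"] True by simp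
    have "(1 + norm z) ^ Suc k * norm (partial_ft c g z) = (1 + norm z) * ((1 + norm z) ^ k * norm (partial_ft c g z))" by simp
    also have "\<dots> \<le> ((1 + r) + (\<Sum>b\<in>Basis. \<bar>snd z \<bullet> b\<bar>)) * ((1 + norm z) ^ k * norm (partial_ft c g z))"
      by (intro mult_right_mono nz) auto
    also have "\<dots> = (1 + r) * ((1 + norm z) ^ k * norm (partial_ft c g z)) + (\<Sum>b\<in>Basis. (1 + norm z) ^ k * norm (of_real (snd z \<bullet> b) * partial_ft c g z))"
    proof -
      define n where "n = (1 + norm z) ^ k * norm (partial_ft c g z)"
      have "((1 + r) + (\<Sum>b\<in>Basis. \<bar>snd z \<bullet> b\<bar>)) * n = (1 + r) * n + (\<Sum>b\<in>Basis. \<bar>snd z \<bullet> b\<bar> * n)"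
        by (simp only: distrib_right[of "1 + r"] sum_distrib_right)
      then show ?thesis by (simp add: n_def norm_mult mult_ac)
    qed
    also have "\<dots> \<le> (1 + r) * \<bar>B0\<bar> + (\<Sum>b\<in>Basis. B b)"
      unfolding partial_ft_mult_coordinate[OF Suc.prems c]
      by (intro add_mono sum_mono B mult_left_mono) (use B0[of z] r in auto)
    finally show ?thesis .
  next
    case False
    then have "g (fst z, w) = 0" for w using r(2)[of "(fst z, w)"] norm_fst_le[of "fst z" w] by linarith
    then have "partial_ft c g z = 0" by (simp add: partial_ft_def)
    moreover have "0 \<le> B b" for b using order_trans[OF _ B[of 0 b]] by simp
    ultimately show ?thesis using r by (simp add: sum_nonneg)
  qed
  then show ?case by blast
qed

lemma partial_ft_schwartz:
  fixes g :: "'a::euclidean_space \<times> 'b::euclidean_space \<Rightarrow> complex"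
  assumes g: "test_function g" and c: "c \<noteq> 0"
  shows "partial_ft c g \<in> schwartz_space"
proof (rule schwartz_coinduct[where P="\<lambda>f. \<exists>g. test_function g \<and> f = partial_ft c g"])
  fix f :: "'a \<times> 'b \<Rightarrow> complex" assume "\<exists>g. test_function g \<and> f = partial_ft c g"
  then obtain g where g: "test_function g" and f: "f = partial_ft c g" by blast
  have "\<exists>g'. test_function g' \<and> pd v f = partial_ft c g'" if v: "v \<in> Basis" for v
  proof -
    consider b where "v = (b, 0)" "b \<in> Basis" | b where "v = (0, b)" "b \<in> Basis"
      using v unfolding Basis_prod_def by blast
    then show ?thesis
    proof cases
      case 1
      then show ?thesis unfolding f using pd_partial_ft_fst[OF g] test_function_pd[OF g] by blast
    next
      case 2
      then show ?thesis unfolding f using pd_partial_ft_snd[OF g 2(2), of c] test_mult_coordinate[OF g, of "\<i> * of_real c" b] by metis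
    qed
  qed
  then show "(\<forall>x. f differentiable (at x)) \<and> rapid f \<and> (\<forall>b\<in>Basis. \<exists>g. test_function g \<and> pd b f = partial_ft c g)"
    unfolding f rapid_def using partial_ft_differentiable[OF g] partial_ft_weighted_bound[OF g c] by blast
qed (use g in blast)

section \<open>A band-limited kernel of mass one\<close>

lemma integrable_inverse_square: "integrable lborel (\<lambda>x::real. 1 / (1 + x\<^sup>2))"
proof (rule integrableI_nonneg)
  show "AE x in lborel. 0 \<le> 1 / (1 + x\<^sup>2 :: real)" by simp
  let ?f = "\<lambda>x::real. 1 / (1 + x\<^sup>2)"
  have m: "?f \<in> borel_measurable borel" by measurable
  have half: "(\<integral>\<^sup>+x. ennreal (?f x) * indicator {0..} x \<partial>lborel) = ennreal (pi / 2 - arctan 0)"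
    by (rule nn_integral_FTC_atLeast[OF m _ _ tendsto_arctan_at_top])
       (use DERIV_arctan in \<open>auto simp: inverse_eq_divide\<close>)
  have "(\<integral>\<^sup>+x. ennreal (?f x) * indicator {..0} x \<partial>lborel)
      = ennreal \<bar>- 1\<bar> * (\<integral>\<^sup>+x. ennreal (?f (0 + (- 1) * x)) * indicator {..0} (0 + (- 1) * x) \<partial>lborel)"
    using nn_integral_real_affine[of "\<lambda>x. ennreal (?f x) * indicator {..0} x" "- 1" 0] by simp
  also have "(\<lambda>x. ennreal (?f (0 + (- 1) * x)) * indicator {..0} (0 + (- 1) * x)) = (\<lambda>x. ennreal (?f x) * indicator {0..} x)"
    by (auto simp: indicator_def)
  finally have half': "(\<integral>\<^sup>+x. ennreal (?f x) * indicator {..0} x \<partial>lborel) = ennreal (pi / 2 - arctan 0)"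
    using half by simp
  have "(\<integral>\<^sup>+x. ennreal (?f x) \<partial>lborel) \<le> (\<integral>\<^sup>+x. ennreal (?f x) * indicator {0..} x + ennreal (?f x) * indicator {..0} x \<partial>lborel)"
    by (intro nn_integral_mono) (auto simp: indicator_def)
  also have "\<dots> = ennreal (pi / 2 - arctan 0) + ennreal (pi / 2 - arctan 0)"
    by (subst nn_integral_add) (auto simp: half half')
  also have "\<dots> < \<infinity>" by (simp add: ennreal_add_eq_top less_top)
  finally show "(\<integral>\<^sup>+x. ennreal (?f x) \<partial>lborel) < \<infinity>" .
qed auto

lemma integrable_prod_inverse_square:
  "integrable lborel (\<lambda>x::'a::euclidean_space. \<Prod>b\<in>Basis. 1 / (1 + (x \<bullet> b)\<^sup>2))"
proof (rule integrableI_nonneg)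
  have "(\<integral>\<^sup>+x. ennreal (1 / (1 + x\<^sup>2)) \<partial>lborel) < \<infinity>"
    using integrable_inverse_square by (simp add: integrable_iff_bounded)
  have "(\<integral>\<^sup>+x. ennreal (\<Prod>b\<in>(Basis::'a set). 1 / (1 + (x \<bullet> b)\<^sup>2)) \<partial>lborel)
      = (\<integral>\<^sup>+x. (\<Prod>b\<in>(Basis::'a set). (\<lambda>t. ennreal (1 / (1 + t\<^sup>2))) (x \<bullet> b)) \<partial>lborel)"
    by (simp add: prod_ennreal)
  also have "\<dots> = (\<Prod>b\<in>(Basis::'a set). \<integral>\<^sup>+x. ennreal (1 / (1 + x\<^sup>2)) \<partial>lborel)"
    by (subst nn_integral_lborel_prod) auto
  also have "\<dots> < \<infinity>"
    using \<open>_ < \<infinity>\<close> by (simp add: power_less_top_ennreal)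
  finally show "(\<integral>\<^sup>+x. ennreal (\<Prod>b\<in>(Basis::'a set). 1 / (1 + (x \<bullet> b)\<^sup>2)) \<partial>lborel) < \<infinity>" .
qed (auto intro!: prod_nonneg AE_I2)

text \<open>A Schwartz function is dominated by a multiple of the product of \<open>1 / (1 + (x \<bullet> b)\<^sup>2)\<close> over the
coordinates, whose integral factorises.\<close>

lemma schwartz_weighted_integrable:
  fixes f :: "'a::euclidean_space \<Rightarrow> complex"
  assumes f: "f \<in> schwartz_space"
  shows "integrable lborel (\<lambda>x. (1 + norm x) ^ k * norm (f x))"
proof -
  \<comment> \<open>The product over the coordinates grows like this power of the weight.\<close>
  let ?d = "2 * DIM('a)"
  obtain B where B: "\<And>x. (1 + norm x) ^ (?d + k) * norm (f x) \<le> B"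
    using f regularD(2)[of rapid 0 f] unfolding schwartz_iff rapid_def by blast
  show ?thesis
  proof (rule Bochner_Integration.integrable_bound)
    show "integrable lborel (\<lambda>x::'a. B * (\<Prod>b\<in>Basis. 1 / (1 + (x \<bullet> b)\<^sup>2)))"
      by (intro integrable_mult_right integrable_prod_inverse_square)
    have "continuous_on UNIV (\<lambda>x. (1 + norm x) ^ k * norm (f x))"
      by (intro continuous_intros smooth_fun_continuous schwartz_smooth f)
    then show "(\<lambda>x. (1 + norm x) ^ k * norm (f x)) \<in> borel_measurable lborel"
      by (simp add: borel_measurable_continuous_onI)
    show "AE x in lborel. norm ((1 + norm x) ^ k * norm (f x)) \<le> norm (B * (\<Prod>b\<in>Basis. 1 / (1 + (x \<bullet> b)\<^sup>2)))"
    proof (rule AE_I2)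
      fix x :: 'a
      let ?P = "\<Prod>b\<in>Basis. (1 + (x \<bullet> b)\<^sup>2)"
      have P0: "0 < ?P" by (intro prod_pos) (auto intro: add_pos_nonneg)
      have "?P \<le> (\<Prod>b\<in>(Basis::'a set). (1 + norm x)\<^sup>2)"
      proof (intro prod_mono conjI)
        fix b :: 'a assume "b \<in> Basis"
        then have "(x \<bullet> b)\<^sup>2 \<le> (norm x)\<^sup>2" using Basis_le_norm abs_le_square_iff by fastforce
        moreover have "(1 + norm x)\<^sup>2 = 1 + (norm x)\<^sup>2 + 2 * norm x" by (simp add: power2_sum)
        ultimately show "1 + (x \<bullet> b)\<^sup>2 \<le> (1 + norm x)\<^sup>2" using norm_ge_zero[of x] by linarith
      qed auto
      also have "\<dots> = (1 + norm x) ^ ?d" by (simp add: power_mult)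
      finally have "?P * ((1 + norm x) ^ k * norm (f x)) \<le> (1 + norm x) ^ ?d * ((1 + norm x) ^ k * norm (f x))"
        by (intro mult_right_mono) auto
      also have "\<dots> \<le> B" using B[of x] by (simp add: power_add mult.assoc)
      finally have "(1 + norm x) ^ k * norm (f x) \<le> B * (1 / ?P)" using P0 by (simp add: field_simps)
      also have "1 / ?P = (\<Prod>b\<in>Basis. 1 / (1 + (x \<bullet> b)\<^sup>2))" by (simp add: prod_dividef)
      finally show "norm ((1 + norm x) ^ k * norm (f x)) \<le> norm (B * (\<Prod>b\<in>Basis. 1 / (1 + (x \<bullet> b)\<^sup>2)))"
        by simp
    qed
  qed
qed

lemma smooth_measurable: "smooth_fun f \<Longrightarrow> f \<in> borel_measurable borel"
  by (rule borel_measurable_continuous_onI[OF smooth_fun_continuous])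

lemma schwartz_integrable: "f \<in> schwartz_space \<Longrightarrow> integrable lborel f"
  using schwartz_weighted_integrable[of f 0] smooth_measurable[OF schwartz_smooth, of f]
  by (simp add: integrable_norm_iff)

lemma integral_pos:
  fixes f :: "'a::euclidean_space \<Rightarrow> real"
  assumes c: "continuous_on UNIV f" and i: "integrable lborel f" and nn: "\<And>x. 0 \<le> f x" and p: "0 < f 0"
  shows "0 < (\<integral>x. f x \<partial>lborel)"
proof -
  have "isCont f 0" using c by (simp add: continuous_on_eq_continuous_at)
  then obtain d where d: "0 < d" "\<And>x. dist x 0 < d \<Longrightarrow> dist (f x) (f 0) < f 0 / 2"
    unfolding continuous_at_eps_delta using p by (metis half_gt_zero)
  have "0 < f 0 / 2 * measure lborel (ball (0::'a) d)" using p content_ball_pos[OF d(1), of "0::'a"] by simp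
  also have "\<dots> = (\<integral>x. f 0 / 2 * indicator (ball (0::'a) d) x \<partial>lborel)" by simp
  also have "\<dots> \<le> (\<integral>x. f x \<partial>lborel)"
  proof (rule integral_mono[OF _ i])
    show "integrable lborel (\<lambda>x. f 0 / 2 * indicator (ball (0::'a) d) x)"
      by (intro integrable_mult_right integrable_real_indicator)
         (auto simp: emeasure_lborel_ball_finite[unfolded infinity_ennreal_def])
    fix x :: 'a
    show "f 0 / 2 * indicator (ball 0 d) x \<le> f x"
    proof (cases "dist x 0 < d")
      case True
      from d(2)[OF this] have "f 0 / 2 \<le> f x" by (simp add: dist_real_def abs_if split: if_splits)
      then show ?thesis using True by (simp add: dist_commute)
    next
      case False
      then show ?thesis using nn by (simp add: dist_commute)
    qed
  qed
  finally show ?thesis .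
qed

lemma lborel_integral_affine:
  fixes f :: "'a::euclidean_space \<Rightarrow> complex"
  assumes [measurable]: "f \<in> borel_measurable borel" and c: "c \<noteq> 0"
  shows "(\<integral>x. f x \<partial>lborel) = of_real (\<bar>c\<bar> ^ DIM('a)) * (\<integral>x. f (t + c *\<^sub>R x) \<partial>lborel)"
  by (subst lborel_affine[OF c, of t])
     (simp add: integral_density integral_distr scaleR_conv_of_real)

lemma Fubini_compact_support:
  fixes F :: "'a::euclidean_space \<times> 'b::euclidean_space \<Rightarrow> complex"
  assumes "continuous_on UNIV F" "\<And>z. F z \<noteq> 0 \<Longrightarrow> norm z \<le> r"
  shows "(\<integral>x. \<integral>y. F (x, y) \<partial>lborel \<partial>lborel) = (\<integral>y. \<integral>x. F (x, y) \<partial>lborel \<partial>lborel)"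
proof -
  have "integrable (lborel \<Otimes>\<^sub>M lborel) F"
    unfolding lborel_prod by (rule integrable_compact_support[OF assms])
  then have "integrable (lborel \<Otimes>\<^sub>M lborel) (case_prod (\<lambda>x y. F (x, y)))" by simp
  from lborel_pair.Fubini_integral[OF this] show ?thesis by simp
qed

definition fourier :: "real \<Rightarrow> ('b::euclidean_space \<Rightarrow> complex) \<Rightarrow> 'b \<Rightarrow> complex" where
  "fourier c \<psi> t = (\<integral>w. \<psi> w * character c t w \<partial>lborel)"

lemma linear_fst_map : "linear (fst :: 'a::real_vector \<times> 'b::real_vector \<Rightarrow> 'a)"
  and linear_snd_map : "linear (snd :: 'a::real_vector \<times> 'b::real_vector \<Rightarrow> 'b)"
  by (auto intro!: linearI)

lemma linear_inner_scaled: "linear (\<lambda>u. c * (v \<bullet> u))"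
  by (auto intro!: linearI simp: inner_add_right algebra_simps)

lemma test_tensor:
  fixes f :: "'a::euclidean_space \<Rightarrow> complex" and g :: "'b::euclidean_space \<Rightarrow> complex"
  assumes "test_function f" "test_function g"
  shows "test_function (\<lambda>z. f (fst z) * g (snd z))"
proof -
  obtain r where r: "\<And>x. f x \<noteq> 0 \<Longrightarrow> norm x \<le> r" using test_functionD(2)[OF assms(1)] by auto
  obtain q where q: "\<And>x. g x \<noteq> 0 \<Longrightarrow> norm x \<le> q" using test_functionD(2)[OF assms(2)] by auto
  show ?thesis
  proof (rule test_functionI)
    show "smooth_fun (\<lambda>z. f (fst z) * g (snd z))"
      using smooth_fun_affine[OF test_functionD(1)[OF assms(1)] linear_fst_map, of 0]
        smooth_fun_affine[OF test_functionD(1)[OF assms(2)] linear_snd_map, of 0]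
      by (intro smooth_fun_mult) auto
    fix z :: "'a \<times> 'b" assume "f (fst z) * g (snd z) \<noteq> 0"
    then have "norm (fst z) \<le> r" "norm (snd z) \<le> q" using r q by auto
    then show "norm z \<le> r + q" using norm_Pair_le[of "fst z" "snd z"] by simp
  qed
qed

text \<open>The transform of \<open>\<psi>\<close> is the slice at \<open>0\<close> of the partial transform of \<open>\<theta> \<otimes> \<psi>\<close> for a cutoff \<open>\<theta>\<close>.\<close>

lemma fourier_schwartz:
  fixes \<psi> :: "'b::euclidean_space \<Rightarrow> complex"
  assumes "test_function \<psi>" "c \<noteq> 0" shows "fourier c \<psi> \<in> schwartz_space"
proof -
  obtain \<theta> :: "'b \<Rightarrow> complex" where \<theta>: "test_function \<theta>" "\<And>x. norm x \<le> 1 \<Longrightarrow> \<theta> x = 1"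
    using exists_cutoff by blast
  have "(\<lambda>t. partial_ft c (\<lambda>z. \<theta> (fst z) * \<psi> (snd z)) (0, t)) \<in> schwartz_space"
    by (intro schwartz_slice partial_ft_schwartz test_tensor \<theta> assms)
  then show ?thesis by (simp add: partial_ft_def fourier_def[abs_def] \<theta>)
qed

text \<open>The transform of an autocorrelation is a squared modulus, so its total mass is visibly positive.\<close>

lemma fourier_autocorrelation:
  fixes \<eta> :: "'b::euclidean_space \<Rightarrow> real"
  assumes \<eta>: "test_function (\<lambda>x. complex_of_real (\<eta> x))"
  defines "\<psi> \<equiv> \<lambda>w. \<integral>s. complex_of_real (\<eta> (w + s) * \<eta> s) \<partial>lborel"
  shows "test_function \<psi>" "fourier c \<psi> t = of_real ((norm (fourier c (\<lambda>x. of_real (\<eta> x)) t))\<^sup>2)"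
proof -
  let ?\<eta> = "\<lambda>x. complex_of_real (\<eta> x)"
  note s\<eta> = test_functionD(1)[OF \<eta>]
  obtain r where r: "0 < r" "\<And>x. \<eta> x \<noteq> 0 \<Longrightarrow> norm x \<le> r" using test_functionD(2)[OF \<eta>] by auto
  define F :: "'b \<times> 'b \<Rightarrow> complex" where "F z = ?\<eta> (fst z + snd z) * ?\<eta> (snd z)" for z
  have L: "linear (\<lambda>z::'b \<times> 'b. fst z + snd z)" by (auto intro!: linearI simp: scaleR_add_right)
  have sF: "smooth_fun F" unfolding F_def[abs_def]
    using smooth_fun_affine[OF s\<eta> L, of 0] smooth_fun_affine[OF s\<eta> linear_snd_map, of 0]
    by (intro smooth_fun_mult) auto
  have Fr: "norm (fst z) \<le> 2 * r \<and> norm (snd z) \<le> r" if "F z \<noteq> 0" for z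
  proof -
    have a: "norm (fst z + snd z) \<le> r" "norm (snd z) \<le> r" using that r(2) by (auto simp: F_def)
    then show ?thesis using norm_triangle_ineq4[of "fst z + snd z" "snd z"] by simp
  qed
  have pF: "proper_support F" unfolding proper_support_def using Fr by fastforce
  have \<psi>F: "\<psi> = (\<lambda>w. \<integral>s. F (w, s) \<partial>lborel)" by (simp add: \<psi>_def F_def)
  show "test_function \<psi>"
  proof (rule test_functionI)
    show "smooth_fun \<psi>" unfolding \<psi>F by (rule smooth_param_integral[OF sF pF])
    fix w assume "\<psi> w \<noteq> 0"
    have "\<exists>s. F (w, s) \<noteq> 0"
    proof (rule ccontr)
      assume "\<not> ?thesis"
      then have "\<psi> w = 0" by (simp add: \<psi>F)
      with \<open>\<psi> w \<noteq> 0\<close> show False by simp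
    qed
    then show "norm w \<le> 2 * r" using Fr by fastforce
  qed
  let ?e = "\<lambda>w. character c t w"
  have se: "smooth_fun ?e"
  proof -
    from smooth_fun_exp[OF smooth_fun_cmult[OF smooth_fun_linear[OF linear_inner_scaled], of \<i>]] show ?thesis .
  qed
  have eadd: "?e (x + y) = ?e x * ?e y" for x y by (simp add: exp_add[symmetric] inner_add_right algebra_simps)
  have "continuous_on UNIV (\<lambda>z. F z * ?e (fst z))"
    using smooth_fun_continuous[OF smooth_fun_mult[OF sF smooth_fun_affine[OF se linear_fst_map, of 0]]] by simp
  moreover have "norm z \<le> 3 * r" if "F z * ?e (fst z) \<noteq> 0" for z
    using Fr[of z] that norm_Pair_le[of "fst z" "snd z"] by auto
  ultimately have fub: "(\<integral>w. \<integral>s. F (w, s) * ?e w \<partial>lborel \<partial>lborel) = (\<integral>s. \<integral>w. F (w, s) * ?e w \<partial>lborel \<partial>lborel)"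
    using Fubini_compact_support[of "\<lambda>z. F z * ?e (fst z)" "3 * r"] by simp
  have inner: "(\<integral>w. F (w, s) * ?e w \<partial>lborel) = (?\<eta> s * cnj (?e s)) * fourier c ?\<eta> t" for s
  proof -
    have cnje: "cnj (?e s) = ?e (- s)" by (simp add: exp_cnj)
    let ?G = "\<lambda>u. ?\<eta> u * ?e u"
    have m: "?G \<in> borel_measurable borel" by (intro smooth_measurable smooth_fun_mult s\<eta> se)
    have "F (w, s) * ?e w = (?\<eta> s * cnj (?e s)) * ?G (s + w)" for w
      unfolding cnje using eadd[of "- s" "s + w"] by (simp add: F_def add.commute)
    then have "(\<integral>w. F (w, s) * ?e w \<partial>lborel) = (?\<eta> s * cnj (?e s)) * (\<integral>w. ?G (s + w) \<partial>lborel)" by simp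
    then show ?thesis unfolding lborel_integral_translate[OF m] by (simp add: fourier_def)
  qed
  have "fourier c \<psi> t = (\<integral>w. \<integral>s. F (w, s) * ?e w \<partial>lborel \<partial>lborel)" by (simp add: fourier_def \<psi>F)
  also have "\<dots> = (\<integral>s. cnj (?\<eta> s * ?e s) \<partial>lborel) * fourier c ?\<eta> t" unfolding fub inner by simp
  also have "(\<integral>s. cnj (?\<eta> s * ?e s) \<partial>lborel) = cnj (fourier c ?\<eta> t)"
    unfolding fourier_def by (rule Bochner_Integration.integral_cnj)
  finally show "fourier c \<psi> t = of_real ((norm (fourier c ?\<eta> t))\<^sup>2)" by (simp only: complex_norm_square mult.commute)
qed

lemma exists_kernel:
  fixes c :: real assumes c: "c \<noteq> 0"
  shows "\<exists>\<psi> :: 'b::euclidean_space \<Rightarrow> complex. test_function \<psi> \<and> (\<integral>t. fourier c \<psi> t \<partial>lborel) = 1"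
proof -
  obtain \<eta> :: "'b \<Rightarrow> real" where \<eta>: "test_function (\<lambda>x. complex_of_real (\<eta> x))" "\<And>x. \<eta> x \<ge> 0" "\<eta> 0 > 0"
    using exists_nonneg_bump by blast
  define \<psi> :: "'b \<Rightarrow> complex" where "\<psi> = (\<lambda>w. \<integral>s. complex_of_real (\<eta> (w + s) * \<eta> s) \<partial>lborel)"
  define h where "h = fourier c (\<lambda>x. complex_of_real (\<eta> x))"
  have t\<psi>: "test_function \<psi>" and K: "fourier c \<psi> t = of_real ((norm (h t))\<^sup>2)" for t
    unfolding \<psi>_def h_def using fourier_autocorrelation[OF \<eta>(1)] by auto
  have i\<eta>: "integrable lborel \<eta>"
    using schwartz_integrable[OF test_function_schwartz[OF \<eta>(1)]] complex_of_real_integrable_eq by blast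
  have c\<eta>: "continuous_on UNIV \<eta>"
    using continuous_on_Re[OF smooth_fun_continuous[OF test_functionD(1)[OF \<eta>(1)]]] by simp
  have "h 0 = of_real (\<integral>x. \<eta> x \<partial>lborel)" by (simp add: h_def fourier_def)
  then have h0: "h 0 \<noteq> 0" using integral_pos[OF c\<eta> i\<eta> \<eta>(2,3)] by simp
  have hS: "h \<in> schwartz_space" unfolding h_def by (rule fourier_schwartz[OF \<eta>(1) c])
  have "fourier c \<psi> = (\<lambda>t. complex_of_real ((norm (h t))\<^sup>2))" by (rule ext, rule K)
  from subst[of _ _ "integrable lborel", OF this schwartz_integrable[OF fourier_schwartz[OF t\<psi> c]]]
  have i: "integrable lborel (\<lambda>t. (norm (h t))\<^sup>2)" by (rule iffD1[OF complex_of_real_integrable_eq])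
  have "continuous_on UNIV (\<lambda>t. (norm (h t))\<^sup>2)"
    by (intro continuous_intros smooth_fun_continuous schwartz_smooth hS)
  from integral_pos[OF this i] h0 have pos: "0 < (\<integral>t. (norm (h t))\<^sup>2 \<partial>lborel)" by simp
  define \<kappa> where "\<kappa> = (\<integral>t. (norm (h t))\<^sup>2 \<partial>lborel)"
  have "(\<integral>t. fourier c \<psi> t \<partial>lborel) = of_real \<kappa>" unfolding K \<kappa>_def by (rule integral_of_real[OF i])
  moreover have "fourier c (\<lambda>w. (1 / of_real \<kappa>) * \<psi> w) t = (1 / of_real \<kappa>) * fourier c \<psi> t" for t
    by (simp add: fourier_def)
  ultimately have "(\<integral>t. fourier c (\<lambda>w. (1 / of_real \<kappa>) * \<psi> w) t \<partial>lborel) = 1"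
    using pos by (simp add: \<kappa>_def[symmetric])
  then show ?thesis using test_function_cmult[OF t\<psi>] by blast
qed

section \<open>Mollification along a subspace\<close>

text \<open>Convolution of \<open>e\<close> with \<open>K\<close> along the range of the linear map \<open>L\<close>.\<close>

definition mollify :: "('b::euclidean_space \<Rightarrow> complex) \<Rightarrow> ('b \<Rightarrow> 'a) \<Rightarrow> ('a::euclidean_space \<Rightarrow> complex) \<Rightarrow> 'a \<Rightarrow> complex" where
  "mollify K L e z = (\<integral>s. e (z - L s) * K s \<partial>lborel)"

lemma mollify_integrable:
  fixes K :: "'b::euclidean_space \<Rightarrow> complex" and L :: "'b \<Rightarrow> 'a::euclidean_space"
  assumes e: "e \<in> schwartz_space" and K: "K \<in> schwartz_space" and L: "linear L"
  shows "integrable lborel (\<lambda>s. e (z - L s) * K s)"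
proof -
  obtain B where B: "\<And>x. norm (e x) \<le> B" using schwartz_bounded[OF e] by blast
  have "linear (\<lambda>s. - L s)" by (rule linear_compose_neg[OF L])
  from smooth_fun_affine[OF schwartz_smooth[OF e] this, of z]
  have s: "smooth_fun (\<lambda>s. e (z - L s))" by simp
  show ?thesis
  proof (rule Bochner_Integration.integrable_bound)
    show "integrable lborel (\<lambda>s. B * norm (K s))"
      by (intro integrable_mult_right integrable_norm schwartz_integrable K)
    show "(\<lambda>s. e (z - L s) * K s) \<in> borel_measurable lborel"
      using smooth_measurable[OF smooth_fun_mult[OF s schwartz_smooth[OF K]]] by simp
    show "AE s in lborel. norm (e (z - L s) * K s) \<le> norm (B * norm (K s))"
      using B order_trans[OF norm_ge_zero B] by (auto simp: norm_mult intro!: mult_right_mono)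
  qed
qed

lemma mollify_deriv:
  fixes K :: "'b::euclidean_space \<Rightarrow> complex" and L :: "'b \<Rightarrow> 'a::euclidean_space"
  assumes e: "e \<in> schwartz_space" and K: "K \<in> schwartz_space" and L: "linear L"
  shows "(mollify K L e has_derivative (\<lambda>h. \<Sum>b\<in>Basis. of_real (h \<bullet> b) * mollify K L (pd b e) z)) (at z)"
proof -
  obtain M where M: "seminorms_le 2 M e" using schwartz_seminorms_bound[OF e] by blast
  have Mb: "norm (pd c (pd b e) w) \<le> M" if "b \<in> Basis" "c \<in> Basis" for b c w
  proof -
    have "1 * norm (pd c (pd b e) w) \<le> (1 + norm w)\<^sup>2 * norm (pd c (pd b e) w)"
      by (intro mult_right_mono) (auto simp: power2_eq_square algebra_simps)
    also have "\<dots> \<le> M" using M[unfolded seminorms_le_def, rule_format, of "[c, b]" w] that by simp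
    finally show ?thesis by simp
  qed
  show ?thesis
    unfolding mollify_def
  proof (rule has_derivative_integral_quadratic)
    show "integrable lborel (\<lambda>s. e (z + h - L s) * K s)" for h by (rule mollify_integrable[OF e K L])
    show "integrable lborel (\<lambda>s. pd b e (z - L s) * K s)" if "b \<in> Basis" for b
      by (rule mollify_integrable[OF schwartz_pd[OF e that] K L])
    show "integrable lborel (\<lambda>s. ((real DIM('a))\<^sup>2 * M) * norm (K s))"
      by (intro integrable_mult_right integrable_norm schwartz_integrable K)
    fix h :: 'a and s
    let ?y = "z - L s"
    have "e (z + h - L s) * K s - e ?y * K s - (\<Sum>b\<in>Basis. of_real (h \<bullet> b) * (pd b e ?y * K s))
        = (e (?y + h) - e ?y - pd h e ?y) * K s"
      unfolding pd_expand[OF smooth_fun_differentiable[OF schwartz_smooth[OF e]], of h]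
      by (simp add: algebra_simps sum_distrib_left)
    also have "norm \<dots> \<le> ((real DIM('a))\<^sup>2 * M * (norm h)\<^sup>2) * norm (K s)"
      unfolding norm_mult by (intro mult_right_mono smooth_taylor_bound schwartz_smooth e Mb) auto
    finally show "norm (e (z + h - L s) * K s - e ?y * K s - (\<Sum>b\<in>Basis. of_real (h \<bullet> b) * (pd b e ?y * K s)))
        \<le> ((real DIM('a))\<^sup>2 * M) * norm (K s) * (norm h)\<^sup>2" by (simp add: mult_ac)
  qed
qed

lemma mollify_iterated:
  fixes K :: "'b::euclidean_space \<Rightarrow> complex" and L :: "'b \<Rightarrow> 'a::euclidean_space"
  assumes e: "e \<in> schwartz_space" and K: "K \<in> schwartz_space" and L: "linear L" and bs: "bs \<in> lists Basis"
  shows "iterated_partial bs (mollify K L e) = mollify K L (iterated_partial bs e)"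
  using bs
proof (induction bs)
  case (Cons b bs)
  then have b: "b \<in> Basis" and I: "iterated_partial bs e \<in> schwartz_space" using schwartz_iterated[OF e] by auto
  have "pd b (mollify K L (iterated_partial bs e)) = mollify K L (pd b (iterated_partial bs e))"
    by (rule ext, rule pd_eq_coefficient[OF mollify_deriv[OF I K L] b])
  then show ?case using Cons by simp
qed simp

lemma schwartz_increment_bound:
  fixes e :: "'a::euclidean_space \<Rightarrow> complex"
  assumes e: "e \<in> schwartz_space"
  shows "\<exists>M\<ge>0. \<forall>z w. (1 + norm z) ^ k * norm (e (z - w) - e z) \<le> M * norm w * (1 + norm w) ^ k"
proof -
  obtain M where M: "seminorms_le (Suc k) M e" using schwartz_seminorms_bound[OF e] by blast
  note M0 = seminorms_le_nonneg[OF M]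
  have "(1 + norm z) ^ k * norm (e (z - w) - e z) \<le> (real DIM('a) * M) * norm w * (1 + norm w) ^ k" for z w
  proof -
    have pos: "0 < (1 + norm z) ^ k" by (simp add: add_pos_nonneg)
    have "norm (e (z + (- w)) - e z) \<le> real DIM('a) * (M * (1 + norm w) ^ k / (1 + norm z) ^ k) * norm (- w)"
    proof (rule smooth_diff_bound[OF schwartz_smooth[OF e]])
      fix u b :: 'a assume u: "u \<in> closed_segment z (z + (- w))" and b: "b \<in> Basis"
      have "norm (z - u) \<le> norm w" using segment_bound1[OF u] by (simp add: norm_minus_commute)
      then have "norm z \<le> norm u + norm w" using norm_triangle_ineq[of "z - u" u] by simp
      moreover have "(1 + norm u) * (1 + norm w) = 1 + norm u + norm w + norm u * norm w" by (simp add: algebra_simps)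
      ultimately have "1 + norm z \<le> (1 + norm u) * (1 + norm w)"
        using mult_nonneg_nonneg[OF norm_ge_zero norm_ge_zero, of u w] norm_ge_zero[of u] norm_ge_zero[of w] by linarith
      then have "(1 + norm z) ^ k \<le> (1 + norm u) ^ k * (1 + norm w) ^ k"
        unfolding power_mult_distrib[symmetric] by (intro power_mono) auto
      then have "(1 + norm z) ^ k * norm (pd b e u) \<le> ((1 + norm u) ^ k * (1 + norm w) ^ k) * norm (pd b e u)"
        by (intro mult_right_mono) auto
      also have "\<dots> = ((1 + norm u) ^ k * norm (pd b e u)) * (1 + norm w) ^ k" by simp
      also have "\<dots> \<le> M * (1 + norm w) ^ k"
      proof (rule mult_right_mono)
        have "1 * ((1 + norm u) ^ k * norm (pd b e u)) \<le> (1 + norm u) * ((1 + norm u) ^ k * norm (pd b e u))"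
          by (intro mult_right_mono) auto
        also have "\<dots> \<le> M" using M[unfolded seminorms_le_def, rule_format, of "[b]" u] b by (simp add: mult.assoc)
        finally show "(1 + norm u) ^ k * norm (pd b e u) \<le> M" by simp
      qed simp
      finally show "norm (pd b e u) \<le> M * (1 + norm w) ^ k / (1 + norm z) ^ k"
        using pos by (simp add: field_simps)
    qed
    then show ?thesis using pos by (simp add: field_simps)
  qed
  then show ?thesis using M0 by (intro exI[of _ "real DIM('a) * M"]) auto
qed

text \<open>Replacing \<open>e (z - \<epsilon> L s)\<close> by \<open>e z\<close> costs \<open>O(\<epsilon> |s|)\<close>, up to a power of \<open>1 + |s|\<close> that the rapidly decreasing
kernel absorbs.\<close>

lemma mollify_error_bound:
  fixes K :: "'b::euclidean_space \<Rightarrow> complex" and L :: "'b \<Rightarrow> 'a::euclidean_space"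
  assumes e: "e \<in> schwartz_space" and K: "K \<in> schwartz_space" and L: "linear L" and K1: "(\<integral>s. K s \<partial>lborel) = 1"
  shows "\<exists>C. \<forall>\<epsilon> z. 0 < \<epsilon> \<longrightarrow> \<epsilon> \<le> 1 \<longrightarrow>
    (1 + norm z) ^ k * norm (mollify K (\<lambda>s. \<epsilon> *\<^sub>R L s) e z - e z) \<le> C * \<epsilon>"
proof -
  obtain M where M: "0 \<le> M" "\<And>z w. (1 + norm z) ^ k * norm (e (z - w) - e z) \<le> M * norm w * (1 + norm w) ^ k"
    using schwartz_increment_bound[OF e] by blast
  obtain l where l: "0 < l" "\<And>s. norm (L s) \<le> l * norm s"
    using linear_bounded_pos[OF L] by (metis mult.commute)
  define J where "J = (\<integral>s. (1 + norm s) ^ Suc k * norm (K s) \<partial>lborel)"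
  have "(1 + norm z) ^ k * norm (mollify K (\<lambda>s. \<epsilon> *\<^sub>R L s) e z - e z) \<le> (M * l * (1 + l) ^ k * J) * \<epsilon>"
    if \<epsilon>: "0 < \<epsilon>" "\<epsilon> \<le> 1" for \<epsilon> z
  proof -
    have L\<epsilon>: "linear (\<lambda>s. \<epsilon> *\<^sub>R L s)" by (rule linear_compose_scale_right[OF L])
    note i1 = mollify_integrable[OF e K L\<epsilon>, of z]
    have i2: "integrable lborel (\<lambda>s. e z * K s)" by (intro integrable_mult_right schwartz_integrable K)
    have "mollify K (\<lambda>s. \<epsilon> *\<^sub>R L s) e z - e z = (\<integral>s. e (z - \<epsilon> *\<^sub>R L s) * K s \<partial>lborel) - (\<integral>s. e z * K s \<partial>lborel)"
      by (simp add: mollify_def K1)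
    also have "\<dots> = (\<integral>s. (e (z - \<epsilon> *\<^sub>R L s) - e z) * K s \<partial>lborel)"
      using Bochner_Integration.integral_diff[OF i1 i2] by (simp add: left_diff_distrib)
    finally have "(1 + norm z) ^ k * norm (mollify K (\<lambda>s. \<epsilon> *\<^sub>R L s) e z - e z)
        = norm (\<integral>s. of_real ((1 + norm z) ^ k) * ((e (z - \<epsilon> *\<^sub>R L s) - e z) * K s) \<partial>lborel)"
      by (simp add: norm_mult norm_power del: of_real_power)
    also have "\<dots> \<le> (\<integral>s. (\<epsilon> * (M * l * (1 + l) ^ k)) * ((1 + norm s) ^ Suc k * norm (K s)) \<partial>lborel)"
    proof (rule norm_lborel_integral_le)
      show "integrable lborel (\<lambda>s. of_real ((1 + norm z) ^ k) * ((e (z - \<epsilon> *\<^sub>R L s) - e z) * K s))"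
        using Bochner_Integration.integrable_diff[OF i1 i2] by (intro integrable_mult_right) (simp add: left_diff_distrib)
      show "integrable lborel (\<lambda>s. (\<epsilon> * (M * l * (1 + l) ^ k)) * ((1 + norm s) ^ Suc k * norm (K s)))"
        by (intro integrable_mult_right schwartz_weighted_integrable K)
      fix s
      let ?w = "\<epsilon> *\<^sub>R L s"
      have w1: "norm ?w \<le> \<epsilon> * (l * norm s)" using \<epsilon> l(2)[of s] by simp
      have "\<epsilon> * (l * norm s) \<le> 1 * (l * norm s)" using \<epsilon> l(1) by (intro mult_right_mono) auto
      moreover have "(1 + l) * (1 + norm s) = 1 + l + norm s + l * norm s" by (simp add: algebra_simps)
      ultimately have "1 + norm ?w \<le> (1 + l) * (1 + norm s)" using w1 l(1) norm_ge_zero[of s] by linarith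
      then have w2: "(1 + norm ?w) ^ k \<le> (1 + l) ^ k * (1 + norm s) ^ k"
        unfolding power_mult_distrib[symmetric] by (intro power_mono) auto
      have "norm (of_real ((1 + norm z) ^ k) * ((e (z - ?w) - e z) * K s))
          = ((1 + norm z) ^ k * norm (e (z - ?w) - e z)) * norm (K s)"
        by (simp add: norm_mult norm_power del: of_real_power)
      also have "\<dots> \<le> (M * norm ?w * (1 + norm ?w) ^ k) * norm (K s)" by (intro mult_right_mono M) auto
      also have "\<dots> \<le> (M * (\<epsilon> * (l * (1 + norm s))) * ((1 + l) ^ k * (1 + norm s) ^ k)) * norm (K s)"
      proof (intro mult_right_mono mult_mono w2 mult_left_mono M(1))
        show "norm ?w \<le> \<epsilon> * (l * (1 + norm s))" using w1 \<epsilon> l(1) by (simp add: algebra_simps add_increasing)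
      qed (use \<epsilon> l(1) M(1) in \<open>auto intro!: mult_nonneg_nonneg\<close>)
      also have "\<dots> = (\<epsilon> * (M * l * (1 + l) ^ k)) * ((1 + norm s) ^ Suc k * norm (K s))" by (simp add: mult_ac)
      finally show "norm (of_real ((1 + norm z) ^ k) * ((e (z - ?w) - e z) * K s))
          \<le> (\<epsilon> * (M * l * (1 + l) ^ k)) * ((1 + norm s) ^ Suc k * norm (K s))" .
    qed
    also have "\<dots> = (\<epsilon> * (M * l * (1 + l) ^ k)) * J"
      unfolding J_def by (rule Bochner_Integration.integral_mult_right_zero)
    also have "\<dots> = (M * l * (1 + l) ^ k * J) * \<epsilon>" by (simp only: mult_ac)
    finally show ?thesis .
  qed
  then show ?thesis by blast
qed

lemma mollify_converges:
  fixes K :: "'b::euclidean_space \<Rightarrow> complex" and L :: "'b \<Rightarrow> 'a::euclidean_space"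
  assumes u: "bounded_functional u" and e: "e \<in> schwartz_space" and K: "K \<in> schwartz_space" and L: "linear L"
    and K1: "(\<integral>s. K s \<partial>lborel) = 1"
    and S: "\<And>\<epsilon>. 0 < \<epsilon> \<Longrightarrow> mollify K (\<lambda>s. \<epsilon> *\<^sub>R L s) e \<in> schwartz_space"
    and Z: "\<And>\<epsilon>. 0 < \<epsilon> \<Longrightarrow> u (mollify K (\<lambda>s. \<epsilon> *\<^sub>R L s) e) = 0"
  shows "u e = 0"
proof -
  let ?E = "\<lambda>\<epsilon>. mollify K (\<lambda>s. \<epsilon> *\<^sub>R L s) e"
  have "- u e = 0"
  proof (rule bounded_functional_limit[OF u, where F="\<lambda>\<epsilon> z. ?E \<epsilon> z - e z"])
    fix \<epsilon> :: real assume \<epsilon>: "0 < \<epsilon>"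
    show "(\<lambda>z. ?E \<epsilon> z - e z) \<in> schwartz_space" by (intro schwartz_diff S \<epsilon> e)
    show "u (\<lambda>z. ?E \<epsilon> z - e z) = - u e" using bounded_functional_diff[OF u S[OF \<epsilon>] e] Z[OF \<epsilon>] by simp
  next
    fix k and bs :: "'a list" assume bs: "bs \<in> lists Basis"
    have "iterated_partial bs (\<lambda>z. ?E \<epsilon> z - e z) z
        = mollify K (\<lambda>s. \<epsilon> *\<^sub>R L s) (iterated_partial bs e) z - iterated_partial bs e z" if "0 < \<epsilon>" for \<epsilon> z
      by (simp add: iterated_partial_diff[OF schwartz_smooth[OF S[OF that]] schwartz_smooth[OF e]]
          mollify_iterated[OF e K linear_compose_scale_right[OF L] bs])
    then show "\<exists>C. \<forall>\<epsilon> z. 0 < \<epsilon> \<longrightarrow> \<epsilon> \<le> 1 \<longrightarrow>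
        (1 + norm z) ^ k * norm (iterated_partial bs (\<lambda>z. ?E \<epsilon> z - e z) z) \<le> C * \<epsilon>"
      using mollify_error_bound[OF schwartz_iterated[OF e bs] K L K1, of k] by simp
  qed
  then show ?thesis by simp
qed

text \<open>The window \<open>\<psi>\<close> bounds the frequency variable, and the partial transform does not enlarge the support in
the first variable. Without the window the partial transform of \<open>h\<close> is in general only Schwartz.\<close>

lemma windowed_test_function:
  fixes h :: "'a::euclidean_space \<times> 'b::euclidean_space \<Rightarrow> complex"
  assumes h: "test_function h" and \<psi>: "test_function \<psi>" and c: "c \<noteq> 0" and \<epsilon>: "0 < \<epsilon>"
  shows "test_function (\<lambda>z. \<psi> (\<epsilon> *\<^sub>R snd z) * partial_ft c h z)"
proof -
  obtain r where r: "\<And>z. h z \<noteq> 0 \<Longrightarrow> norm z \<le> r" using test_functionD(2)[OF h] by auto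
  obtain q where q: "\<And>x. \<psi> x \<noteq> 0 \<Longrightarrow> norm x \<le> q" using test_functionD(2)[OF \<psi>] by auto
  show ?thesis
  proof (rule test_functionI)
    show "smooth_fun (\<lambda>z. \<psi> (\<epsilon> *\<^sub>R snd z) * partial_ft c h z)"
      using smooth_fun_affine[OF test_functionD(1)[OF \<psi>] linear_compose_scale_right[OF linear_snd_map], of \<epsilon> 0]
      by (intro smooth_fun_mult schwartz_smooth[OF partial_ft_schwartz[OF h c]]) simp
    fix z assume z: "\<psi> (\<epsilon> *\<^sub>R snd z) * partial_ft c h z \<noteq> 0"
    then have "norm (\<epsilon> *\<^sub>R snd z) \<le> q" by (intro q) simp
    then have 1: "norm (snd z) \<le> q / \<epsilon>" using \<epsilon> by (simp add: field_simps)
    have "\<exists>w. h (fst z, w) \<noteq> 0"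
    proof (rule ccontr)
      assume "\<not> ?thesis"
      then have "partial_ft c h z = 0" by (simp add: partial_ft_def)
      with z show False by simp
    qed
    then obtain w where "h (fst z, w) \<noteq> 0" ..
    from r[OF this] have "norm (fst z) \<le> r" using norm_fst_le[of "fst z" w] by linarith
    with 1 show "norm z \<le> r + q / \<epsilon>" using norm_Pair_le[of "fst z" "snd z"] by simp
  qed
qed

text \<open>Transforming \<open>h\<close> in the second variable, multiplying by a window and transforming back is a mollification
of \<open>h\<close> in that variable, the kernel being the transform of the window. This uses only Fubini and the
substitutions \<open>s \<mapsto> t - \<epsilon> s\<close> and \<open>w \<mapsto> w / \<epsilon>\<close>.\<close>

lemma partial_ft_windowed:
  fixes h :: "'a::euclidean_space \<times> 'b::euclidean_space \<Rightarrow> complex"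
  assumes h: "test_function h" and \<psi>: "test_function \<psi>" and c: "c \<noteq> 0" and \<epsilon>: "0 < \<epsilon>"
  shows "partial_ft (- c) (\<lambda>z. \<psi> (\<epsilon> *\<^sub>R snd z) * partial_ft c h z) (x, t) = (\<integral>s. h (x, t - \<epsilon> *\<^sub>R s) * fourier (- c) \<psi> s \<partial>lborel)"
proof -
  let ?e = "\<lambda>w s. character c w s" and ?e' = "\<lambda>w s. character (- c) w s"
  let ?D = "complex_of_real (\<epsilon> ^ DIM('b))"
  have D0: "?D \<noteq> 0" using \<epsilon> by simp
  obtain r where r: "0 < r" "\<And>z. h z \<noteq> 0 \<Longrightarrow> norm z \<le> r" using test_functionD(2)[OF h] by auto
  obtain q where q: "0 < q" "\<And>x. \<psi> x \<noteq> 0 \<Longrightarrow> norm x \<le> q" using test_functionD(2)[OF \<psi>] by auto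
  note sh = test_functionD(1)[OF h] and s\<psi> = test_functionD(1)[OF \<psi>]
  define F :: "'b \<times> 'b \<Rightarrow> complex" where "F z = h (x, t - \<epsilon> *\<^sub>R fst z) * (\<psi> (snd z) * ?e' (fst z) (snd z))" for z
  have Lx: "linear (\<lambda>z::'b \<times> 'b. (0::'a, - (\<epsilon> *\<^sub>R fst z)))" by (auto intro!: linearI simp: algebra_simps)
  have sF: "smooth_fun F" unfolding F_def[abs_def]
    using smooth_fun_affine[OF sh Lx, of "(x, t)"] smooth_fun_affine[OF s\<psi> linear_snd_map, of 0]
    by (intro smooth_fun_mult smooth_character linear_fst_map linear_snd_map) auto
  have Fr: "norm z \<le> (norm t + r) / \<epsilon> + q" if "F z \<noteq> 0" for z
  proof -
    have a: "h (x, t - \<epsilon> *\<^sub>R fst z) \<noteq> 0" "\<psi> (snd z) \<noteq> 0" using that by (auto simp: F_def)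
    have "norm (t - \<epsilon> *\<^sub>R fst z) \<le> r" using r(2)[OF a(1)] norm_snd_le[of "t - \<epsilon> *\<^sub>R fst z" x] by linarith
    then have "norm (\<epsilon> *\<^sub>R fst z) \<le> norm t + r" using norm_triangle_ineq4[of t "t - \<epsilon> *\<^sub>R fst z"] by simp
    then have "norm (fst z) \<le> (norm t + r) / \<epsilon>" using \<epsilon> by (simp add: field_simps)
    then show ?thesis using q(2)[OF a(2)] norm_Pair_le[of "fst z" "snd z"] by simp
  qed
  have inner: "?D * (\<integral>s. h (x, t - \<epsilon> *\<^sub>R s) * ?e' s w \<partial>lborel) = ?e' t ((1 / \<epsilon>) *\<^sub>R w) * partial_ft c h (x, (1 / \<epsilon>) *\<^sub>R w)" for w
  proof -
    let ?G = "\<lambda>u. h (x, u) * ?e ((1 / \<epsilon>) *\<^sub>R w) u"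
    have m: "?G \<in> borel_measurable borel"
    proof (intro smooth_measurable smooth_fun_mult smooth_fun_slice sh)
      from smooth_fun_exp[OF smooth_fun_cmult[OF smooth_fun_linear[OF linear_inner_scaled], of \<i>]]
      show "smooth_fun (\<lambda>u. ?e ((1 / \<epsilon>) *\<^sub>R w) u)" .
    qed
    have G: "?e' t ((1 / \<epsilon>) *\<^sub>R w) * ?G (t + (- \<epsilon>) *\<^sub>R s) = h (x, t - \<epsilon> *\<^sub>R s) * ?e' s w" for s
    proof -
      have "?e' t ((1 / \<epsilon>) *\<^sub>R w) * ?e ((1 / \<epsilon>) *\<^sub>R w) (t + (- \<epsilon>) *\<^sub>R s) = ?e' s w"
        unfolding exp_add[symmetric] using \<epsilon>
        by (intro arg_cong[of _ _ exp])
           (simp add: inner_add_right inner_diff_right inner_commute field_simps)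
      then show ?thesis by (simp add: mult_ac)
    qed
    have "partial_ft c h (x, (1 / \<epsilon>) *\<^sub>R w) = (\<integral>u. ?G u \<partial>lborel)" by (simp add: partial_ft_def)
    also have "\<dots> = of_real (\<bar>- \<epsilon>\<bar> ^ DIM('b)) * (\<integral>s. ?G (t + (- \<epsilon>) *\<^sub>R s) \<partial>lborel)"
      by (rule lborel_integral_affine[OF m]) (use \<epsilon> in simp)
    also have "of_real (\<bar>- \<epsilon>\<bar> ^ DIM('b)) = ?D" using \<epsilon> by simp
    finally have "?e' t ((1 / \<epsilon>) *\<^sub>R w) * partial_ft c h (x, (1 / \<epsilon>) *\<^sub>R w) = ?D * (?e' t ((1 / \<epsilon>) *\<^sub>R w) * (\<integral>s. ?G (t + (- \<epsilon>) *\<^sub>R s) \<partial>lborel))"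
      by (simp only: mult.left_commute)
    also have "?e' t ((1 / \<epsilon>) *\<^sub>R w) * (\<integral>s. ?G (t + (- \<epsilon>) *\<^sub>R s) \<partial>lborel) = (\<integral>s. ?e' t ((1 / \<epsilon>) *\<^sub>R w) * ?G (t + (- \<epsilon>) *\<^sub>R s) \<partial>lborel)"
      by (rule Bochner_Integration.integral_mult_right_zero[symmetric])
    finally show ?thesis unfolding G by (rule sym)
  qed
  let ?J = "\<lambda>w. (\<psi> (\<epsilon> *\<^sub>R w) * partial_ft c h (x, w)) * ?e' t w"
  have mJ: "?J \<in> borel_measurable borel"
  proof (intro smooth_measurable smooth_fun_mult smooth_fun_slice[OF schwartz_smooth[OF partial_ft_schwartz[OF h c]]] smooth_fun_scale s\<psi>)
    from smooth_fun_exp[OF smooth_fun_cmult[OF smooth_fun_linear[OF linear_inner_scaled], of \<i>]]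
    show "smooth_fun (\<lambda>u. ?e' t u)" .
  qed
  have "?D * (\<integral>s. h (x, t - \<epsilon> *\<^sub>R s) * fourier (- c) \<psi> s \<partial>lborel) = ?D * (\<integral>s. \<integral>w. F (s, w) \<partial>lborel \<partial>lborel)"
    by (simp add: fourier_def F_def)
  also have "(\<integral>s. \<integral>w. F (s, w) \<partial>lborel \<partial>lborel) = (\<integral>w. \<integral>s. F (s, w) \<partial>lborel \<partial>lborel)"
    by (rule Fubini_compact_support[OF smooth_fun_continuous[OF sF] Fr])
  also have "?D * \<dots> = (\<integral>w. \<psi> w * (?D * (\<integral>s. h (x, t - \<epsilon> *\<^sub>R s) * ?e' s w \<partial>lborel)) \<partial>lborel)"
  proof -
    have "F (s, w) = \<psi> w * (h (x, t - \<epsilon> *\<^sub>R s) * ?e' s w)" for s w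
      by (simp add: F_def mult_ac)
    then have eq: "(\<integral>s. F (s, w) \<partial>lborel) = \<psi> w * (\<integral>s. h (x, t - \<epsilon> *\<^sub>R s) * ?e' s w \<partial>lborel)" for w
      by (simp only: Bochner_Integration.integral_mult_right_zero)
    have "?D * (\<integral>w. \<integral>s. F (s, w) \<partial>lborel \<partial>lborel) = (\<integral>w. ?D * (\<integral>s. F (s, w) \<partial>lborel) \<partial>lborel)"
      by (rule Bochner_Integration.integral_mult_right_zero[symmetric])
    then show ?thesis by (simp only: eq mult.left_commute)
  qed
  also have "\<dots> = (\<integral>w. ?J (0 + (1 / \<epsilon>) *\<^sub>R w) \<partial>lborel)"
    unfolding inner using \<epsilon> by (simp add: mult_ac)
  also have "\<dots> = ?D * (of_real (\<bar>1 / \<epsilon>\<bar> ^ DIM('b)) * (\<integral>w. ?J (0 + (1 / \<epsilon>) *\<^sub>R w) \<partial>lborel))"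
  proof -
    have "?D * of_real (\<bar>1 / \<epsilon>\<bar> ^ DIM('b)) = 1"
      using \<epsilon> by (simp add: power_divide)
    then show ?thesis by (simp only: mult.assoc[symmetric] mult_1)
  qed
  also have "of_real (\<bar>1 / \<epsilon>\<bar> ^ DIM('b)) * (\<integral>w. ?J (0 + (1 / \<epsilon>) *\<^sub>R w) \<partial>lborel) = (\<integral>w. ?J w \<partial>lborel)"
    by (rule lborel_integral_affine[OF mJ, symmetric]) (use \<epsilon> in simp)
  finally have "(\<integral>s. h (x, t - \<epsilon> *\<^sub>R s) * fourier (- c) \<psi> s \<partial>lborel) = (\<integral>w. ?J w \<partial>lborel)" using D0 by simp
  then show ?thesis by (simp add: partial_ft_def)
qed

section \<open>Supports and the matrix-Wigner transform\<close>

lemma partial_fourier_eq: "partial_fourier g = partial_ft (- (2 * pi)) g"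
proof
  fix z
  have "exp (- 2 * complex_of_real pi * \<i> * complex_of_real (w \<bullet> t)) = exp (\<i> * of_real (- (2 * pi) * (w \<bullet> t)))" for w t :: "real ^ 'a"
    by (intro arg_cong[of _ _ exp]) simp
  then show "partial_fourier g z = partial_ft (- (2 * pi)) g z"
    by (simp only: partial_fourier_def partial_ft_def case_prod_beta)
qed

lemma matrix_wigner_eq:
  "matrix_wigner T u v g = of_real (1 / \<bar>det (map_matrix2 T)\<bar>) *
     tensor_distr u (conj_distr v) (\<lambda>z. partial_ft (- (2 * pi)) g (inv T z))"
  by (simp add: matrix_wigner_def partial_fourier_distr_def pullback_distr_def partial_fourier_eq)

lemma partial_ft_add:
  assumes "test_function f" "test_function g"
  shows "partial_ft c (\<lambda>z. f z + g z) z = partial_ft c f z + partial_ft c g z"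
proof -
  have i: "integrable lborel (\<lambda>w. h (fst z, w) * character c (snd z) w)" if "test_function h" for h
    using integrable_slice[OF smooth_partial_ft_integrand[OF test_functionD(1)[OF that]] proper_partial_ft_integrand[OF that], of c z]
    by (simp add: partial_ft_integrand_def)
  show ?thesis unfolding partial_ft_def distrib_right
    by (rule Bochner_Integration.integral_add[OF i[OF assms(1)] i[OF assms(2)]])
qed

lemma wigner_test_schwartz:
  fixes T :: "(real ^ 'n::finite) \<times> (real ^ 'n) \<Rightarrow> (real ^ 'n) \<times> (real ^ 'n)"
  assumes "linear T" "bij T" "test_function g"
  shows "(\<lambda>z. partial_ft (- (2 * pi)) g (inv T z)) \<in> schwartz_space"
proof (rule schwartz_linear_bij[where L="inv T"])
  show "linear (inv T)" using assms by (simp add: bij_is_inj bij_is_surj inj_linear_imp_inv_linear)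
  show "inj (inv T)" using assms(2) by (simp add: bij_imp_bij_inv bij_is_inj)
  show "partial_ft (- (2 * pi)) g \<in> schwartz_space" by (rule partial_ft_schwartz[OF assms(3)]) simp
qed

lemma matrix_wigner_additive:
  fixes T :: "(real ^ 'n::finite) \<times> (real ^ 'n) \<Rightarrow> (real ^ 'n) \<times> (real ^ 'n)"
  assumes T: "linear T" "bij T" and u: "bounded_functional u" and v: "bounded_functional v"
  shows "additive_on_tests (matrix_wigner T u v)"
  unfolding additive_on_tests_def matrix_wigner_eq
  using bounded_functionalD(1)[OF bounded_functional_tensor[OF u bounded_functional_conj[OF v]]
      wigner_test_schwartz[OF T] wigner_test_schwartz[OF T]]
  by (simp add: partial_ft_add distrib_left)

lemma linear_join_vec: "linear (join_vec :: (real ^ 'n::finite) \<times> (real ^ 'n) \<Rightarrow> _)"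
  by (rule linearI) (simp_all add: join_vec_def vec_eq_iff split: sum.split)

lemma linear_split_vec: "linear (split_vec :: real ^ ('n::finite + 'n) \<Rightarrow> _)"
  by (rule linearI) (simp_all add: split_vec_def vec_eq_iff)

lemma split_join_vec [simp]: "split_vec (join_vec z) = z"
  by (cases z) (simp add: split_vec_def join_vec_def vec_eq_iff)

lemma join_split_vec [simp]: "join_vec (split_vec v) = v"
  by (simp add: split_vec_def join_vec_def vec_eq_iff split: sum.split)

lemma linear_joined: "linear S \<Longrightarrow> linear (\<lambda>v. join_vec (S (split_vec v)))"
  using linear_compose[OF linear_compose[OF linear_split_vec] linear_join_vec] by (simp add: o_def)

lemma det_map_matrix2_nonzero:
  assumes "linear T" "bij T" shows "det (map_matrix2 T) \<noteq> 0"
proof -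
  have "inj (\<lambda>v. join_vec (T (split_vec v)))"
    by (intro injI) (metis assms(2) bij_is_inj injD join_split_vec split_join_vec)
  then show ?thesis unfolding map_matrix2_def using det_nz_iff_inj[OF linear_joined[OF assms(1)]] by blast
qed

lemma fst_block_matrix:
  assumes S: "linear S" and M: "map_matrix2 S = block_matrix A B C D"
  shows "fst (S (x, y)) = A *v x + B *v y"
proof -
  have "join_vec (S (x, y)) = map_matrix2 S *v join_vec (x, y)"
    unfolding map_matrix2_def using fun_cong[OF matrix_vector_mul(2)[OF linear_joined[OF S]], of "join_vec (x, y)"] by simp
  then have "fst (S (x, y)) $ i = (block_matrix A B C D *v join_vec (x, y)) $ Inl i" for i
    unfolding M by (simp add: join_vec_def vec_eq_iff[of "\<chi> i. _ i"]) (metis sum.case(1) vec_lambda_beta)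
  also have "(block_matrix A B C D *v join_vec (x, y)) $ Inl i = (A *v x + B *v y) $ i" for i
    unfolding matrix_vector_mult_def
    by (simp add: UNIV_Plus_UNIV[symmetric] sum.Plus block_matrix_def join_vec_def del: UNIV_Plus_UNIV)
  finally show ?thesis by (simp add: vec_eq_iff)
qed

text \<open>Suppose that \<open>p\<close>, the first component of \<open>T\<^sup>-\<^sup>1 (x0, y0)\<close>, is not in the projection of the support; then a ball
around \<open>p\<close> avoids it. Choose \<open>\<phi>\<close> near \<open>x0\<close> and \<open>\<psi>\<close> near \<open>y0\<close> on which \<open>\<mu>\<close> and the conjugate of \<open>\<nu>\<close> do not
vanish, so near that \<open>h = (\<phi> \<otimes> \<psi>) \<circ> T\<close> has its first coordinate in this ball. The windowed inverse partial
transforms \<open>g \<epsilon>\<close> of \<open>h\<close> are test functions off the support of the Wigner transform. The Wigner transform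
of \<open>g \<epsilon>\<close> is a nonzero multiple of the tensor product evaluated at a mollification of \<open>\<phi> \<otimes> \<psi>\<close> along \<open>T (0, s)\<close>.
Letting \<open>\<epsilon>\<close> tend to \<open>0\<close>, the tensor product vanishes at \<open>\<phi> \<otimes> \<psi>\<close>, a contradiction.\<close>

lemma support_relation:
  fixes T :: "(real ^ 'n::finite) \<times> (real ^ 'n) \<Rightarrow> (real ^ 'n) \<times> (real ^ 'n)"
  assumes T: "linear T" "bij T" and \<mu>: "bounded_functional \<mu>" and \<nu>: "bounded_functional \<nu>"
    and cl: "closed (fst ` distr_supp (matrix_wigner T \<mu> \<nu>))"
    and x0: "x0 \<in> distr_supp \<mu>" and y0: "y0 \<in> distr_supp \<nu>"
  shows "fst (inv T (x0, y0)) \<in> fst ` distr_supp (matrix_wigner T \<mu> \<nu>)"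
proof (rule ccontr)
  let ?W = "matrix_wigner T \<mu> \<nu>" and ?I = "tensor_distr \<mu> (conj_distr \<nu>)"
  let ?P = "fst ` distr_supp ?W" and ?c = "2 * pi"
  define p where "p = fst (inv T (x0, y0))"
  assume "fst (inv T (x0, y0)) \<notin> ?P"
  then obtain r where r: "0 < r" "cball p r \<subseteq> - ?P"
    using cl unfolding p_def by (meson ComplI open_Compl open_contains_cball)
  have linv: "linear (inv T)" using T by (simp add: bij_is_inj bij_is_surj inj_linear_imp_inv_linear)
  have bI: "bounded_functional ?I" by (intro bounded_functional_tensor \<mu> bounded_functional_conj \<nu>)
  let ?O = "{z. fst (inv T z) \<in> ball p r}"
  have "open ?O"
  proof -
    have "continuous_on UNIV (\<lambda>z. fst (inv T z))"
      by (intro continuous_on_fst linear_continuous_on) (use linv linear_conv_bounded_linear in blast)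
    then show ?thesis using open_vimage[of "ball p r" "\<lambda>z. fst (inv T z)"] by (simp add: vimage_def)
  qed
  moreover have "(x0, y0) \<in> ?O" using r(1) by (simp add: p_def)
  ultimately obtain U V where UV: "open U" "open V" "x0 \<in> U" "y0 \<in> V" "U \<times> V \<subseteq> ?O"
    by (rule open_prod_elim) auto
  obtain \<phi> where \<phi>: "test_function \<phi>" "closure {x. \<phi> x \<noteq> 0} \<subseteq> U" "\<mu> \<phi> \<noteq> 0"
    using support_nonzero[OF x0 UV(1,3)] by blast
  have "y0 \<in> distr_supp (conj_distr \<nu>)" using y0 distr_supp_conj by blast
  then obtain \<psi> where \<psi>: "test_function \<psi>" "closure {x. \<psi> x \<noteq> 0} \<subseteq> V" "conj_distr \<nu> \<psi> \<noteq> 0"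
    using support_nonzero[OF _ UV(2,4)] by blast
  define e where "e z = \<phi> (fst z) * \<psi> (snd z)" for z :: "(real ^ 'n) \<times> (real ^ 'n)"
  have te: "test_function e" unfolding e_def[abs_def] by (intro test_tensor \<phi> \<psi>)
  have "?I e = \<mu> (\<lambda>x. conj_distr \<nu> \<psi> * \<phi> x)"
    unfolding tensor_distr_def e_def
    using bounded_functionalD(2)[OF bounded_functional_conj[OF \<nu>] test_function_schwartz[OF \<psi>(1)]]
    by (simp add: mult.commute)
  also have "\<dots> = conj_distr \<nu> \<psi> * \<mu> \<phi>" by (rule bounded_functionalD(2)[OF \<mu> test_function_schwartz[OF \<phi>(1)]])
  finally have Ie: "?I e \<noteq> 0" using \<phi>(3) \<psi>(3) by simp
  define h where "h z = e (T z)" for z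
  obtain q where q: "\<And>z. e z \<noteq> 0 \<Longrightarrow> norm z \<le> q" using test_functionD(2)[OF te] by auto
  obtain B where B: "B > 0" "\<And>z. B * norm z \<le> norm (T z)"
    using linear_inj_bounded_below_pos[OF T(1) bij_is_inj[OF T(2)]] by blast
  have th: "test_function h"
  proof (rule test_functionI)
    show "smooth_fun h" unfolding h_def[abs_def] using smooth_fun_affine[OF test_functionD(1)[OF te] T(1), of 0] by simp
    fix z assume "h z \<noteq> 0"
    then have "B * norm z \<le> q" using q[of "T z"] B(2)[of z] by (simp add: h_def)
    then show "norm z \<le> q / B" using B(1) by (simp add: field_simps)
  qed
  have hsupp: "x \<in> ball p r" if "h (x, s) \<noteq> 0" for x s
  proof -
    have nz: "\<phi> (fst (T (x, s))) \<noteq> 0" "\<psi> (snd (T (x, s))) \<noteq> 0" using that by (auto simp: h_def e_def)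
    have "fst (T (x, s)) \<in> U" by (rule subsetD[OF \<phi>(2) subsetD[OF closure_subset]]) (simp add: nz)
    moreover have "snd (T (x, s)) \<in> V" by (rule subsetD[OF \<psi>(2) subsetD[OF closure_subset]]) (simp add: nz)
    ultimately have "T (x, s) \<in> U \<times> V" by (simp add: mem_Times_iff)
    then have "T (x, s) \<in> ?O" by (rule subsetD[OF UV(5)])
    then show ?thesis using T(2) by (simp add: bij_is_inj)
  qed
  obtain \<omega> :: "real ^ 'n \<Rightarrow> complex" where \<omega>: "test_function \<omega>" "(\<integral>t. fourier (- ?c) \<omega> t \<partial>lborel) = 1"
    using exists_kernel[of "- ?c"] by auto
  let ?K = "fourier (- ?c) \<omega>" and ?L = "\<lambda>s. T (0, s)"
  have KS: "?K \<in> schwartz_space" by (rule fourier_schwartz[OF \<omega>(1)]) simp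
  have L: "linear ?L"
  proof -
    have "linear (\<lambda>s::real ^ 'n. (0 :: real ^ 'n, s))" by (auto intro!: linearI)
    from linear_compose[OF this T(1)] show ?thesis by (simp add: o_def)
  qed
  define g where "g \<epsilon> z = \<omega> (\<epsilon> *\<^sub>R snd z) * partial_ft ?c h z" for \<epsilon> z
  have tg: "test_function (g \<epsilon>)" if "0 < \<epsilon>" for \<epsilon>
    unfolding g_def[abs_def] by (rule windowed_test_function[OF th \<omega>(1) _ that]) simp
  have moll: "mollify ?K (\<lambda>s. \<epsilon> *\<^sub>R ?L s) e = (\<lambda>z. partial_ft (- ?c) (g \<epsilon>) (inv T z))" if "0 < \<epsilon>" for \<epsilon>
  proof
    fix z
    obtain x t where xt: "inv T z = (x, t)" by (cases "inv T z")
    then have z: "z = T (x, t)" using T(2) by (metis bij_inv_eq_iff)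
    have "e (z - \<epsilon> *\<^sub>R ?L s) = h (x, t - \<epsilon> *\<^sub>R s)" for s
      using linear_diff[OF T(1), of "(x, t)" "\<epsilon> *\<^sub>R (0, s)"] linear_cmul[OF T(1), of \<epsilon> "(0, s)"]
      by (simp add: h_def z)
    then show "mollify ?K (\<lambda>s. \<epsilon> *\<^sub>R ?L s) e z = partial_ft (- ?c) (g \<epsilon>) (inv T z)"
      unfolding xt g_def[abs_def] mollify_def using partial_ft_windowed[OF th \<omega>(1) _ that, of ?c x t] by simp
  qed
  have Wg: "?W (g \<epsilon>) = 0" if "0 < \<epsilon>" for \<epsilon>
  proof (rule vanishes_off_support[OF matrix_wigner_additive[OF T \<mu> \<nu>] tg[OF that]])
    have "fst z \<in> cball p r" if "g \<epsilon> z \<noteq> 0" for z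
    proof (rule ccontr)
      assume "fst z \<notin> cball p r"
      then have "h (fst z, s) = 0" for s using hsupp[of "fst z" s] ball_subset_cball[of p r] by blast
      then show False using that by (simp add: g_def partial_ft_def)
    qed
    then have "{z. g \<epsilon> z \<noteq> 0} \<subseteq> cball p r \<times> UNIV" by (auto simp: mem_Times_iff)
    then have "closure {z. g \<epsilon> z \<noteq> 0} \<subseteq> cball p r \<times> UNIV"
      by (rule closure_minimal) (intro closed_Times closed_cball closed_UNIV)
    then have "fst z \<notin> ?P" if "z \<in> closure {z. g \<epsilon> z \<noteq> 0}" for z
    proof -
      have "z \<in> cball p r \<times> UNIV" by (rule subsetD) fact+
      then have "fst z \<in> cball p r" by (simp only: mem_Times_iff)
      then show ?thesis using r(2) by blast
    qed
    then show "closure {z. g \<epsilon> z \<noteq> 0} \<inter> distr_supp ?W = {}" by blast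
  qed
  have "?I e = 0"
  proof (rule mollify_converges[OF bI test_function_schwartz[OF te] KS L \<omega>(2)])
    fix \<epsilon> :: real assume \<epsilon>: "0 < \<epsilon>"
    show "mollify ?K (\<lambda>s. \<epsilon> *\<^sub>R ?L s) e \<in> schwartz_space"
      unfolding moll[OF \<epsilon>] by (rule wigner_test_schwartz[OF T tg[OF \<epsilon>]])
    show "?I (mollify ?K (\<lambda>s. \<epsilon> *\<^sub>R ?L s) e) = 0"
      using Wg[OF \<epsilon>] det_map_matrix2_nonzero[OF T] unfolding moll[OF \<epsilon>] matrix_wigner_eq by simp
  qed
  with Ie show False by simp
qed

section \<open>Uniform discreteness\<close>

lemma uniform_discrete_preimage:
  fixes A :: "real ^ 'n::finite ^ 'n"
  assumes P: "uniform_discrete P" and A: "det A \<noteq> 0" and S: "\<And>x. x \<in> S \<Longrightarrow> A *v x + c \<in> P"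
  shows "uniform_discrete S"
proof -
  obtain \<delta> where \<delta>: "0 < \<delta>" "\<And>x y. x \<in> P \<Longrightarrow> y \<in> P \<Longrightarrow> dist x y < \<delta> \<Longrightarrow> x = y"
    using P unfolding uniform_discrete_def by blast
  obtain K where K: "0 < K" "\<And>x. norm (A *v x) \<le> norm x * K"
    using bounded_linear.pos_bounded[OF matrix_vector_mul_bounded_linear[of A]] by blast
  have inj: "x = y" if "A *v x = A *v y" for x y
    using A that inj_matrix_vector_mult[of A] invertible_det_nz injD by metis
  have "x = y" if "x \<in> S" "y \<in> S" "dist x y < \<delta> / K" for x y
  proof -
    have "dist (A *v x + c) (A *v y + c) = norm (A *v (x - y))"
      by (simp add: dist_norm matrix_vector_mult_diff_distrib)
    also have "\<dots> \<le> dist x y * K" using K(2)[of "x - y"] by (simp add: dist_norm)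
    also have "\<dots> < \<delta>" using that(3) K(1) by (simp add: field_simps)
    finally show ?thesis using \<delta>(2)[OF S[OF that(1)] S[OF that(2)]] inj by simp
  qed
  then show ?thesis unfolding uniform_discrete_def using \<delta>(1) K(1) by (intro exI[of _ "\<delta> / K"]) auto
qed

text \<open>With one \<open>y\<close> in the support of \<open>\<nu>\<close> fixed, the map \<open>x \<mapsto> A x + B y\<close> sends the support of \<open>\<mu>\<close> into a uniformly
discrete set. Uniform discreteness provides closedness of that set for the support relation.\<close>

lemma matrix_wigner_uniform_discrete:
  fixes T :: "(real ^ 'n::finite) \<times> (real ^ 'n) \<Rightarrow> (real ^ 'n) \<times> (real ^ 'n)"
  assumes T: "linear T" "bij T" and M: "map_matrix2 (inv T) = block_matrix A B C D"
    and \<mu>: "tempered_distribution \<mu>" and \<nu>: "tempered_distribution \<nu>"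
    and P: "uniform_discrete (fst ` distr_supp (matrix_wigner T \<mu> \<nu>))"
  shows "det A \<noteq> 0 \<Longrightarrow> \<not> zero_distribution \<nu> \<Longrightarrow> uniform_discrete (distr_supp \<mu>)"
    and "det B \<noteq> 0 \<Longrightarrow> \<not> zero_distribution \<mu> \<Longrightarrow> uniform_discrete (distr_supp \<nu>)"
proof -
  note b\<mu> = tempered_imp_bounded[OF \<mu>] and b\<nu> = tempered_imp_bounded[OF \<nu>]
  have "linear (inv T)" using T by (simp add: bij_is_inj bij_is_surj inj_linear_imp_inv_linear)
  then have rel: "A *v x + B *v y \<in> fst ` distr_supp (matrix_wigner T \<mu> \<nu>)"
    if "x \<in> distr_supp \<mu>" "y \<in> distr_supp \<nu>" for x y
    using support_relation[OF T b\<mu> b\<nu> uniform_discrete_imp_closed[OF P] that] fst_block_matrix[OF _ M] by metis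
  show "uniform_discrete (distr_supp \<mu>)" if A: "det A \<noteq> 0" and nz: "\<not> zero_distribution \<nu>"
  proof -
    obtain y where "y \<in> distr_supp \<nu>" using nonzero_imp_support_nonempty[OF b\<nu> nz] by blast
    then show ?thesis using rel by (intro uniform_discrete_preimage[OF P A, of _ "B *v y"])
  qed
  show "uniform_discrete (distr_supp \<nu>)" if B: "det B \<noteq> 0" and nz: "\<not> zero_distribution \<mu>"
  proof -
    obtain x where "x \<in> distr_supp \<mu>" using nonzero_imp_support_nonempty[OF b\<mu> nz] by blast
    then show ?thesis using rel by (intro uniform_discrete_preimage[OF P B, of _ "A *v x"]) (simp add: add.commute)
  qed
qed

lemma wigner_coord_properties:
  shows linear_wigner_coord: "linear (wigner_coord :: (real ^ 'n::finite) \<times> (real ^ 'n) \<Rightarrow> _)"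
    and bij_wigner_coord: "bij (wigner_coord :: (real ^ 'n) \<times> (real ^ 'n) \<Rightarrow> _)"
    and inv_wigner_coord: "inv (wigner_coord :: (real ^ 'n) \<times> (real ^ 'n) \<Rightarrow> _) = (\<lambda>(a, b). ((1/2) *\<^sub>R a + (1/2) *\<^sub>R b, a - b))"
proof -
  let ?w = "wigner_coord :: (real ^ 'n) \<times> (real ^ 'n) \<Rightarrow> _"
  let ?i = "\<lambda>(a :: real ^ 'n, b). ((1/2) *\<^sub>R a + (1/2) *\<^sub>R b, a - b)"
  show "linear ?w"
    by (rule linearI) (auto simp: wigner_coord_def algebra_simps)
  have 1: "?i (?w z) = z" for z
    by (cases z) (simp add: wigner_coord_def vec_eq_iff field_simps)
  have 2: "?w (?i z) = z" for z
    by (cases z) (simp add: wigner_coord_def vec_eq_iff field_simps)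
  show "bij ?w" by (rule o_bij[of ?i]) (auto simp: fun_eq_iff 1 2 simp del: split_paired_All)
  show "inv ?w = ?i" by (rule inv_equality) (use 1 2 in auto)
qed

lemma map_matrix2_inv_wigner_coord:
  "map_matrix2 (inv (wigner_coord :: (real ^ 'n::finite) \<times> (real ^ 'n) \<Rightarrow> _)) =
     block_matrix ((1/2) *\<^sub>R mat 1) ((1/2) *\<^sub>R mat 1) (mat 1) (- mat 1)"
proof -
  have "map_matrix2 (inv (wigner_coord :: (real ^ 'n) \<times> (real ^ 'n) \<Rightarrow> _)) $ i $ j =
     block_matrix ((1/2) *\<^sub>R mat 1) ((1/2) *\<^sub>R mat 1) (mat 1) (- mat 1) $ i $ j" for i j :: "'n + 'n"
    by (cases i; cases j)
       (simp_all add: map_matrix2_def matrix_def inv_wigner_coord join_vec_def split_vec_def block_matrix_def mat_def axis_def)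
  then show ?thesis by (simp add: vec_eq_iff)
qed

lemma det_scaled_identity: "k \<noteq> 0 \<Longrightarrow> det (k *\<^sub>R mat 1 :: real ^ 'n::finite ^ 'n) \<noteq> 0"
  by (subst det_diagonal) (simp_all add: mat_def)

theorem proposition12:
  fixes T :: "(real ^ 'n::finite) \<times> (real ^ 'n) \<Rightarrow> (real ^ 'n) \<times> (real ^ 'n)"
    and A B C D :: "real ^ 'n ^ 'n"
    and \<mu> \<nu> :: "(real ^ 'n) functional"
  assumes "linear T" and "bij T"
    and "map_matrix2 (inv T) = block_matrix A B C D"
    and "tempered_distribution \<mu>" and "tempered_distribution \<nu>"
  shows
    "(uniform_discrete (fst ` distr_supp (matrix_wigner T \<mu> \<nu>)) \<longrightarrow>
        (det A \<noteq> 0 \<and> \<not> zero_distribution \<nu> \<longrightarrow> uniform_discrete (distr_supp \<mu>)) \<and>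
        (det B \<noteq> 0 \<and> \<not> zero_distribution \<mu> \<longrightarrow> uniform_discrete (distr_supp \<nu>))) \<and>
     (linear (wigner_coord :: (real ^ 'n) \<times> (real ^ 'n) \<Rightarrow> _) \<and>
      bij (wigner_coord :: (real ^ 'n) \<times> (real ^ 'n) \<Rightarrow> _) \<and>
      map_matrix2 (inv wigner_coord) =
        block_matrix ((1/2) *\<^sub>R mat 1 :: real ^ 'n ^ 'n) ((1/2) *\<^sub>R mat 1) (mat 1) (- mat 1) \<and>
      det ((1/2) *\<^sub>R mat 1 :: real ^ 'n ^ 'n) \<noteq> 0 \<and>
      det (mat 1 :: real ^ 'n ^ 'n) \<noteq> 0 \<and>
      det (- mat 1 :: real ^ 'n ^ 'n) \<noteq> 0 \<and>
      (uniform_discrete (fst ` distr_supp (wigner \<mu> \<nu>)) \<longrightarrow>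
        (\<not> zero_distribution \<nu> \<longrightarrow> uniform_discrete (distr_supp \<mu>)) \<and>
        (\<not> zero_distribution \<mu> \<longrightarrow> uniform_discrete (distr_supp \<nu>))))"
proof -
  have half: "det ((1/2) *\<^sub>R mat 1 :: real ^ 'n ^ 'n) \<noteq> 0" by (rule det_scaled_identity) simp
  have "det (- mat 1 :: real ^ 'n ^ 'n) \<noteq> 0" using det_scaled_identity[of "-1", where 'n='n] by simp
  moreover note half linear_wigner_coord bij_wigner_coord map_matrix2_inv_wigner_coord det_I
    matrix_wigner_uniform_discrete[OF assms]
    matrix_wigner_uniform_discrete[OF linear_wigner_coord bij_wigner_coord map_matrix2_inv_wigner_coord assms(4,5)]
  ultimately show ?thesis unfolding wigner_def by simp
qed

end
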